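(* Any simple Harish-Chandra $\mathcal{S}(\frac12)$-module is isomorphic to one of the following $\mathcal{S}(\frac12)$-modules. (1) $V^{\mathcal{S}(\frac12)}$, where $V$ is a simple Harish-Chandra $\mathrm{Vir}$-module and $F(\frac12)V=0$; (2) $\mathscr{V}(\frac12)^\lambda\otimes V^{\mathcal{S}(\frac12)}$, where $\lambda\in\mathbb{C}^*$ and $V$ is a simple highest weight $\mathrm{Vir}$-module, and $\mathscr{V}(\frac12)^\lambda$ is considered as an $\mathcal{S}(\frac12)$-module; (3) the restricted dual of a module in (2).
   Context: All vector spaces and algebras are over $\mathbb{C}$; $\mathbb{Z}_+$ is the set of non-negative integers, $\mathbb{C}^*$ the nonzero complex numbers. Modules over Lie superalgebras are $\mathbb{Z}_2$-graded, and simple means having no nonzero proper graded submodule. The Virasoro algebra is regarded as a purely even Lie superalgebra, so a simple $\mathrm{Vir}$-module is concentrated in a single parity, which may be even or odd. The Fermion-Virasoro algebra $\mathcal{S}(\frac12)$ is the Lie superalgebra with basis $\{L_m,\psi_n,c,z:m\in\mathbb{Z},n\in\mathbb{Z}+\frac12\}$, where $L_m,c,z$ are even and $\psi_n$ odd, with $$[L_m,L_n]=(m-n)L_{m+n}+\delta_{m,-n}\tfrac{m^3-m}{12}c,\quad [L_m,\psi_n]=(-n-\tfrac m2)\psi_{m+n},\quad [\psi_m,\psi_n]=\delta_{m,-n}z,$$ and $c,z$ central. It contains $\mathrm{Vir}=\mathrm{span}\{c,L_i:i\in\mathbb{Z}\}$ and $F(\frac12)=\mathrm{span}\{z,\psi_i:i\in\mathbb{Z}+\frac12\}$.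 A module $V$ over $\mathcal{S}(\frac12)$ or $\mathrm{Vir}$ is a weight module if $V=\bigoplus_{\alpha\in\mathbb{C}}V_\alpha$ with $V_\alpha=\{v:L_0v=\alpha v\}$; it is a Harish-Chandra module if moreover all $V_\alpha$ are finite-dimensional. A weight $\mathrm{Vir}$-module is a highest weight module if $\{\alpha:V_\alpha\ne0\}\subset\alpha_0+\mathbb{Z}_+$ for some $\alpha_0\in\mathbb{C}$ (note $L_m$ with $m>0$ lowers the $L_0$-eigenvalue by $m$). The restricted dual of a Harish-Chandra module $V=\bigoplus_\alpha V_\alpha$ is $\bigoplus_\alpha (V_\alpha)^*$ with the usual dual (contragredient) action of the Lie superalgebra. $\mathscr{V}(\frac12)$ is the exterior algebra generated by odd elements $\xi_i$, $i\in\mathbb{Z}_++\frac12$. It is an $F(\frac12)$-module: for $n\in\mathbb{Z}_++\frac12$, $\psi_n$ acts as the odd derivation $\partial/\partial\xi_n$, $\psi_{-n}$ as left multiplication by $\xi_n$, $z$ as the identity. It is an $\mathcal{S}(\frac12)$-module with $c$ acting as $\frac12$ and $L_k$ acting as $$\bar L_k=\tfrac12\sum_{j\in\mathbb{Z}+\frac12}j:\psi_{-j}\psi_{j+k}:,$$ where $:\psi_j\psi_k:\,=\psi_j\psi_k$ if $k\ge j$ and $-\psi_k\psi_j$ if $k<j$. For $\mu\in\mathbb{C}^*$, $\sigma_\mu$ is the automorphism of $\mathcal{S}(\frac12)$ with $\sigma_\mu(L_k)=L_k$, $\sigma_\mu(\psi_l)=\mu\psi_l$, $\sigma_\mu(c)=c$,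 $\sigma_\mu(z)=\mu^2z$, and for an $\mathcal{S}(\frac12)$-module $W$, $W^\mu$ is the same space with action $x\cdot v=\sigma_\mu(x)v$. For a $\mathrm{Vir}$-module $V$, $V^{\mathcal{S}(\frac12)}$ denotes $V$ made into an $\mathcal{S}(\frac12)$-module by $F(\frac12)\cdot V=0$. Tensor products are the usual tensor products of modules over a Lie superalgebra. *)

theory Defs
  imports
    Complex_Main
    "HOL-Library.FSet"
    "HOL-Library.Poly_Mapping"
    "HOL-Library.Groups_Big_Fun"
    "HOL-Library.Function_Algebras"
begin

text \<open>
  Vector spaces are subspaces of an ambient type of class \<^class>\<open>ab_group_add\<close> with an explicit
  complex scalar multiplication, in the style of \<^locale>\<open>vector_space\<close>.  Elements of a vector
  space with a given basis are finitely supported coefficient functions on the basis.  The group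
  \<open>\<int>\<^sub>2\<close> is represented by \<^typ>\<open>bool\<close>: \<^const>\<open>True\<close> is the odd parity and addition is
  inequality of truth values.
\<close>

definition pscale :: "complex \<Rightarrow> ('k \<Rightarrow>\<^sub>0 complex) \<Rightarrow> ('k \<Rightarrow>\<^sub>0 complex)" where
  "pscale a x = Poly_Mapping.map ((*) a) x"

definition fscale :: "complex \<Rightarrow> ('k \<Rightarrow> complex) \<Rightarrow> ('k \<Rightarrow> complex)" where
  "fscale a f = (\<lambda>k. a * f k)"

definition lin_extend :: "(complex \<Rightarrow> 'b::ab_group_add \<Rightarrow> 'b) \<Rightarrow> ('k \<Rightarrow> 'b) \<Rightarrow> ('k \<Rightarrow>\<^sub>0 complex) \<Rightarrow> 'b"
  where "lin_extend s f x = (\<Sum>k\<in>Poly_Mapping.keys x. s (Poly_Mapping.lookup x k) (f k))"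

lemma lookup_pscale [simp]:
  "Poly_Mapping.lookup (pscale a x) k = a * Poly_Mapping.lookup x k"
  by (simp add: pscale_def Poly_Mapping.map.rep_eq when_def)

lemma vector_space_pscale: "vector_space (pscale :: complex \<Rightarrow> ('k \<Rightarrow>\<^sub>0 complex) \<Rightarrow> _)"
  by unfold_locales (auto intro!: poly_mapping_eqI simp: lookup_add algebra_simps)

lemma vector_space_fscale: "vector_space (fscale :: complex \<Rightarrow> ('k \<Rightarrow> complex) \<Rightarrow> _)"
  by unfold_locales (auto simp: fscale_def fun_eq_iff algebra_simps)


section \<open>The Lie superalgebra\<close>

text \<open>A half-integer is represented by its integer part: \<open>r\<close> stands for \<open>r + 1/2\<close>, so that
  \<open>GenPsi r\<close> is \<open>\<psi>\<close> with index \<open>r + 1/2\<close>.\<close>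

datatype gen = GenL int | GenPsi int | GenC | GenZ

type_synonym fvir = "gen \<Rightarrow>\<^sub>0 complex"

definition half :: "int \<Rightarrow> complex" where
  "half r = of_int r + 1 / 2"

abbreviation unit_vec :: "'k \<Rightarrow> ('k \<Rightarrow>\<^sub>0 complex)" where
  "unit_vec k \<equiv> Poly_Mapping.single k 1"

fun gen_bracket :: "gen \<Rightarrow> gen \<Rightarrow> fvir" where
  "gen_bracket (GenL m) (GenL n) =
     Poly_Mapping.single (GenL (m + n)) (of_int (m - n))
     + (if m = - n then Poly_Mapping.single GenC ((of_int m ^ 3 - of_int m) / 12) else 0)"
| "gen_bracket (GenL m) (GenPsi r) =
     Poly_Mapping.single (GenPsi (m + r)) (- half r - of_int m / 2)"
| "gen_bracket (GenPsi r) (GenL m) =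
     - Poly_Mapping.single (GenPsi (m + r)) (- half r - of_int m / 2)"
| "gen_bracket (GenPsi r) (GenPsi s) = (if half r = - half s then unit_vec GenZ else 0)"
| "gen_bracket GenC _ = 0"
| "gen_bracket GenZ _ = 0"
| "gen_bracket _ GenC = 0"
| "gen_bracket _ GenZ = 0"

definition bracket :: "fvir \<Rightarrow> fvir \<Rightarrow> fvir" where
  "bracket x y = lin_extend pscale (\<lambda>g. lin_extend pscale (gen_bracket g) y) x"

fun gen_parity :: "gen \<Rightarrow> bool" where
  "gen_parity (GenPsi r) = True"
| "gen_parity _ = False"

definition fvir_part :: "bool \<Rightarrow> fvir set" where
  "fvir_part p = {x. \<forall>g\<in>Poly_Mapping.keys x. gen_parity g = p}"

definition fvir_proj :: "bool \<Rightarrow> fvir \<Rightarrow> fvir" where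
  "fvir_proj p = lin_extend pscale (\<lambda>g. if gen_parity g = p then unit_vec g else 0)"

abbreviation FVir :: "fvir set" where
  "FVir \<equiv> UNIV"

definition Vir :: "fvir set" where
  "Vir = module.span pscale (insert (unit_vec GenC) (range (\<lambda>i. unit_vec (GenL i))))"

definition sigma :: "complex \<Rightarrow> fvir \<Rightarrow> fvir" where
  "sigma \<mu> = lin_extend pscale (\<lambda>g. case g of
       GenL k \<Rightarrow> unit_vec (GenL k)
     | GenPsi r \<Rightarrow> Poly_Mapping.single (GenPsi r) \<mu>
     | GenC \<Rightarrow> unit_vec GenC
     | GenZ \<Rightarrow> Poly_Mapping.single GenZ (\<mu>\<^sup>2))"


section \<open>Modules\<close>

text \<open>The homogeneous components of a module are the sets \<open>part M False\<close> (even) and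
  \<open>part M True\<close> (odd); values of \<open>act\<close> outside the acting algebra or outside the
  underlying space carry no meaning.\<close>

record 'a smod =
  scal :: "complex \<Rightarrow> 'a \<Rightarrow> 'a"
  part :: "bool \<Rightarrow> 'a set"
  act :: "fvir \<Rightarrow> 'a \<Rightarrow> 'a"

definition carr :: "'a::ab_group_add smod \<Rightarrow> 'a set" where
  "carr M = {a + b |a b. a \<in> part M False \<and> b \<in> part M True}"

text \<open>\<open>g\<close> is a graded subalgebra, in our use either \<open>FVir\<close> or \<open>Vir\<close>.\<close>

definition supermodule :: "fvir set \<Rightarrow> 'a::ab_group_add smod \<Rightarrow> bool" where
  "supermodule g M \<longleftrightarrow>
     vector_space (scal M) \<and>
     (\<forall>p. module.subspace (scal M) (part M p)) \<and>
     part M False \<inter> part M True = {0} \<and>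
     (\<forall>x\<in>g. \<forall>v\<in>carr M. \<forall>w\<in>carr M. act M x (v + w) = act M x v + act M x w) \<and>
     (\<forall>x\<in>g. \<forall>v\<in>carr M. \<forall>a. act M x (scal M a v) = scal M a (act M x v)) \<and>
     (\<forall>x\<in>g. \<forall>y\<in>g. \<forall>v\<in>carr M. act M (x + y) v = act M x v + act M y v) \<and>
     (\<forall>x\<in>g. \<forall>v\<in>carr M. \<forall>a. act M (pscale a x) v = scal M a (act M x v)) \<and>
     (\<forall>p q. \<forall>x\<in>g \<inter> fvir_part p. \<forall>v\<in>part M q. act M x v \<in> part M (p \<noteq> q)) \<and>
     (\<forall>p q. \<forall>x\<in>g \<inter> fvir_part p. \<forall>y\<in>g \<inter> fvir_part q. \<forall>v\<in>carr M.
        act M (bracket x y) v =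
          act M x (act M y v) - scal M (if p \<and> q then - 1 else 1) (act M y (act M x v)))"

definition graded_submodule :: "fvir set \<Rightarrow> 'a::ab_group_add smod \<Rightarrow> 'a set \<Rightarrow> bool" where
  "graded_submodule g M N \<longleftrightarrow>
     module.subspace (scal M) N \<and> N \<subseteq> carr M \<and>
     N = {a + b |a b. a \<in> N \<inter> part M False \<and> b \<in> N \<inter> part M True} \<and>
     (\<forall>x\<in>g. \<forall>v\<in>N. act M x v \<in> N)"

definition simple_supermodule :: "fvir set \<Rightarrow> 'a::ab_group_add smod \<Rightarrow> bool" where
  "simple_supermodule g M \<longleftrightarrow>
     supermodule g M \<and> carr M \<noteq> {0} \<and>
     (\<forall>N. graded_submodule g M N \<longrightarrow> N = {0} \<or> N = carr M)"

definition weight_space :: "'a::ab_group_add smod \<Rightarrow> complex \<Rightarrow> 'a set" where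
  "weight_space M \<alpha> = {v \<in> carr M. act M (unit_vec (GenL 0)) v = scal M \<alpha> v}"

text \<open>The sum of the weight spaces is automatically direct, as for all eigenspaces.\<close>

definition weight_module :: "'a::ab_group_add smod \<Rightarrow> bool" where
  "weight_module M \<longleftrightarrow> carr M = module.span (scal M) (\<Union>\<alpha>. weight_space M \<alpha>)"

definition harish_chandra :: "'a::ab_group_add smod \<Rightarrow> bool" where
  "harish_chandra M \<longleftrightarrow>
     weight_module M \<and> (\<forall>\<alpha>. \<exists>B. finite B \<and> weight_space M \<alpha> = module.span (scal M) B)"

definition highest_weight :: "'a::ab_group_add smod \<Rightarrow> bool" where
  "highest_weight M \<longleftrightarrow>
     weight_module M \<and>
     (\<exists>\<alpha>\<^sub>0. {\<alpha>. weight_space M \<alpha> \<noteq> {0}} \<subseteq> range (\<lambda>n::nat. \<alpha>\<^sub>0 + of_nat n))"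

text \<open>Isomorphisms preserve the parity.\<close>

definition smod_iso :: "fvir set \<Rightarrow> 'a::ab_group_add smod \<Rightarrow> 'b::ab_group_add smod \<Rightarrow> bool" where
  "smod_iso g M N \<longleftrightarrow> (\<exists>\<phi>.
     bij_betw \<phi> (carr M) (carr N) \<and>
     (\<forall>v\<in>carr M. \<forall>w\<in>carr M. \<phi> (v + w) = \<phi> v + \<phi> w) \<and>
     (\<forall>v\<in>carr M. \<forall>a. \<phi> (scal M a v) = scal N a (\<phi> v)) \<and>
     (\<forall>p. \<phi> ` part M p \<subseteq> part N p) \<and>
     (\<forall>x\<in>g. \<forall>v\<in>carr M. \<phi> (act M x v) = act N x (\<phi> v)))"


section \<open>Constructions of modules\<close>

definition twist :: "complex \<Rightarrow> 'a smod \<Rightarrow> 'a smod" where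
  "twist \<mu> W = W\<lparr>act := (\<lambda>x. act W (sigma \<mu> x))\<rparr>"

text \<open>A \<open>Vir\<close>-module is extended by letting every \<open>\<psi>\<close> and \<open>z\<close> act as zero, that is, by letting
  an element act through its component in \<open>Vir\<close>.\<close>

definition inflate :: "'a smod \<Rightarrow> 'a smod" where
  "inflate V = V\<lparr>act := (\<lambda>x. act V (lin_extend pscale (\<lambda>g. case g of
       GenL k \<Rightarrow> unit_vec (GenL k)
     | GenPsi r \<Rightarrow> 0
     | GenC \<Rightarrow> unit_vec GenC
     | GenZ \<Rightarrow> 0) x))\<rparr>"

text \<open>The parity involution, \<open>v \<mapsto> (-1)\<^bsup>|v|\<^esup> v\<close> on homogeneous \<open>v\<close>.\<close>

definition parity_inv :: "'a::ab_group_add smod \<Rightarrow> 'a \<Rightarrow> 'a" where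
  "parity_inv M v = (THE w. \<exists>a\<in>part M False. \<exists>b\<in>part M True. v = a + b \<and> w = a - b)"

definition bilinear_on :: "'a::ab_group_add smod \<Rightarrow> 'b::ab_group_add smod \<Rightarrow> ('a \<Rightarrow> 'b \<Rightarrow> complex) \<Rightarrow> bool"
  where "bilinear_on A B \<beta> \<longleftrightarrow>
     (\<forall>a\<in>carr A. \<forall>a'\<in>carr A. \<forall>b\<in>carr B. \<beta> (a + a') b = \<beta> a b + \<beta> a' b) \<and>
     (\<forall>a\<in>carr A. \<forall>b\<in>carr B. \<forall>b'\<in>carr B. \<beta> a (b + b') = \<beta> a b + \<beta> a b') \<and>
     (\<forall>a\<in>carr A. \<forall>b\<in>carr B. \<forall>k. \<beta> (scal A k a) b = k * \<beta> a b \<and> \<beta> a (scal B k b) = k * \<beta> a b)"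

text \<open>The tensor product over the field of complex numbers is realised inside the dual of the
  space of bilinear forms: \<open>a \<otimes> b\<close> is evaluation at \<open>(a, b)\<close>, and the tensor product is the
  span of these evaluations.  Thus every bilinear form \<open>\<beta>\<close> factors through the linear functional
  \<open>t \<mapsto> t \<beta>\<close>.  The action below is the unique linear one with
  \<open>x (a \<otimes> b) = x a \<otimes> b + (-1)\<^bsup>|x| |a|\<^esup> a \<otimes> x b\<close>, transposed to bilinear forms.\<close>

definition pure_tensor :: "'a::ab_group_add smod \<Rightarrow> 'b::ab_group_add smod \<Rightarrow> 'a \<Rightarrow> 'b \<Rightarrow>
    ('a \<Rightarrow> 'b \<Rightarrow> complex) \<Rightarrow> complex" where
  "pure_tensor A B a b = (\<lambda>\<beta>. if bilinear_on A B \<beta> then \<beta> a b else 0)"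

definition tensor :: "'a::ab_group_add smod \<Rightarrow> 'b::ab_group_add smod \<Rightarrow>
    (('a \<Rightarrow> 'b \<Rightarrow> complex) \<Rightarrow> complex) smod" where
  "tensor A B = \<lparr>
     scal = fscale,
     part = (\<lambda>p. module.span fscale
       {pure_tensor A B a b |a b q r. a \<in> part A q \<and> b \<in> part B r \<and> (q \<noteq> r) = p}),
     act = (\<lambda>x t \<beta>. if bilinear_on A B \<beta> then
         t (\<lambda>a b. \<beta> (act A x a) b + \<beta> a (act B (fvir_proj False x) b)
                  + \<beta> (parity_inv A a) (act B (fvir_proj True x) b))
       else 0)\<rparr>"

text \<open>An element of the restricted dual is a linear functional on the module that vanishes on all
  but finitely many weight spaces, extended by zero to the ambient type.  For homogeneous \<open>x\<close>
  and \<open>f\<close> the action is \<open>(x f) v = - (-1)\<^bsup>|x| |f|\<^esup> f (x v)\<close>; the sign for odd \<open>x\<close> is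
  expressed through \<open>f \<circ> parity_inv M = (-1)\<^bsup>|f|\<^esup> f\<close>.\<close>

definition rdual :: "'a::ab_group_add smod \<Rightarrow> ('a \<Rightarrow> complex) smod" where
  "rdual M = \<lparr>
     scal = fscale,
     part = (\<lambda>p. {f.
       (\<forall>v\<in>carr M. \<forall>w\<in>carr M. f (v + w) = f v + f w) \<and>
       (\<forall>v\<in>carr M. \<forall>k. f (scal M k v) = k * f v) \<and>
       (\<forall>v. v \<notin> carr M \<longrightarrow> f v = 0) \<and>
       finite {\<alpha>. \<exists>v\<in>weight_space M \<alpha>. f v \<noteq> 0} \<and>
       (\<forall>v\<in>part M (\<not> p). f v = 0)}),
     act = (\<lambda>x f v. if v \<in> carr M then
         - f (act M (fvir_proj False x) v) - f (parity_inv M (act M (fvir_proj True x) v))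
       else 0)\<rparr>"


section \<open>The exterior algebra module\<close>

text \<open>The natural number \<open>n\<close> stands for the index \<open>n + 1/2\<close>.  A finite set
  \<open>{n\<^sub>1 < \<dots> < n\<^sub>k}\<close> stands for the basis monomial \<open>\<xi>\<close>-\<open>n\<^sub>1 \<and> \<dots> \<and> \<xi>\<close>-\<open>n\<^sub>k\<close>.\<close>

type_synonym ext = "nat fset \<Rightarrow>\<^sub>0 complex"

definition wedge :: "ext \<Rightarrow> ext \<Rightarrow> ext" where
  "wedge u v = lin_extend pscale (\<lambda>S. lin_extend pscale (\<lambda>T.
     if S |\<inter>| T = {||}
     then Poly_Mapping.single (S |\<union>| T) ((- 1) ^ card {(s, t). s |\<in>| S \<and> t |\<in>| T \<and> t < s})
     else 0) v) u"

definition xi :: "nat \<Rightarrow> ext" where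
  "xi n = unit_vec {|n|}"

text \<open>The odd derivation \<open>\<partial>/\<partial>\<xi>\<close>: moving \<open>\<xi>\<close>-\<open>n\<close> to the front of a monomial costs one sign for
  each smaller index.\<close>

definition dxi :: "nat \<Rightarrow> ext \<Rightarrow> ext" where
  "dxi n = lin_extend pscale (\<lambda>S.
     if n |\<in>| S then Poly_Mapping.single (S |-| {|n|}) ((- 1) ^ card {m. m |\<in>| S \<and> m < n}) else 0)"

definition ext_psi :: "int \<Rightarrow> ext \<Rightarrow> ext" where
  "ext_psi r v = (if r \<ge> 0 then dxi (nat r) v else wedge (xi (nat (- r - 1))) v)"

definition normal_psi :: "int \<Rightarrow> int \<Rightarrow> ext \<Rightarrow> ext" where
  "normal_psi r s v = (if s \<ge> r then ext_psi r (ext_psi s v) else - ext_psi s (ext_psi r v))"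

text \<open>The index \<open>- j\<close> of a half-integer \<open>j = r + 1/2\<close> is encoded by \<open>- r - 1\<close>.  On each vector only
  finitely many summands are nonzero.\<close>

definition ext_L :: "int \<Rightarrow> ext \<Rightarrow> ext" where
  "ext_L k v = pscale (1 / 2) (Sum_any (\<lambda>r. pscale (half r) (normal_psi (- r - 1) (r + k) v)))"

definition ext_module :: "ext smod" where
  "ext_module = \<lparr>
     scal = pscale,
     part = (\<lambda>p. {v. \<forall>S\<in>Poly_Mapping.keys v. odd (fcard S) = p}),
     act = (\<lambda>x v. lin_extend pscale (\<lambda>g. case g of
         GenL k \<Rightarrow> ext_L k v
       | GenPsi r \<Rightarrow> ext_psi r v
       | GenC \<Rightarrow> pscale (1 / 2) v
       | GenZ \<Rightarrow> v) x)\<rparr>"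

end

theory Submission
  imports Defs "HOL-Computational_Algebra.Fundamental_Theorem_Algebra"
begin

text \<open>
  By Schur's lemma \<open>c\<close> and \<open>z\<close> act as scalars \<open>k\<close> and \<open>\<zeta>\<close>.

  Let \<open>\<zeta> = 0\<close>, so that the \<open>\<psi>\<close>'s anticommute.  If some nonzero vector is killed by all \<open>L\<close>'s and \<open>\<psi>\<close>'s
  of sufficiently large index, then the weights are bounded below and the \<open>\<psi>\<close>'s kill a lowest weight
  vector, hence everything.  Reversing the weights covers the mirrored situation.  Otherwise the
  weight multiplicities are bounded by some \<open>N\<close>.  By the pigeonhole principle many pairs of \<open>\<psi>\<close>'s
  with indices in \<open>[-R, R]\<close> have the same index sum, and a linear dependency among them kills every product
  of \<open>n\<close> such \<open>\<psi>\<close>'s as soon as \<open>n choose 2\<close> exceeds \<open>N (4 R + 1)\<close>.  But if the \<open>\<psi>\<close>'s act nontrivially,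
  simplicity puts a whole weight space into the span of the products of \<open>n\<close> of them with \<open>R\<close> linear in
  \<open>n\<close>, a contradiction.

  Let \<open>\<zeta> = l\<^sup>2 \<noteq> 0\<close>.  The operators \<open>\<psi> / l\<close> satisfy the canonical anticommutation relations, and
  their number operators have a common eigenvector in a weight space.  Finite multiplicities force
  this vector to be killed either by almost all annihilation or by almost all creation operators.
  In the first case there is a vacuum vector, and the module is the tensor product of the exterior
  algebra with the space of vacuum vectors, on which \<open>L\<^sub>m\<close> minus its free-field counterpart acts.
  In the second case the first one applies to the dual module.
\<close>

section \<open>Linear algebra\<close>

text \<open>All that is known of the module is that it is simple and that its weight spaces are
  finite-dimensional. So each step either exhibits a nonzero graded submodule, which must be
  everything, or finds more independent vectors in a weight space than it can hold. The end of the
  proof is shaped by the third alternative of the theorem. The Virasoro module there has vectors of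
  the same type as the given module, so the dual is not taken as a space of functionals: a basis of
  homogeneous weight vectors gives a symmetric form on the carrier, and transposes with respect to
  it define the dual action there. The theory of vacuum vectors then applies to the dual as it
  stands, and the restricted dual of the resulting tensor product is the original module again.
  Reversing the weights, which suffices for \<zeta> = 0, would replace the module by its pullback
  under an automorphism and not lead to a restricted dual. The sign rule makes z act on the dual by
  - \<zeta>, so the exterior factor there is twisted by a square root of - \<zeta>.\<close>

locale cspace = vector_space s
  for s :: "complex \<Rightarrow> 'a::ab_group_add \<Rightarrow> 'a"
begin

text \<open>Indexed families, unlike sets, may repeat a vector, and a repetition is itself a
  dependency. This is the form in which finite weight multiplicities are mostly exploited
  below.\<close>

lemma dependent_family:
  assumes I: "finite I" and B: "finite B" "card B < card I" and f: "\<And>i. i \<in> I \<Longrightarrow> f i \<in> span B"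
  shows "\<exists>c. (\<exists>i\<in>I. c i \<noteq> 0) \<and> (\<Sum>i\<in>I. s (c i) (f i)) = 0"
proof (cases "inj_on f I")
  case False
  then obtain i j where ij: "i \<in> I" "j \<in> I" "i \<noteq> j" "f i = f j" by (auto simp: inj_on_def)
  define c where "c = (\<lambda>x. if x = i then 1 else if x = j then -1 else (0::complex))"
  have "(\<Sum>x\<in>I. s (c x) (f x)) = (\<Sum>x\<in>{i, j}. s (c x) (f x))"
    by (rule sum.mono_neutral_right) (use I ij in \<open>auto simp: c_def\<close>)
  also have "\<dots> = 0" using ij by (simp add: c_def)
  finally show ?thesis using ij by (intro exI[of _ c]) (auto simp: c_def)
next
  case True
  have "\<not> independent (f ` I)"
  proof
    assume "independent (f ` I)"
    then have "card (f ` I) \<le> card B" using f by (intro independent_span_bound[THEN conjunct2] B) auto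
    then show False using B card_image[OF True] by simp
  qed
  then obtain u where u: "\<exists>v\<in>f ` I. u v \<noteq> 0" "(\<Sum>v\<in>f ` I. s (u v) v) = 0"
    using dependent_finite[of "f ` I"] I by auto
  have "(\<Sum>i\<in>I. s (u (f i)) (f i)) = 0"
    using u(2) sum.reindex[OF True, of "\<lambda>v. s (u v) v"] by simp
  then show ?thesis using u(1) by (intro exI[of _ "u \<circ> f"]) auto
qed

lemma span_finite_coords:
  assumes "finite B" "x \<in> span B"
  obtains u where "x = (\<Sum>b\<in>B. s (u b) b)"
  using assms span_finite[of B] by auto

text \<open>Linearity is asked on a subset only, because \<open>act\<close> carries no meaning
  outside the carrier; stability of the subset is included so that such maps compose.\<close>

definition lin_on :: "'a set \<Rightarrow> ('a \<Rightarrow> 'a) \<Rightarrow> bool" where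
  "lin_on C T \<longleftrightarrow> (\<forall>v\<in>C. T v \<in> C) \<and> (\<forall>v\<in>C. \<forall>w\<in>C. T (v + w) = T v + T w)
     \<and> (\<forall>v\<in>C. \<forall>a. T (s a v) = s a (T v))"

lemma lin_onD:
  assumes "lin_on C T"
  shows "v \<in> C \<Longrightarrow> T v \<in> C" "v \<in> C \<Longrightarrow> w \<in> C \<Longrightarrow> T (v + w) = T v + T w"
    "v \<in> C \<Longrightarrow> T (s a v) = s a (T v)"
  using assms by (auto simp: lin_on_def)

lemma lin_on_comp: "lin_on C S \<Longrightarrow> lin_on C T \<Longrightarrow> lin_on C (\<lambda>v. S (T v))"
  by (auto simp: lin_on_def)

lemma lin_on_0: "lin_on C T \<Longrightarrow> subspace C \<Longrightarrow> T 0 = 0"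
  by (metis lin_onD(3) scale_zero_left subspace_0)

lemma lin_on_sum:
  assumes "lin_on C T" "subspace C" "\<And>i. i \<in> A \<Longrightarrow> f i \<in> C"
  shows "T (\<Sum>i\<in>A. f i) = (\<Sum>i\<in>A. T (f i))"
  using assms(3)
proof (induction A rule: infinite_finite_induct)
  case (insert x A)
  then show ?case using subspace_sum[OF assms(2), of A f] by (simp add: lin_onD(2)[OF assms(1)])
qed (simp_all add: lin_on_0[OF assms(1,2)])

lemma lin_on_neg: "lin_on C T \<Longrightarrow> v \<in> C \<Longrightarrow> T (- v) = - T v"
  using lin_onD(3)[of C T v "- 1"] by simp

lemma lin_on_diff:
  assumes "lin_on C T" "subspace C" "v \<in> C" "w \<in> C" shows "T (v - w) = T v - T w"
  using lin_onD(2)[OF assms(1,3) subspace_neg[OF assms(2,4)]] lin_on_neg[OF assms(1,4)] by simp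

lemma lin_on_const: "subspace C \<Longrightarrow> lin_on C (s a)"
  by (auto simp: lin_on_def scale_right_distrib subspace_scale mult.commute)

lemma lin_on_minus: "lin_on C T \<Longrightarrow> subspace C \<Longrightarrow> lin_on C (\<lambda>v. - T v)"
  by (auto simp: lin_on_def subspace_neg)

lemma lin_on_span_subset:
  assumes "lin_on C T" "subspace C" "G \<subseteq> C" "subspace N" "\<And>g. g \<in> G \<Longrightarrow> T g \<in> N" "v \<in> span G"
  shows "T v \<in> N"
proof -
  have "v \<in> C \<and> T v \<in> N" using assms(6)
  proof (induction rule: span_induct_alt)
    case base
    then show ?case using assms(1,2,4) by (simp add: lin_on_0 subspace_0)
  next
    case (step c x y)
    then show ?case using assms
      by (auto simp: lin_onD subspace_add subspace_scale subset_iff)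
  qed
  then show ?thesis ..
qed

end

lemma sum_fun_apply: "(\<Sum>i\<in>A. f i) x = (\<Sum>i\<in>A. f i x)"
  by (induction A rule: infinite_finite_induct) auto

text \<open>There are more unknowns \<open>l i\<close> than equations: the columns of coefficients,
  cut off to \<open>J\<close>, lie in the span of the unit vectors \<open>e j\<close> with
  \<open>j\<close> in \<open>J\<close>, hence are dependent.\<close>

lemma complex_system_nontrivial:
  fixes c :: "'j \<Rightarrow> 'i \<Rightarrow> complex"
  assumes "finite I" "finite J" "card J < card I"
  shows "\<exists>l. (\<exists>i\<in>I. l i \<noteq> 0) \<and> (\<forall>j\<in>J. (\<Sum>i\<in>I. l i * c j i) = 0)"
proof -
  interpret F: cspace "fscale :: complex \<Rightarrow> ('j \<Rightarrow> complex) \<Rightarrow> _" by (simp add: cspace_def vector_space_fscale)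
  define e where "e j = (\<lambda>k. if k = j then 1 else (0::complex))" for j :: 'j
  define f where "f i = (\<Sum>j\<in>J. fscale (c j i) (e j))" for i
  have fe: "f i k = c k i" if "k \<in> J" for i k
  proof -
    have "f i k = (\<Sum>j\<in>J. c j i * e j k)"
      unfolding f_def sum_fun_apply by (simp add: fscale_def)
    also have "\<dots> = (\<Sum>j\<in>J. if j = k then c j i else 0)" by (rule sum.cong) (auto simp: e_def)
    finally show ?thesis using that assms(2) by simp
  qed
  have "\<exists>l. (\<exists>i\<in>I. l i \<noteq> 0) \<and> (\<Sum>i\<in>I. fscale (l i) (f i)) = 0"
  proof (rule F.dependent_family[where B = "e ` J"])
    show "card (e ` J) < card I" using card_image_le[OF assms(2), of e] assms(3) by linarith
    show "f i \<in> F.span (e ` J)" for i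
      unfolding f_def by (intro F.span_sum F.span_scale F.span_base) auto
  qed (use assms in auto)
  then obtain l where l: "\<exists>i\<in>I. l i \<noteq> 0" "(\<Sum>i\<in>I. fscale (l i) (f i)) = 0" by blast
  have "(\<Sum>i\<in>I. l i * c j i) = 0" if "j \<in> J" for j
  proof -
    have "(\<Sum>i\<in>I. l i * c j i) = (\<Sum>i\<in>I. fscale (l i) (f i)) j"
      unfolding sum_fun_apply by (simp add: fscale_def fe that)
    then show ?thesis by (simp add: l(2))
  qed
  then show ?thesis using l(1) by blast
qed

lemma pigeonhole_sum:
  assumes "finite A" "finite B" "f ` A \<subseteq> B" "n * card B < card A"
  shows "\<exists>y\<in>B. n < card {a \<in> A. f a = y}"
proof (rule ccontr)
  assume "\<not> ?thesis"
  then have "(\<Sum>y\<in>B. card {a \<in> A. f a = y}) \<le> card B * n"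
    by (intro sum_bounded_above[where 'a = nat, simplified]) (auto simp: not_less)
  moreover have "card A = (\<Sum>y\<in>B. card {a \<in> A. f a = y})"
  proof -
    have "card A = (\<Sum>a\<in>A. 1)" by simp
    also have "\<dots> = (\<Sum>y\<in>B. \<Sum>a\<in>{a \<in> A. f a = y}. 1)"
      using sum.group[OF assms(1,2,3), of "\<lambda>_. 1::nat"] by simp
    finally show ?thesis by simp
  qed
  ultimately show False using assms(4) by (simp add: mult.commute)
qed

section \<open>Harish-Chandra modules in terms of operators\<close>

definition hsum :: "(bool \<Rightarrow> 'a::ab_group_add set) \<Rightarrow> 'a set" where
  "hsum H = {a + b |a b. a \<in> H False \<and> b \<in> H True}"

text \<open>\<open>P r\<close> is the action of \<open>\<psi>\<close> with index \<open>r + 1/2\<close>, so \<open>r + t = - 1\<close> says that the indices are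
  opposite; \<open>k\<close> and \<open>\<zeta>\<close> are the values of \<open>c\<close> and \<open>z\<close>.\<close>

locale fvmod = cspace s
  for s :: "complex \<Rightarrow> 'a::ab_group_add \<Rightarrow> 'a" +
  fixes H :: "bool \<Rightarrow> 'a set" and L P :: "int \<Rightarrow> 'a \<Rightarrow> 'a" and k \<zeta> :: complex
  assumes H_sub: "\<And>p. subspace (H p)"
    and H_int: "H False \<inter> H True = {0}"
    and L_lin: "\<And>m. lin_on (hsum H) (L m)"
    and P_lin: "\<And>r. lin_on (hsum H) (P r)"
    and L_hom: "\<And>m p v. v \<in> H p \<Longrightarrow> L m v \<in> H p"
    and P_hom: "\<And>r p v. v \<in> H p \<Longrightarrow> P r v \<in> H (\<not> p)"
    and LL: "\<And>m n v. v \<in> hsum H \<Longrightarrow> L m (L n v) - L n (L m v) =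
          s (of_int (m - n)) (L (m + n) v)
          + (if m = - n then s ((of_int m ^ 3 - of_int m) / 12 * k) v else 0)"
    and LP: "\<And>m r v. v \<in> hsum H \<Longrightarrow> L m (P r v) - P r (L m v) = s (- half r - of_int m / 2) (P (m + r) v)"
    and PP: "\<And>r t v. v \<in> hsum H \<Longrightarrow> P r (P t v) + P t (P r v) = (if r + t = -1 then s \<zeta> v else 0)"
    and wts: "hsum H \<subseteq> span (\<Union>\<alpha>. {v \<in> hsum H. L 0 v = s \<alpha> v})"
    and wt_fin: "\<And>\<alpha>. \<exists>B. finite B \<and> {v \<in> hsum H. L 0 v = s \<alpha> v} = span B"
    and nonzero: "hsum H \<noteq> {0}"
    and simple: "\<And>N. subspace N \<Longrightarrow> N \<subseteq> hsum H
        \<Longrightarrow> (\<And>v. v \<in> N \<Longrightarrow> \<exists>a\<in>N \<inter> H False. \<exists>b\<in>N \<inter> H True. v = a + b)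
        \<Longrightarrow> (\<And>m v. v \<in> N \<Longrightarrow> L m v \<in> N) \<Longrightarrow> (\<And>r v. v \<in> N \<Longrightarrow> P r v \<in> N)
        \<Longrightarrow> N = {0} \<or> N = hsum H"
begin

abbreviation C :: "'a set" where "C \<equiv> hsum H"

definition wt :: "complex \<Rightarrow> 'a set" where "wt \<alpha> = {v \<in> C. L 0 v = s \<alpha> v}"

definition graded :: "'a set \<Rightarrow> bool" where
  "graded N \<longleftrightarrow> (\<forall>v\<in>N. \<exists>a\<in>N \<inter> H False. \<exists>b\<in>N \<inter> H True. v = a + b)"

lemma simple_graded:
  assumes "subspace N" "N \<subseteq> C" "graded N" "\<And>m v. v \<in> N \<Longrightarrow> L m v \<in> N" "\<And>r v. v \<in> N \<Longrightarrow> P r v \<in> N"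
    and "x \<in> N" "x \<noteq> 0"
  shows "N = C"
  using simple[of N] assms by (auto simp: graded_def)

lemma C_sub: "subspace C"
proof (rule subspaceI)
  show "0 \<in> C" unfolding hsum_def by (auto intro!: exI[of _ 0] subspace_0[OF H_sub])
  fix x y assume "x \<in> C" "y \<in> C"
  then obtain a b a' b' where "x = a + b" "y = a' + b'" "a \<in> H False" "a' \<in> H False" "b \<in> H True" "b' \<in> H True"
    by (auto simp: hsum_def)
  then have "x + y = (a + a') + (b + b')" "a + a' \<in> H False" "b + b' \<in> H True"
    by (auto intro: subspace_add[OF H_sub])
  then show "x + y \<in> C" unfolding hsum_def by blast
next
  fix c x assume "x \<in> C"
  then obtain a b where "x = a + b" "a \<in> H False" "b \<in> H True" by (auto simp: hsum_def)
  then have "s c x = s c a + s c b" "s c a \<in> H False" "s c b \<in> H True"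
    by (auto simp: scale_right_distrib intro: subspace_scale[OF H_sub])
  then show "s c x \<in> C" unfolding hsum_def by blast
qed

lemma H_C: "v \<in> H p \<Longrightarrow> v \<in> C"
proof (cases p)
  case True
  assume "v \<in> H p"
  then show ?thesis using True subspace_0[OF H_sub, of False] unfolding hsum_def by force
next
  case False
  assume "v \<in> H p"
  then show ?thesis using False subspace_0[OF H_sub, of True] unfolding hsum_def by force
qed

lemma C_cases:
  assumes "v \<in> C" obtains a b where "a \<in> H False" "b \<in> H True" "v = a + b"
  using assms by (auto simp: hsum_def)

lemma C_closed [simp, intro]:
  "0 \<in> C" "v \<in> C \<Longrightarrow> w \<in> C \<Longrightarrow> v + w \<in> C" "v \<in> C \<Longrightarrow> w \<in> C \<Longrightarrow> v - w \<in> C"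
  "v \<in> C \<Longrightarrow> - v \<in> C" "v \<in> C \<Longrightarrow> s a v \<in> C" "v \<in> C \<Longrightarrow> L m v \<in> C" "v \<in> C \<Longrightarrow> P r v \<in> C"
  using C_sub L_lin P_lin
  by (simp_all add: subspace_0 subspace_add subspace_diff subspace_neg subspace_scale lin_onD(1))

lemma C_sum [intro]: "(\<And>i. i \<in> A \<Longrightarrow> f i \<in> C) \<Longrightarrow> sum f A \<in> C"
  by (rule subspace_sum[OF C_sub])

lemma L_simps [simp]:
  "v \<in> C \<Longrightarrow> w \<in> C \<Longrightarrow> L m (v + w) = L m v + L m w"
  "v \<in> C \<Longrightarrow> w \<in> C \<Longrightarrow> L m (v - w) = L m v - L m w"
  "v \<in> C \<Longrightarrow> L m (s a v) = s a (L m v)" "v \<in> C \<Longrightarrow> L m (- v) = - L m v" "L m 0 = 0"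
  by (simp_all add: lin_onD[OF L_lin] lin_on_neg[OF L_lin] lin_on_diff[OF L_lin C_sub] lin_on_0[OF L_lin C_sub])

lemma P_simps [simp]:
  "v \<in> C \<Longrightarrow> w \<in> C \<Longrightarrow> P m (v + w) = P m v + P m w"
  "v \<in> C \<Longrightarrow> w \<in> C \<Longrightarrow> P m (v - w) = P m v - P m w"
  "v \<in> C \<Longrightarrow> P m (s a v) = s a (P m v)" "v \<in> C \<Longrightarrow> P m (- v) = - P m v" "P m 0 = 0"
  by (simp_all add: lin_onD[OF P_lin] lin_on_neg[OF P_lin] lin_on_diff[OF P_lin C_sub] lin_on_0[OF P_lin C_sub])

lemma L_sum: "(\<And>i. i \<in> A \<Longrightarrow> f i \<in> C) \<Longrightarrow> L m (sum f A) = (\<Sum>i\<in>A. L m (f i))"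
  by (rule lin_on_sum[OF L_lin C_sub])

lemma P_sum: "(\<And>i. i \<in> A \<Longrightarrow> f i \<in> C) \<Longrightarrow> P m (sum f A) = (\<Sum>i\<in>A. P m (f i))"
  by (rule lin_on_sum[OF P_lin C_sub])

lemma H_unique:
  assumes "a \<in> H False" "a' \<in> H False" "b \<in> H True" "b' \<in> H True" "a + b = a' + b'"
  shows "a = a'" "b = b'"
proof -
  have "a - a' = b' - b" using assms(5) by (simp add: algebra_simps)
  moreover have "a - a' \<in> H False" "b' - b \<in> H True" using assms subspace_diff[OF H_sub] by auto
  ultimately have "a - a' = 0" "b' - b = 0" using H_int by (metis IntI singletonD)+
  then show "a = a'" "b = b'" by auto
qed

lemma graded_component:
  assumes "graded N" "a + b \<in> N" "a \<in> H False" "b \<in> H True" shows "a \<in> N" "b \<in> N"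
proof -
  obtain a' b' where *: "a' \<in> N \<inter> H False" "b' \<in> N \<inter> H True" "a + b = a' + b'"
    using assms unfolding graded_def by metis
  then have "a = a'" "b = b'" using H_unique[of a a' b b'] assms by auto
  with * show "a \<in> N" "b \<in> N" by auto
qed

lemma graded_span:
  assumes "\<And>g. g \<in> G \<Longrightarrow> \<exists>p. g \<in> H p"
  shows "graded (span G)"
  unfolding graded_def
proof
  fix v assume "v \<in> span G"
  then show "\<exists>a\<in>span G \<inter> H False. \<exists>b\<in>span G \<inter> H True. v = a + b"
  proof (induction rule: span_induct_alt)
    case base
    then show ?case by (auto intro!: bexI[of _ 0] span_zero subspace_0[OF H_sub])
  next
    case (step c x y)
    then obtain a b where ab: "a \<in> span G \<inter> H False" "b \<in> span G \<inter> H True" "y = a + b" by blast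
    have x: "s c x \<in> span G" using step by (simp add: span_base span_scale)
    obtain p where "x \<in> H p" using assms step by blast
    then have xp: "s c x \<in> H p" by (rule subspace_scale[OF H_sub])
    show ?case
    proof (cases p)
      case True
      then show ?thesis using ab x xp
        by (intro bexI[of _ a] bexI[of _ "b + s c x"]) (auto intro: span_add subspace_add[OF H_sub])
    next
      case False
      then show ?thesis using ab x xp
        by (intro bexI[of _ "a + s c x"] bexI[of _ b]) (auto intro: span_add subspace_add[OF H_sub])
    qed
  qed
qed

section \<open>Weight spaces and weight components\<close>

lemma wt_C: "v \<in> wt \<alpha> \<Longrightarrow> v \<in> C" by (simp add: wt_def)

lemma wt_sub: "subspace (wt \<alpha>)"
  unfolding wt_def by (rule subspaceI) (auto simp: scale_right_distrib mult.commute)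

lemma wt_L: "v \<in> wt \<alpha> \<Longrightarrow> L m v \<in> wt (\<alpha> - of_int m)"
  using LL[of v 0 m] by (cases "m = 0") (auto simp: wt_def algebra_simps)

lemma wt_P: "v \<in> wt \<alpha> \<Longrightarrow> P r v \<in> wt (\<alpha> - half r)"
  using LP[of v 0 r] by (auto simp: wt_def algebra_simps)

lemma wt_graded: "graded (wt \<alpha>)"
  unfolding graded_def
proof
  fix v assume v: "v \<in> wt \<alpha>"
  then obtain a b where ab: "a \<in> H False" "b \<in> H True" "v = a + b" by (auto simp: wt_def elim: C_cases)
  have "L 0 a + L 0 b = s \<alpha> a + s \<alpha> b" using v ab by (simp add: wt_def H_C scale_right_distrib)
  then have "L 0 a = s \<alpha> a" "L 0 b = s \<alpha> b"
    using H_unique[of "L 0 a" "s \<alpha> a" "L 0 b" "s \<alpha> b"] ab L_hom subspace_scale[OF H_sub] by auto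
  then show "\<exists>a\<in>wt \<alpha> \<inter> H False. \<exists>b\<in>wt \<alpha> \<inter> H True. v = a + b"
    using ab by (intro bexI[of _ a] bexI[of _ b]) (auto simp: wt_def H_C)
qed

text \<open>Induction on the number of weights: \<open>L 0 - \<beta>\<close> removes the component
  of weight \<beta> and multiplies the others by nonzero numbers. Besides submodules,
  \<open>N\<close> may be \<open>{0}\<close> or a space of vacuum vectors.\<close>

lemma wt_component:
  assumes "subspace N" "\<And>v. v \<in> N \<Longrightarrow> L 0 v \<in> N" "finite A" "\<And>\<alpha>. \<alpha> \<in> A \<Longrightarrow> f \<alpha> \<in> wt \<alpha>"
    "(\<Sum>\<alpha>\<in>A. f \<alpha>) \<in> N" "\<alpha> \<in> A"
  shows "f \<alpha> \<in> N"
  using assms(3-6)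
proof (induction A arbitrary: f \<alpha> rule: finite_induct)
  case (insert \<beta> A)
  define g where "g = (\<lambda>\<alpha>. s (\<alpha> - \<beta>) (f \<alpha>))"
  have fC: "f \<gamma> \<in> C" if "\<gamma> \<in> insert \<beta> A" for \<gamma> using insert that by (auto simp: wt_def)
  have "L 0 (\<Sum>\<gamma>\<in>insert \<beta> A. f \<gamma>) - s \<beta> (\<Sum>\<gamma>\<in>insert \<beta> A. f \<gamma>) = (\<Sum>\<gamma>\<in>insert \<beta> A. g \<gamma>)"
    using fC insert.prems(1) by (subst L_sum)
      (auto simp: g_def scale_sum_right sum_subtractf[symmetric] wt_def scale_left_diff_distrib intro!: sum.cong)
  also have "\<dots> = (\<Sum>\<gamma>\<in>A. g \<gamma>)" using insert by (simp add: g_def)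
  finally have "(\<Sum>\<gamma>\<in>A. g \<gamma>) \<in> N"
    using assms(1,2) insert.prems by (metis subspace_diff subspace_scale)
  then have g: "g \<gamma> \<in> N" if "\<gamma> \<in> A" for \<gamma>
    using insert.IH[of g \<gamma>] insert.prems that wt_sub by (auto simp: g_def subspace_scale)
  have f: "f \<gamma> \<in> N" if "\<gamma> \<in> A" for \<gamma>
  proof -
    have "\<gamma> \<noteq> \<beta>" using that insert by auto
    then have "f \<gamma> = s (1 / (\<gamma> - \<beta>)) (g \<gamma>)" by (simp add: g_def)
    then show ?thesis using g[OF that] assms(1) by (metis subspace_scale)
  qed
  show ?case
  proof (cases "\<alpha> \<in> A")
    case False
    then have "\<alpha> = \<beta>" using insert by auto
    have "f \<beta> = (\<Sum>\<gamma>\<in>insert \<beta> A. f \<gamma>) - (\<Sum>\<gamma>\<in>A. f \<gamma>)" using insert by simp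
    moreover have "(\<Sum>\<gamma>\<in>A. f \<gamma>) \<in> N" using f by (rule subspace_sum[OF assms(1)])
    ultimately show ?thesis using \<open>\<alpha> = \<beta>\<close> insert.prems assms(1) by (metis subspace_diff)
  qed (rule f)
qed simp

lemma wt_decomp:
  assumes "v \<in> span (\<Union>\<alpha>\<in>K. wt \<alpha>)"
  obtains A f where "finite A" "A \<subseteq> K" "\<And>\<alpha>. \<alpha> \<in> A \<Longrightarrow> f \<alpha> \<in> wt \<alpha>" "v = (\<Sum>\<alpha>\<in>A. f \<alpha>)"
proof -
  have "\<exists>A f. finite A \<and> A \<subseteq> K \<and> (\<forall>\<alpha>. f \<alpha> \<in> wt \<alpha>) \<and> v = (\<Sum>\<alpha>\<in>A. f \<alpha>)" using assms
  proof (induction rule: span_induct_alt)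
    case base
    then show ?case by (intro exI[of _ "{}"] exI[of _ "\<lambda>_. 0"]) (auto simp: subspace_0 wt_sub)
  next
    case (step c x y)
    then obtain A f \<beta> where A: "finite A" "A \<subseteq> K" "\<forall>\<alpha>. f \<alpha> \<in> wt \<alpha>" "y = (\<Sum>\<alpha>\<in>A. f \<alpha>)"
      and b: "\<beta> \<in> K" "x \<in> wt \<beta>" by blast
    define g where "g \<alpha> = (if \<alpha> \<in> A then f \<alpha> else 0) + (if \<alpha> = \<beta> then s c x else 0)" for \<alpha>
    have "(\<Sum>\<alpha>\<in>insert \<beta> A. g \<alpha>) = (\<Sum>\<alpha>\<in>insert \<beta> A. if \<alpha> \<in> A then f \<alpha> else 0) + (\<Sum>\<alpha>\<in>insert \<beta> A. if \<alpha> = \<beta> then s c x else 0)"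
      by (simp add: g_def sum.distrib)
    also have "(\<Sum>\<alpha>\<in>insert \<beta> A. if \<alpha> \<in> A then f \<alpha> else 0) = (\<Sum>\<alpha>\<in>A. f \<alpha>)"
      by (rule sum.mono_neutral_cong_right) (use A in auto)
    also have "(\<Sum>\<alpha>\<in>insert \<beta> A. if \<alpha> = \<beta> then s c x else 0) = s c x" using A by simp
    finally have "s c x + y = (\<Sum>\<alpha>\<in>insert \<beta> A. g \<alpha>)" using A by (simp add: add.commute)
    moreover have "g \<alpha> \<in> wt \<alpha>" for \<alpha>
      using A b by (auto simp: g_def intro!: subspace_add[OF wt_sub] subspace_scale[OF wt_sub] subspace_0[OF wt_sub])
    ultimately show ?case using A b by (intro exI[of _ "insert \<beta> A"] exI[of _ g]) auto
  qed
  then show ?thesis using that by blast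
qed

lemma C_span_wt: "C = span (\<Union>\<alpha>. wt \<alpha>)"
proof
  show "C \<subseteq> span (\<Union>\<alpha>. wt \<alpha>)" using wts by (simp add: wt_def)
  show "span (\<Union>\<alpha>. wt \<alpha>) \<subseteq> C" by (rule span_minimal[OF _ C_sub]) (auto simp: wt_def)
qed

lemma C_decomp:
  assumes "v \<in> C"
  obtains A f where "finite A" "\<And>\<alpha>. \<alpha> \<in> A \<Longrightarrow> f \<alpha> \<in> wt \<alpha>" "v = (\<Sum>\<alpha>\<in>A. f \<alpha>)"
  using assms wt_decomp[of v UNIV] C_span_wt by auto

lemma wt_disjoint:
  assumes "v \<in> wt \<alpha>" "v \<in> span (\<Union>\<beta>\<in>K. wt \<beta>)" "\<alpha> \<notin> K" shows "v = 0"
proof -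
  obtain A f where A: "finite A" "A \<subseteq> K" "\<And>\<beta>. \<beta> \<in> A \<Longrightarrow> f \<beta> \<in> wt \<beta>" "v = (\<Sum>\<beta>\<in>A. f \<beta>)"
    using wt_decomp[OF assms(2)] by blast
  have a: "\<alpha> \<notin> A" using A assms by auto
  \<comment> \<open>Bringing \<open>v\<close> to the other side gives a vanishing sum over distinct
    weights, so \<open>wt_component\<close> applies with \<open>{0}\<close> as the stable
    subspace.\<close>
  define g where "g = f(\<alpha> := - v)"
  have "(\<Sum>\<beta>\<in>insert \<alpha> A. g \<beta>) = - v + (\<Sum>\<beta>\<in>A. g \<beta>)" using a A(1) by (simp add: g_def)
  also have "(\<Sum>\<beta>\<in>A. g \<beta>) = v" unfolding A(4) by (rule sum.cong) (use a in \<open>auto simp: g_def\<close>)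
  finally have "(\<Sum>\<beta>\<in>insert \<alpha> A. g \<beta>) \<in> {0}" by simp
  moreover have "g \<beta> \<in> wt \<beta>" if "\<beta> \<in> insert \<alpha> A" for \<beta>
    using that A assms subspace_neg[OF wt_sub] by (auto simp: g_def)
  ultimately have "g \<alpha> \<in> {0}"
    using wt_component[of "{0}" "insert \<alpha> A" g \<alpha>] A(1) by (auto simp: subspace_def)
  then show ?thesis by (simp add: g_def)
qed

lemma wt_fin': obtains B where "finite B" "wt \<alpha> = span B"
  using wt_fin[of \<alpha>] unfolding wt_def by blast

lemma ex_wt: obtains \<alpha> v p where "v \<in> wt \<alpha>" "v \<noteq> 0" "v \<in> H p"
proof -
  obtain x where x: "x \<in> C" "x \<noteq> 0" using nonzero C_closed(1) by blast
  have "\<exists>\<alpha> v. v \<in> wt \<alpha> \<and> v \<noteq> 0"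
  proof (rule ccontr)
    assume "\<not> ?thesis"
    then have "(\<Union>\<alpha>. wt \<alpha>) \<subseteq> {0}" by auto
    then have "C \<subseteq> {0}" using C_span_wt by (metis span_mono span_empty span_insert_0)
    then show False using x by auto
  qed
  then obtain \<alpha> v where v: "v \<in> wt \<alpha>" "v \<noteq> 0" by blast
  then obtain a b where "a \<in> wt \<alpha> \<inter> H False" "b \<in> wt \<alpha> \<inter> H True" "v = a + b"
    using wt_graded[of \<alpha>] unfolding graded_def by blast
  then show ?thesis using that[of a \<alpha> False] that[of b \<alpha> True] v by force
qed

text \<open>The pullback along \<open>L\<^sub>m \<mapsto> - L\<^bsub>-m\<^esub>\<close>, \<open>\<psi>\<^sub>r \<mapsto> \<psi>\<^bsub>-r\<^esub>\<close>, \<open>c \<mapsto> - c\<close>, which reverses the weights.\<close>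

lemma mirror: "fvmod s H (\<lambda>m v. - L (- m) v) (\<lambda>r. P (- r - 1)) (- k) \<zeta>"
proof (unfold_locales)
  fix m n :: int and v assume v: "v \<in> C"
  show "- L (- m) (- L (- n) v) - - L (- n) (- L (- m) v) =
       s (of_int (m - n)) (- L (- (m + n)) v) + (if m = - n then s ((of_int m ^ 3 - of_int m) / 12 * - k) v else 0)"
    using LL[OF v, of "-m" "-n"] v by (auto simp: algebra_simps)
next
  fix m r :: int and v assume v: "v \<in> C"
  have e: "- m + (- r - 1) = - (m + r) - 1" "half r + half (- r - 1) = 0" by (auto simp: half_def)
  then have e2: "- half (- r - 1) - of_int (- m) / 2 = - (- half r - of_int m / 2)"
    by (simp add: algebra_simps add_eq_0_iff2)
  show "- L (- m) (P (- r - 1) v) - P (- r - 1) (- L (- m) v) = s (- half r - of_int m / 2) (P (- (m + r) - 1) v)"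
    using LP[OF v, of "-m" "- r - 1"] v unfolding e(1) e2 scale_minus_left
    by (simp add: algebra_simps)
next
  fix r t :: int and v assume v: "v \<in> C"
  show "P (- r - 1) (P (- t - 1) v) + P (- t - 1) (P (- r - 1) v) = (if r + t = - 1 then s \<zeta> v else 0)"
    using PP[OF v, of "- r - 1" "- t - 1"] by auto
next
  have e: "{v \<in> C. - L (- 0) v = s \<alpha> v} = wt (- \<alpha>)" for \<alpha>
    by (auto simp: wt_def minus_equation_iff[of _ "s \<alpha> _"] equation_minus_iff[of "L 0 _"] eq_commute[of "L 0 _" "s \<alpha> _"] eq_commute[of "- s \<alpha> _"])
  show "C \<subseteq> span (\<Union>\<alpha>. {v \<in> C. - L (- 0) v = s \<alpha> v})"
  proof -
    have "wt \<alpha> \<subseteq> (\<Union>\<beta>. wt (- \<beta>))" for \<alpha> using UN_upper[of "- \<alpha>" UNIV "\<lambda>\<beta>. wt (- \<beta>)"] by simp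
    then have "(\<Union>\<alpha>. wt \<alpha>) \<subseteq> (\<Union>\<beta>. wt (- \<beta>))" by blast
    then show ?thesis unfolding e using C_span_wt span_mono by blast
  qed
  show "\<exists>B. finite B \<and> {v \<in> C. - L (- 0) v = s \<alpha> v} = span B" for \<alpha>
    unfolding e using wt_fin'[of "- \<alpha>"] by metis
next
  fix N assume N: "subspace N" "N \<subseteq> C" "\<And>v. v \<in> N \<Longrightarrow> \<exists>a\<in>N \<inter> H False. \<exists>b\<in>N \<inter> H True. v = a + b"
    "\<And>m v. v \<in> N \<Longrightarrow> - L (- m) v \<in> N" "\<And>r v. v \<in> N \<Longrightarrow> P (- r - 1) v \<in> N"
  show "N = {0} \<or> N = C"
  proof (rule simple[OF N(1,2,3)])
    show "L m v \<in> N" if "v \<in> N" for m v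
      using N(4)[OF that, of "-m"] subspace_neg[OF N(1)] by force
    show "P r v \<in> N" if "v \<in> N" for r v using N(5)[OF that, of "-r-1"] by simp
  qed
qed (use H_sub H_int L_lin P_lin L_hom P_hom nonzero subspace_neg[OF H_sub] in \<open>auto intro!: lin_on_minus C_sub\<close>)

end

section \<open>Vectors killed by all high modes\<close>

context fvmod
begin

definition smooth :: "'a \<Rightarrow> bool" where
  "smooth v \<longleftrightarrow> (\<exists>M. \<forall>j\<ge>M. L j v = 0 \<and> P j v = 0)"

text \<open>The smooth vectors form a graded submodule: commuting a high mode past a fixed operator
  shifts its index by a bounded amount.\<close>

lemma smooth_all:
  assumes "x \<in> C" "x \<noteq> 0" "smooth x" and v: "v \<in> C"
  shows "smooth v"
proof -
  define N where "N = {v \<in> C. smooth v}"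
  have "N = C"
  proof (rule simple_graded[of _ x])
    show "subspace N"
    proof (rule subspaceI)
      show "0 \<in> N" by (auto simp: N_def smooth_def)
      show "s c y \<in> N" if "y \<in> N" for c y using that by (auto simp: N_def smooth_def)
      fix y z assume "y \<in> N" "z \<in> N"
      then obtain M M' where "\<forall>j\<ge>M. L j y = 0 \<and> P j y = 0" "\<forall>j\<ge>M'. L j z = 0 \<and> P j z = 0" "y \<in> C" "z \<in> C"
        by (auto simp: N_def smooth_def)
      then show "y + z \<in> N"
        by (auto simp: N_def smooth_def intro!: exI[of _ "max M M'"])
    qed
    show "N \<subseteq> C" by (auto simp: N_def)
    show "graded N" unfolding graded_def
    proof
      fix y assume y: "y \<in> N"
      then obtain M where M: "\<forall>j\<ge>M. L j y = 0 \<and> P j y = 0" by (auto simp: N_def smooth_def)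
      obtain a b where ab: "a \<in> H False" "b \<in> H True" "y = a + b" using y by (auto simp: N_def elim: C_cases)
      have "L j a = 0 \<and> P j a = 0 \<and> L j b = 0 \<and> P j b = 0" if "j \<ge> M" for j
      proof -
        have z: "0 \<in> H False" "0 \<in> H True" using subspace_0[OF H_sub] by auto
        have "L j a + L j b = 0 + 0" "P j b + P j a = 0 + 0"
          using M that ab H_C by (auto simp: add.commute)
        then show ?thesis
          using H_unique[of "L j a" 0 "L j b" 0] H_unique[of "P j b" 0 "P j a" 0] z L_hom P_hom[of a False] P_hom[of b True] ab
          by auto
      qed
      then show "\<exists>a\<in>N \<inter> H False. \<exists>b\<in>N \<inter> H True. y = a + b"
        using ab by (intro bexI[of _ a] bexI[of _ b]) (auto simp: N_def smooth_def H_C)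
    qed
    show "x \<in> N" using assms by (simp add: N_def)
    show "x \<noteq> 0" by fact
    fix y assume y: "y \<in> N"
    then obtain M where M: "\<And>j. j \<ge> M \<Longrightarrow> L j y = 0" "\<And>j. j \<ge> M \<Longrightarrow> P j y = 0" by (auto simp: N_def smooth_def)
    have yC: "y \<in> C" using y by (simp add: N_def)
    show "L m y \<in> N" for m
    proof -
      \<comment> \<open>The margin keeps both \<open>j\<close> and \<open>j + m\<close> above
        \<open>M\<close> and excludes the central term at \<open>j = - m\<close>.\<close>
      have "L j (L m y) = 0 \<and> P j (L m y) = 0" if "j \<ge> \<bar>M\<bar> + \<bar>m\<bar> + 1" for j
        using LL[OF yC, of j m] LP[OF yC, of m j] M[of j] M[of "j + m"] M[of "m + j"] that by auto
      then show ?thesis using yC by (auto simp: N_def smooth_def)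
    qed
    show "P r y \<in> N" for r
    proof -
      have "L j (P r y) = 0 \<and> P j (P r y) = 0" if "j \<ge> \<bar>M\<bar> + \<bar>r\<bar> + 1" for j
        using PP[OF yC, of j r] LP[OF yC, of j r] M[of j] M[of "j + r"] that by auto
      then show ?thesis using yC by (auto simp: N_def smooth_def)
    qed
  qed
  then show ?thesis using v by (auto simp: N_def)
qed

text \<open>The vectors \<open>L (-n) u\<^sub>n\<close> all lie in the weight space of \<open>\<alpha>\<close>; applying a suitable \<open>L K\<close> isolates one of them,
  which bounds their number.\<close>

lemma deep_singular:
  assumes sm: "\<And>v. v \<in> C \<Longrightarrow> smooth v"
  shows "\<exists>n0::nat. \<forall>n\<ge>n0. \<forall>u\<in>wt (\<alpha> - of_nat n). \<forall>j>0. L j u = 0"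
proof (rule ccontr)
  assume "\<not> ?thesis"
  then have *: "\<forall>n0::nat. \<exists>n\<ge>n0. \<exists>u\<in>wt (\<alpha> - of_nat n). \<exists>j>0. L j u \<noteq> 0" by blast
  define Q where "Q = {n::nat. n \<ge> 1 \<and> (\<exists>u\<in>wt (\<alpha> - of_nat n). \<exists>j>0. L j u \<noteq> 0)}"
  have Qinf: "infinite Q"
    unfolding infinite_nat_iff_unbounded_le
  proof
    fix m
    show "\<exists>n\<ge>m. n \<in> Q" using spec[OF *, of "max m 1"] by (auto simp: Q_def)
  qed
  \<comment> \<open>\<open>d\<close> is the largest mode that does not kill \<open>u\<close>; it
    exists because \<open>u\<close> is smooth.\<close>
  have "\<forall>n. \<exists>u d. n \<in> Q \<longrightarrow> u \<in> wt (\<alpha> - of_nat n) \<and> d > 0 \<and> L d u \<noteq> 0 \<and> (\<forall>j>d. L j u = 0)"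
  proof
    fix n
    show "\<exists>u d. n \<in> Q \<longrightarrow> u \<in> wt (\<alpha> - of_nat n) \<and> d > 0 \<and> L d u \<noteq> 0 \<and> (\<forall>j>d. L j u = 0)"
    proof (cases "n \<in> Q")
      case True
      then obtain u j where u: "u \<in> wt (\<alpha> - of_nat n)" "j > 0" "L j u \<noteq> 0" by (auto simp: Q_def)
      obtain M where M: "\<forall>i\<ge>M. L i u = 0" using sm[OF wt_C[OF u(1)]] by (auto simp: smooth_def)
      define D where "D = {i \<in> {1..M}. L i u \<noteq> 0}"
      have "finite D" unfolding D_def by (rule finite_subset[of _ "{1..M}"]) auto
      have "j \<in> D" using u M by (auto simp: D_def not_le dest!: spec[of _ j])
      with \<open>finite D\<close> have "Max D \<in> D" "\<And>i. i \<in> D \<Longrightarrow> i \<le> Max D" by (auto intro: Max_in)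
      moreover have "L i u = 0" if "i > Max D" for i
        proof (rule ccontr)
        assume "L i u \<noteq> 0"
        moreover from this have "i < M" using M not_le by blast
        moreover have "i \<ge> 1" using that \<open>Max D \<in> D\<close> by (auto simp: D_def)
        ultimately have "i \<in> D" by (simp add: D_def)
        then show False using \<open>\<And>i. i \<in> D \<Longrightarrow> i \<le> Max D\<close>[of i] that by simp
      qed
      moreover have "Max D > 0" "L (Max D) u \<noteq> 0" using \<open>Max D \<in> D\<close> by (auto simp: D_def)
      ultimately show ?thesis using u(1) by blast
    qed auto
  qed
  then obtain u d where ud: "\<And>n. n \<in> Q \<Longrightarrow> u n \<in> wt (\<alpha> - of_nat n) \<and> d n > 0 \<and> L (d n) (u n) \<noteq> 0 \<and> (\<forall>j>d n. L j (u n) = 0)"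
    by metis
  \<comment> \<open>Commuting \<open>L K\<close> past \<open>L (- n)\<close> leaves a multiple of
    \<open>L (K - n) (u n)\<close>, which is nonzero for \<open>K = g n\<close> and zero for larger
    \<open>K\<close>. The finite set \<open>A\<close> below is chosen so that \<open>g\<close> is
    injective on it; the largest \<open>g m\<close> with nonzero coefficient then singles out one
    summand.\<close>
  define g where "g n = int n + d n" for n
  have ginf: "infinite (g ` Q)"
  proof
    assume "finite (g ` Q)"
    then obtain b where b: "\<And>x. x \<in> g ` Q \<Longrightarrow> x \<le> b" using finite_has_maximal by (metis Max_ge)
    have "Q \<subseteq> {..nat b}"
    proof
      fix n assume n: "n \<in> Q"
      then have "int n + d n \<le> b" "d n > 0" using b ud by (auto simp: g_def)
      then show "n \<in> {..nat b}" by auto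
    qed
    then show False using Qinf finite_subset by blast
  qed
  obtain B where B: "finite B" "wt \<alpha> = span B" by (rule wt_fin')
  obtain Y where Y: "Y \<subseteq> g ` Q" "finite Y" "card Y = Suc (card B)"
    using infinite_arbitrarily_large[OF ginf] by blast
  define A where "A = inv_into Q g ` Y"
  have gi: "g (inv_into Q g y) = y" "inv_into Q g y \<in> Q" if "y \<in> Y" for y
    using that Y by (auto intro: f_inv_into_f inv_into_into)
  have "inj_on (inv_into Q g) Y" by (rule inj_on_inverseI[of _ g]) (rule gi(1))
  then have AQ: "A \<subseteq> Q" "finite A" "card A = card Y"
    using gi(2) Y by (auto simp: A_def card_image)
  have Ainj: "inj_on g A" unfolding A_def by (rule inj_onI) (auto simp: gi(1))
  define y where "y n = L (- int n) (u n)" for n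
  have ywt: "y n \<in> wt \<alpha>" if "n \<in> Q" for n
    using wt_L[of "u n" "\<alpha> - of_nat n" "- int n"] ud[OF that] by (simp add: y_def)
  have "\<exists>c. (\<exists>i\<in>A. c i \<noteq> 0) \<and> (\<Sum>i\<in>A. s (c i) (y i)) = 0"
    by (rule dependent_family[of _ B]) (use AQ Y B ywt in auto)
  then obtain c where c: "\<exists>i\<in>A. c i \<noteq> 0" "(\<Sum>i\<in>A. s (c i) (y i)) = 0" by blast
  define A' where "A' = {i \<in> A. c i \<noteq> 0}"
  have fA': "finite A'" "A' \<noteq> {}" using c AQ by (auto simp: A'_def)
  have "Max (g ` A') \<in> g ` A'" by (rule Max_in) (use fA' in auto)
  then obtain m where "m \<in> A'" "Max (g ` A') = g m" by auto
  then have m: "m \<in> A'" "\<And>i. i \<in> A' \<Longrightarrow> g i \<le> g m" using fA'(1) Max_ge[of "g ` A'"] by auto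
  have uC: "u n \<in> C" if "n \<in> A" for n using ud AQ that wt_C by blast
  have key: "L (g m) (y i) = (if i = m then s (of_int (g m + int m)) (L (d m) (u m)) else 0)" if i: "i \<in> A'" for i
  proof -
    have iA: "i \<in> A" "i \<in> Q" "m \<in> Q" "m \<in> A" using i m AQ by (auto simp: A'_def)
    have gi: "g i \<le> g m" "g i > int i" "g m > 0" using m i ud[OF iA(2)] ud[OF iA(3)] by (auto simp: g_def)
    have "L (g m) (u i) = 0" using ud[OF iA(2)] gi iA(2) by (auto simp: g_def Q_def)
    moreover have "g m \<noteq> int i" using gi by simp
    ultimately have "L (g m) (y i) = s (of_int (g m + int i)) (L (g m - int i) (u i))"
      using LL[OF uC[OF iA(1)], of "g m" "- int i"] by (simp add: y_def)
    moreover have "L (g m - int i) (u i) = 0" if "i \<noteq> m"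
    proof -
      have "g i \<noteq> g m" using Ainj iA that by (auto simp: inj_on_def)
      then show ?thesis using ud[OF iA(2)] gi by (auto simp: g_def)
    qed
    ultimately show ?thesis by (auto simp: g_def)
  qed
  have "(\<Sum>i\<in>A. s (c i) (y i)) = (\<Sum>i\<in>A'. s (c i) (y i))"
    by (rule sum.mono_neutral_right) (use AQ in \<open>auto simp: A'_def\<close>)
  then have "0 = L (g m) (\<Sum>i\<in>A'. s (c i) (y i))" using c by simp
  also have "\<dots> = (\<Sum>i\<in>A'. s (c i) (L (g m) (y i)))"
    using uC by (subst L_sum) (auto simp: y_def A'_def)
  also have "\<dots> = (\<Sum>i\<in>A'. if i = m then s (c m * of_int (g m + int m)) (L (d m) (u m)) else 0)"
    by (rule sum.cong) (auto simp: key)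
  also have "\<dots> = s (c m * of_int (g m + int m)) (L (d m) (u m))" using fA' m by simp
  finally have "c m * of_int (g m + int m) = 0 \<or> L (d m) (u m) = 0" by simp
  moreover have mQ: "m \<in> Q" "c m \<noteq> 0" using m AQ by (auto simp: A'_def)
  moreover have "g m + int m > 0" using ud[OF mQ(1)] by (auto simp: g_def)
  then have "of_int (g m + int m) \<noteq> (0::complex)" by (metis of_int_eq_0_iff less_irrefl)
  ultimately show False using ud by auto
qed

text \<open>Far down, all positive modes vanish on \<open>u\<close> and on \<open>L (- 1) u\<close>,
  so \<open>0 = L 1 (L (- 1) u) = 2 L 0 u\<close>, which forces weight zero. The second bound on
  \<open>n\<close> keeps the weight away from zero.\<close>

lemma wt_bounded_below:
  assumes sm: "\<And>v. v \<in> C \<Longrightarrow> smooth v"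
  shows "\<exists>n0::nat. \<forall>n\<ge>n0. wt (\<alpha> - of_nat n) = {0}"
proof -
  obtain n0 where n0: "\<And>n u j. n \<ge> n0 \<Longrightarrow> u \<in> wt (\<alpha> - of_nat n) \<Longrightarrow> j > 0 \<Longrightarrow> L j u = 0"
    using deep_singular[OF sm, of \<alpha>] by blast
  have "wt (\<alpha> - of_nat n) = {0}" if n: "n \<ge> n0 + 1" "n \<ge> nat \<lceil>Re \<alpha>\<rceil> + 1" for n
  proof -
    have "u = 0" if u: "u \<in> wt (\<alpha> - of_nat n)" for u
    proof -
      have "\<alpha> - of_nat n - of_int (- 1) = \<alpha> - of_nat (n - 1)" using n by (simp add: of_nat_diff)
      then have "L (- 1) u \<in> wt (\<alpha> - of_nat (n - 1))" using wt_L[OF u, of "- 1"] by metis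
      then have "L 1 (L (- 1) u) = 0" using n0[of "n - 1"] n by auto
      moreover have "L 1 u = 0" using n0[OF _ u, of 1] n by simp
      ultimately have "s 2 (L 0 u) = 0" using LL[OF wt_C[OF u], of 1 "- 1"] by simp
      then have "s (2 * (\<alpha> - of_nat n)) u = 0" using u by (simp add: wt_def)
      moreover have "\<alpha> \<noteq> of_nat n"
      proof
        assume "\<alpha> = of_nat n"
        then have "Re \<alpha> = real n" by simp
        then show False using n(2) by simp
      qed
      ultimately show ?thesis by simp
    qed
    then show ?thesis using subspace_0[OF wt_sub] by blast
  qed
  then show ?thesis by (intro exI[of _ "max (n0 + 1) (nat \<lceil>Re \<alpha>\<rceil> + 1)"]) auto
qed

lemma half_eq: "half r = of_int (2 * r + 1) / 2"
  by (simp add: half_def field_simps)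

lemma lowest_vector:
  assumes sm: "\<And>v. v \<in> C \<Longrightarrow> smooth v"
  obtains v \<alpha> p where "v \<in> wt \<alpha>" "v \<noteq> 0" "v \<in> H p" "\<And>j. j > 0 \<Longrightarrow> L j v = 0" "\<And>j. j \<ge> 0 \<Longrightarrow> P j v = 0"
proof -
  obtain \<alpha> v0 where v0: "v0 \<in> wt \<alpha>" "v0 \<noteq> 0" by (rule ex_wt)
  obtain n1 where n1: "\<And>n. n \<ge> n1 \<Longrightarrow> wt (\<alpha> - of_nat n) = {0}" using wt_bounded_below[OF sm, of \<alpha>] by auto
  obtain n2 where n2: "\<And>n. n \<ge> n2 \<Longrightarrow> wt (\<alpha> - 1/2 - of_nat n) = {0}" using wt_bounded_below[OF sm, of "\<alpha> - 1/2"] by auto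
  \<comment> \<open>\<open>h\<close> counts half steps down from \<alpha>: even ones stay in the
    coset of \<alpha> modulo the integers, odd ones in that of \<open>\<alpha> - 1/2\<close>, as a
    \<psi> changes the weight by a half-integer. Each coset has its own bound.\<close>
  define K where "K = {h::nat. wt (\<alpha> - of_nat h / 2) \<noteq> {0}}"
  have "K \<subseteq> {..2 * (n1 + n2) + 1}"
  proof
    fix h assume h: "h \<in> K"
    show "h \<in> {..2 * (n1 + n2) + 1}"
    proof (rule ccontr)
      assume "\<not> ?thesis"
      then have hh: "h > 2 * (n1 + n2) + 1" by simp
      show False
      proof (cases "even h")
        case True
        then obtain n where "h = 2 * n" by blast
        then show False using n1[of n] hh h by (simp add: K_def)
      next
        case False
        then obtain n where "h = 2 * n + 1" using oddE by blast
        then show False using n2[of n] hh h by (simp add: K_def add_divide_distrib algebra_simps)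
      qed
    qed
  qed
  then have fK: "finite K" by (rule finite_subset) simp
  have "0 \<in> K" using v0 by (auto simp: K_def)
  define h where "h = Max K"
  have h: "h \<in> K" "\<And>i. i \<in> K \<Longrightarrow> i \<le> h" using fK \<open>0 \<in> K\<close> Max_in by (auto simp: h_def)
  define \<beta> where "\<beta> = \<alpha> - of_nat h / 2"
  have z: "wt (\<beta> - of_nat i / 2) = {0}" if "i > 0" for i
  proof -
    have "i + h \<notin> K" using h(2)[of "i + h"] that by auto
    then show ?thesis by (simp add: K_def \<beta>_def add_divide_distrib algebra_simps)
  qed
  obtain v where v: "v \<in> wt \<beta>" "v \<noteq> 0" using h(1) subspace_0[OF wt_sub] by (auto simp: K_def \<beta>_def)
  obtain w p where w: "w \<in> wt \<beta>" "w \<in> H p" "w \<noteq> 0"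
  proof -
    obtain a b where "a \<in> wt \<beta> \<inter> H False" "b \<in> wt \<beta> \<inter> H True" "v = a + b"
      using wt_graded v unfolding graded_def by blast
    then show ?thesis using that[of a False] that[of b True] v by force
  qed
  show ?thesis
  proof (rule that[OF w(1,3,2)])
    fix j :: int assume j: "j > 0"
    have "of_nat (nat (2 * j)) / 2 = (of_int j :: complex)" using j by simp
    then show "L j w = 0" using wt_L[OF w(1), of j] z[of "nat (2 * j)"] j by simp
  next
    fix j :: int assume j: "j \<ge> 0"
    have "of_nat (nat (2 * j + 1)) / 2 = half j" using j by (simp add: half_eq)
    then show "P j w = 0" using wt_P[OF w(1), of j] z[of "nat (2 * j + 1)"] j by simp
  qed
qed

text \<open>Monomials in the modes that do not lower the weight, applied to \<open>u\<close>; the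
  first component records by how much the weight has been raised.\<close>

inductive_set lowgen :: "'a \<Rightarrow> (complex \<times> 'a) set" for u where
  base: "(0, u) \<in> lowgen u"
| L: "(h, v) \<in> lowgen u \<Longrightarrow> j \<ge> 0 \<Longrightarrow> (h + of_int j, L (- j) v) \<in> lowgen u"
| P: "(h, v) \<in> lowgen u \<Longrightarrow> r < 0 \<Longrightarrow> (h - half r, P r v) \<in> lowgen u"

text \<open>The span is stable under the remaining modes as well: they are commuted to the right
  through a monomial until they meet \<open>u\<close>, which they kill. The induction treats all
  modes at once, since commutators produce modes of other indices.\<close>

lemma lowgen_span:
  assumes u: "u \<in> wt \<alpha>" "u \<noteq> 0" "u \<in> H p" "\<And>j. j > 0 \<Longrightarrow> L j u = 0" "\<And>j. j \<ge> 0 \<Longrightarrow> P j u = 0"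
  shows "C = span (snd ` lowgen u)"
proof -
  let ?G = "snd ` lowgen u"
  have uC: "u \<in> C" using u by (auto intro: wt_C)
  have GC: "v \<in> C" if "(h, v) \<in> lowgen u" for h v using that by induction (auto intro: uC)
  have GH: "\<exists>q. v \<in> H q" if "(h, v) \<in> lowgen u" for h v
    using that by induction (use u L_hom P_hom in blast)+
  have NC: "span ?G \<subseteq> C" by (rule span_minimal[OF _ C_sub]) (auto intro: GC)
  have sb: "v \<in> span ?G" if "(h, v) \<in> lowgen u" for h v using that by (force intro: span_base)
  have Lneg: "L (- j) v \<in> span ?G" if "j \<ge> 0" "v \<in> span ?G" for j v
  proof (rule lin_on_span_subset[OF L_lin C_sub _ subspace_span _ that(2)])
    show "?G \<subseteq> C" using GC by auto
    fix g assume "g \<in> ?G"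
    then obtain h where "(h, g) \<in> lowgen u" by auto
    then show "L (- j) g \<in> span ?G" by (rule sb[OF lowgen.L[OF _ that(1)]])
  qed
  have Pneg: "P r v \<in> span ?G" if "r < 0" "v \<in> span ?G" for r v
  proof (rule lin_on_span_subset[OF P_lin C_sub _ subspace_span _ that(2)])
    show "?G \<subseteq> C" using GC by auto
    fix g assume "g \<in> ?G"
    then obtain h where "(h, g) \<in> lowgen u" by auto
    then show "P (r) g \<in> span ?G" by (rule sb[OF lowgen.P[OF _ that(1)]])
  qed
  have main: "\<forall>j. L j v \<in> span ?G \<and> P j v \<in> span ?G" if "(h, v) \<in> lowgen u" for h v
    using that
  proof induction
    case base
    have "L j u \<in> span ?G" for j
      using Lneg[of "- j" u] sb[OF lowgen.base] u(4)[of j] by (cases "j > 0") (auto simp: span_zero)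
    moreover have "P j u \<in> span ?G" for j
      using Pneg[of j u] sb[OF lowgen.base] u(5)[of j] by (cases "j \<ge> 0") (auto simp: span_zero)
    ultimately show ?case by blast
  next
    case (L h v i)
    note vC = GC[OF L(1)]
    show ?case
    proof (intro allI conjI)
      fix j
      have "L j (L (- i) v) = L (- i) (L j v) + s (of_int (j + i)) (L (j - i) v)
          + (if j = i then s ((of_int j ^ 3 - of_int j) / 12 * k) v else 0)"
        using LL[OF vC, of j "- i"] by (simp add: algebra_simps)
      then show "L j (L (- i) v) \<in> span ?G"
        using L sb[OF L(1)] by (auto intro!: span_add span_scale Lneg span_zero)
      have "P j (L (- i) v) = L (- i) (P j v) - s (- half j + of_int i / 2) (P (j - i) v)"
        using LP[OF vC, of "- i" j] by (simp add: algebra_simps)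
      then show "P j (L (- i) v) \<in> span ?G"
        using L by (auto intro!: span_diff span_scale Lneg)
    qed
  next
    case (P h v r)
    note vC = GC[OF P(1)]
    show ?case
    proof (intro allI conjI)
      fix j
      have "L j (P r v) = P r (L j v) + s (- half r - of_int j / 2) (P (j + r) v)"
        using LP[OF vC, of j r] by (simp add: algebra_simps)
      moreover have "P r (L j v) \<in> span ?G" "P (j + r) v \<in> span ?G" using P by (blast intro: Pneg)+
      ultimately show "L j (P r v) \<in> span ?G" by (simp add: span_add span_scale)
      have "P j (P r v) = (if j + r = - 1 then s \<zeta> v else 0) - P r (P j v)"
        using PP[OF vC, of j r] by (simp add: algebra_simps)
      moreover have "P r (P j v) \<in> span ?G" using P by (blast intro: Pneg)
      ultimately show "P j (P r v) \<in> span ?G"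
        using sb[OF P(1)] by (simp add: span_diff span_scale span_neg)
    qed
  qed
  have "span ?G = C"
  proof (rule simple_graded[of _ u])
    show "graded (span ?G)" by (rule graded_span) (use GH in force)
    show "L m v \<in> span ?G" if "v \<in> span ?G" for m v
      by (rule lin_on_span_subset[OF L_lin C_sub _ subspace_span _ that]) (use GC main in auto)
    show "P m v \<in> span ?G" if "v \<in> span ?G" for m v
      by (rule lin_on_span_subset[OF P_lin C_sub _ subspace_span _ that]) (use GC main in auto)
  qed (use NC sb[OF lowgen.base] u in auto)
  then show ?thesis by simp
qed

lemma lowgen_wt:
  assumes "u \<in> wt \<alpha>" "(h, v) \<in> lowgen u"
  shows "v \<in> wt (\<alpha> + h) \<and> (\<exists>n::nat. h = of_nat n / 2)"
  using assms(2)
proof induction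
  case base
  then show ?case using assms(1) by (auto intro!: exI[of _ 0])
next
  case (L h v j)
  then obtain n :: nat where n: "h = of_nat n / 2" by blast
  have "h + of_int j = of_nat (n + nat (2 * j)) / 2" using L n by (simp add: add_divide_distrib)
  moreover have "L (- j) v \<in> wt (\<alpha> + (h + of_int j))" using wt_L[of v "\<alpha> + h" "- j"] L by (simp add: add.assoc)
  ultimately show ?case by blast
next
  case (P h v r)
  then obtain n :: nat where n: "h = of_nat n / 2" by blast
  have "h - half r = of_nat (n + nat (- 2 * r - 1)) / 2" using P n by (simp add: half_eq field_simps)
  moreover have "P r v \<in> wt (\<alpha> + (h - half r))" using wt_P[of v "\<alpha> + h" r] P by (simp add: algebra_simps)
  ultimately show ?case by blast
qed

lemma singular_lowest:
  assumes u: "u \<in> wt \<alpha>" "u \<noteq> 0" "u \<in> H p" "\<And>j. j > 0 \<Longrightarrow> L j u = 0" "\<And>j. j \<ge> 0 \<Longrightarrow> P j u = 0"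
    and v: "v \<in> wt (\<alpha> - of_nat n / 2)" "n > 0"
  shows "v = 0"
proof (rule wt_disjoint[OF v(1)])
  have "v \<in> span (snd ` lowgen u)" using lowgen_span[OF u] v wt_C by blast
  moreover have "snd ` lowgen u \<subseteq> (\<Union>\<beta>\<in>range (\<lambda>n::nat. \<alpha> + of_nat n / 2). wt \<beta>)"
    using lowgen_wt[OF u(1)] by fastforce
  ultimately show "v \<in> span (\<Union>\<beta>\<in>range (\<lambda>n::nat. \<alpha> + of_nat n / 2). wt \<beta>)" using span_mono by blast
  show "\<alpha> - of_nat n / 2 \<notin> range (\<lambda>n::nat. \<alpha> + of_nat n / 2)"
  proof
    assume "\<alpha> - of_nat n / 2 \<in> range (\<lambda>n::nat. \<alpha> + of_nat n / 2)"
    then obtain i :: nat where "\<alpha> - of_nat n / 2 = \<alpha> + of_nat i / 2" by blast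
    moreover have "(of_nat i + of_nat n) / 2 = (\<alpha> + of_nat i / 2) - (\<alpha> - of_nat n / 2)"
      by (simp add: add_divide_distrib)
    ultimately have "(of_nat i + of_nat n) / 2 = (0 :: complex)" by (metis diff_self)
    then have "of_nat i + of_nat n = (0 :: complex)" by simp
    then have "(of_nat (i + n) :: complex) = 0" by simp
    then show False using v(2) by (metis add_is_0 less_irrefl of_nat_eq_0_iff)
  qed
qed

text \<open>Suppose some \<psi> of negative index does not kill the lowest weight vector
  \<open>v\<close>, and take the one closest to zero. Its value \<open>u\<close> is again killed by
  all positive modes: by \<open>\<zeta> = 0\<close> for the \<psi>'s and by the minimal choice for
  the \<open>L j\<close>. Then \<open>u\<close> generates only weights from its own upwards, while
  \<open>v\<close> lies strictly below.\<close>

lemma smooth_annih: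
  assumes "\<zeta> = 0" and sm: "\<And>v. v \<in> C \<Longrightarrow> smooth v"
  shows "\<exists>v\<in>C. v \<noteq> 0 \<and> (\<forall>r. P r v = 0)"
proof -
  obtain v \<alpha> p where v: "v \<in> wt \<alpha>" "v \<noteq> 0" "v \<in> H p" "\<And>j. j > 0 \<Longrightarrow> L j v = 0" "\<And>j. j \<ge> 0 \<Longrightarrow> P j v = 0"
    using lowest_vector[OF sm] by blast
  have vC: "v \<in> C" using v wt_C by blast
  have "P (- 1 - int n) v = 0" for n
  proof (induction n rule: less_induct)
    case (less n)
    define u where "u = P (- 1 - int n) v"
    have uw: "u \<in> wt (\<alpha> - half (- 1 - int n))" unfolding u_def by (rule wt_P[OF v(1)])
    have P0: "P j v = 0" if "j > - 1 - int n" for j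
      using less[of "nat (- 1 - j)"] v(5)[of j] that by (cases "j \<ge> 0") auto
    have Lu: "L j u = 0" if "j > 0" for j
      using LP[OF vC, of j "- 1 - int n"] P0[of "j + (- 1 - int n)"] v(4)[OF that] that by (simp add: u_def)
    have Pu: "P j u = 0" if "j \<ge> 0" for j
      using PP[OF vC, of j "- 1 - int n"] v(5)[OF that] assms(1) by (simp add: u_def)
    have vw: "v \<in> wt (\<alpha> - half (- 1 - int n) - of_nat (2 * n + 1) / 2)"
      using v(1) by (simp add: half_def field_simps)
    have uH: "u \<in> H (\<not> p)" unfolding u_def by (rule P_hom[OF v(3)])
    have "u = 0" 
    proof (rule ccontr)
      assume "u \<noteq> 0"
      then have "v = 0" by (rule singular_lowest[OF uw _ uH Lu Pu vw]) simp_all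
      then show False using v(2) by simp
    qed
    then show ?case by (simp add: u_def)
  qed
  then have "P r v = 0" for r
    using v(5)[of r] spec[of "\<lambda>n. P (- 1 - int n) v = 0" "nat (- 1 - r)"] by (cases "r \<ge> 0") auto
  then show ?thesis using v vC by blast
qed

lemma annih_all:
  assumes "x \<in> C" "x \<noteq> 0" "\<And>r. P r x = 0" "v \<in> C" shows "P r v = 0"
proof -
  define N where "N = {v \<in> C. \<forall>r. P r v = 0}"
  have "N = C"
  proof (rule simple_graded[of _ x])
    show "subspace N" by (rule subspaceI) (auto simp: N_def)
    show "graded N" unfolding graded_def
    proof
      fix y assume y: "y \<in> N"
      then obtain a b where ab: "a \<in> H False" "b \<in> H True" "y = a + b" by (auto simp: N_def elim: C_cases)
      have z: "0 \<in> H False" "0 \<in> H True" using subspace_0[OF H_sub] by auto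
      have "P r b + P r a = 0 + 0" for r using y ab by (simp add: N_def H_C add.commute)
      then have "P r a = 0 \<and> P r b = 0" for r
        using H_unique[of "P r b" 0 "P r a" 0] z P_hom[of a False] P_hom[of b True] ab by auto
      then show "\<exists>a\<in>N \<inter> H False. \<exists>b\<in>N \<inter> H True. y = a + b"
        using ab by (intro bexI[of _ a] bexI[of _ b]) (auto simp: N_def H_C)
    qed
    fix y assume y: "y \<in> N"
    show "L m y \<in> N" for m
      using y LP[of y m] by (auto simp: N_def)
    show "P r y \<in> N" for r using y by (auto simp: N_def)
  qed (use assms in \<open>auto simp: N_def\<close>)
  then show ?thesis using assms by (auto simp: N_def)
qed

end

section \<open>Bounded weight multiplicities\<close>

context fvmod
begin

definition PL :: "int list \<Rightarrow> 'a \<Rightarrow> 'a" where "PL xs v = foldr P xs v"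

lemma PL_simps [simp]: "PL [] v = v" "PL (x # xs) v = P x (PL xs v)" "PL (xs @ ys) v = PL xs (PL ys v)"
  by (simp_all add: PL_def)

lemma PL_lin: "lin_on C (PL xs)"
proof (induction xs)
  case Nil
  then show ?case by (simp add: lin_on_def)
next
  case (Cons x xs)
  then show ?case using lin_on_comp[OF P_lin Cons] by (simp add: lin_on_def)
qed

lemma PL_C [simp, intro]: "v \<in> C \<Longrightarrow> PL xs v \<in> C"
  using PL_lin by (rule lin_onD(1))

lemma PL_wt: "v \<in> wt \<alpha> \<Longrightarrow> PL xs v \<in> wt (\<alpha> - (\<Sum>x\<leftarrow>xs. half x))"
proof (induction xs)
  case (Cons x xs)
  then show ?case using wt_P[OF Cons.IH, of x] by (simp add: algebra_simps)
qed simp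

text \<open>Repeated brackets of \<open>L n\<close> and \<open>L (n + 1)\<close> give all
  \<open>L j\<close> with \<open>j = a n + b (n + 1)\<close> and \<open>a, b \<ge> 1\<close>, which
  covers all large \<open>j\<close>. A bracket of such an \<open>L j\<close> with \<open>P n\<close>
  then reaches all large \<open>P\<close>.\<close>

lemma bounded_L_step:
  assumes n: "n \<ge> 1" and v: "v \<in> wt \<alpha>" "L n v = 0" "L (n + 1) v = 0" "P n v = 0"
  shows "smooth v"
proof -
  have vC: "v \<in> C" using v wt_C by blast
  have add: "L (i + j) v = 0" if "L i v = 0" "L j v = 0" "i \<noteq> j" "i + j > 0" for i j
  proof -
    have "s (of_int (i - j)) (L (i + j) v) = 0" using LL[OF vC, of i j] that by auto
    then show ?thesis using that by simp
  qed
  have comb: "L ((int a + 1) * n + (int b + 1) * (n + 1)) v = 0" for a b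
  proof (induction "a + b" arbitrary: a b)
    case 0
    then show ?case using add[of n "n + 1"] v n by simp
  next
    case (Suc t)
    have pos: "(int c + 1) * n \<ge> n" "(int c + 1) * (n + 1) \<ge> n + 1" for c
      using n by (simp_all add: algebra_simps)
    show ?case
    proof (cases a)
      case (Suc a')
      then have IH: "L ((int a' + 1) * n + (int b + 1) * (n + 1)) v = 0" using Suc.hyps by simp
      have "L (n + ((int a' + 1) * n + (int b + 1) * (n + 1))) v = 0"
        by (rule add[OF v(2) IH]) (use pos(1)[of a'] pos(2)[of b] n in linarith)+
      then show ?thesis using Suc by (simp add: algebra_simps)
    next
      case 0
      then obtain b' where b': "b = Suc b'" using Suc by (cases b) auto
      then have IH: "L ((int a + 1) * n + (int b' + 1) * (n + 1)) v = 0" using Suc.hyps by simp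
      have "L ((n + 1) + ((int a + 1) * n + (int b' + 1) * (n + 1))) v = 0"
        by (rule add[OF v(3) IH]) (use pos(1)[of a] pos(2)[of b'] n in linarith)+
      then show ?thesis using b' by (simp add: algebra_simps)
    qed
  qed
  have Lj: "L j v = 0" if j: "j \<ge> n * (2 * n + 3)" for j
  proof -
    define q where "q = j div n"
    define r where "r = j mod n"
    have r: "0 \<le> r" "r < n" using n by (auto simp: r_def)
    have jq: "j = q * n + r" by (simp add: q_def r_def)
    have "q \<ge> 2 * n + 3" unfolding q_def using zdiv_mono1[OF j, of n] n by simp
    \<comment> \<open>Write \<open>j = q n + r\<close> as \<open>r + n\<close> copies of
      \<open>n + 1\<close> and \<open>q - r - n - 1\<close> copies of \<open>n\<close>; taking
      \<open>r + n\<close> rather than \<open>r\<close> copies keeps both numbers positive. In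
      \<open>comb\<close> both are shifted by one.\<close>
    then obtain a b where ab: "int a = q - r - n - 2" "int b = r + n - 1"
      using r n zero_le_imp_eq_int[of "q - r - n - 2"] zero_le_imp_eq_int[of "r + n - 1"] by fastforce
    have "j = (int a + 1) * n + (int b + 1) * (n + 1)" unfolding ab jq by (simp add: algebra_simps)
    then show ?thesis using comb[of a b] by simp
  qed
  have Pj: "P (j + n) v = 0" if j: "j \<ge> n * (2 * n + 3)" for j
  proof -
    have "j \<ge> 0" using j n by (meson mult_nonneg_nonneg order_trans add_nonneg_nonneg zero_le_numeral zero_le_one)
    have "- half n - of_int j / 2 = - (of_int (2 * n + 1 + j) / 2)" by (simp add: half_eq add_divide_distrib)
    moreover have "2 * n + 1 + j \<noteq> 0" using n \<open>j \<ge> 0\<close> by simp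
    then have "of_int (2 * n + 1 + j) \<noteq> (0::complex)" by (metis of_int_eq_0_iff)
    ultimately show ?thesis using LP[OF vC, of j n] Lj[OF j] v by simp
  qed
  show ?thesis unfolding smooth_def
  proof (intro exI allI impI conjI)
    fix j assume "j \<ge> n * (2 * n + 3) + n"
    then show "L j v = 0" "P j v = 0" using Lj[of j] Pj[of "j - n"] n by auto
  qed
qed

definition spanned_by :: "nat \<Rightarrow> 'a set \<Rightarrow> bool" where
  "spanned_by N U \<longleftrightarrow> (\<exists>B. finite B \<and> card B \<le> N \<and> U \<subseteq> span B)"

lemma spanned_by_mono: "spanned_by N U \<Longrightarrow> N \<le> N' \<Longrightarrow> spanned_by N' U"
  unfolding spanned_by_def using order_trans by blast

text \<open>For \<open>n \<ge> 1\<close> the modes \<open>L n\<close>, \<open>L (n + 1)\<close>,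
  \<open>P n\<close> map the weight space of \<open>\<alpha> + n\<close> into the three fixed spaces
  of weights \<alpha>, \<open>\<alpha> - 1\<close>, \<open>\<alpha> - 1/2\<close>. By
  \<open>bounded_L_step\<close> their common kernel consists of smooth vectors, so it is zero and
  the dimension is at most the sum of the three.\<close>

lemma wt_bound_pos:
  assumes ns: "\<And>v. v \<in> C \<Longrightarrow> smooth v \<Longrightarrow> v = 0"
  shows "\<exists>N. \<forall>n\<ge>0::int. spanned_by N (wt (\<alpha> + of_int n))"
proof -
  obtain B1 where B1: "finite B1" "wt \<alpha> = span B1" by (rule wt_fin')
  obtain B2 where B2: "finite B2" "wt (\<alpha> - 1) = span B2" by (rule wt_fin')
  obtain B3 where B3: "finite B3" "wt (\<alpha> - 1/2) = span B3" by (rule wt_fin')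
  define N where "N = card B1 + card B2 + card B3"
  have "spanned_by N (wt (\<alpha> + of_int n))" if n: "n \<ge> 1" for n
  proof -
    obtain B where B: "finite B" "wt (\<alpha> + of_int n) = span B" by (rule wt_fin')
    obtain I where I: "I \<subseteq> span B" "independent I" "span B \<subseteq> span I"
      using basis_exists[of "span B"] by metis
    have fI: "finite I" using independent_span_bound[OF B(1) I(2,1)] by simp
    have "card I \<le> N"
    proof (rule ccontr)
      assume "\<not> ?thesis"
      then have cI: "card I > N" by simp
      have Iw: "x \<in> wt (\<alpha> + of_int n)" if "x \<in> I" for x using that I B by blast
      have m: "L n x \<in> span B1" "L (n + 1) x \<in> span B2" "P n x \<in> span B3" if "x \<in> I" for x
        using wt_L[OF Iw[OF that], of n] wt_L[OF Iw[OF that], of "n + 1"] wt_P[OF Iw[OF that], of n] B1 B2 B3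
        by (simp_all add: half_def algebra_simps)
      have "\<forall>x\<in>I. \<exists>u. L n x = (\<Sum>b\<in>B1. s (u b) b)" using span_finite_coords[OF B1(1) m(1)] by metis
      then obtain u1 where u1: "\<And>x. x \<in> I \<Longrightarrow> L n x = (\<Sum>b\<in>B1. s (u1 x b) b)" by metis
      have "\<forall>x\<in>I. \<exists>u. L (n + 1) x = (\<Sum>b\<in>B2. s (u b) b)" using span_finite_coords[OF B2(1) m(2)] by metis
      then obtain u2 where u2: "\<And>x. x \<in> I \<Longrightarrow> L (n + 1) x = (\<Sum>b\<in>B2. s (u2 x b) b)" by metis
      have "\<forall>x\<in>I. \<exists>u. P n x = (\<Sum>b\<in>B3. s (u b) b)" using span_finite_coords[OF B3(1) m(3)] by metis
      then obtain u3 where u3: "\<And>x. x \<in> I \<Longrightarrow> P n x = (\<Sum>b\<in>B3. s (u3 x b) b)" by metis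
      \<comment> \<open>One equation for each coordinate of each image; the tags keep the three
        bases apart even if they share vectors.\<close>
      define J where "J = (Inl ` Inl ` B1 \<union> Inl ` Inr ` B2 \<union> Inr ` B3 :: (('a + 'a) + 'a) set)"
      define c where "c j x = (case j of Inl (Inl b) \<Rightarrow> u1 x b | Inl (Inr b) \<Rightarrow> u2 x b | Inr b \<Rightarrow> u3 x b)" for j x
      have fJ: "finite J" using B1 B2 B3 by (simp add: J_def)
      have "card J \<le> card (Inl ` Inl ` B1 :: (('a + 'a) + 'a) set) + card (Inl ` Inr ` B2 :: (('a + 'a) + 'a) set)
          + card (Inr ` B3 :: (('a + 'a) + 'a) set)"
        unfolding J_def by (meson card_Un_le add_le_mono1 order_trans)
      also have "\<dots> = N" by (simp add: N_def card_image inj_on_def)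
      finally have "card J < card I" using cI by simp
      then obtain l where l: "\<exists>x\<in>I. l x \<noteq> 0" "\<And>j. j \<in> J \<Longrightarrow> (\<Sum>x\<in>I. l x * c j x) = 0"
        using complex_system_nontrivial[OF fI fJ, of c] by blast
      define v where "v = (\<Sum>x\<in>I. s (l x) x)"
      have vw: "v \<in> wt (\<alpha> + of_int n)" unfolding v_def
        using Iw by (intro subspace_sum[OF wt_sub] subspace_scale[OF wt_sub]) auto
      have IC: "x \<in> C" if "x \<in> I" for x using Iw[OF that] wt_C by blast
      have comb: "(\<Sum>x\<in>I. s (l x) (\<Sum>b\<in>B'. s (u x b) b)) = (\<Sum>b\<in>B'. s (\<Sum>x\<in>I. l x * u x b) b)" for u and B' :: "'a set"
        by (simp add: scale_sum_right scale_sum_left sum.swap[of _ B' I])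
      have "L n v = (\<Sum>x\<in>I. s (l x) (L n x))" unfolding v_def using IC by (subst L_sum) auto
      also have "\<dots> = (\<Sum>b\<in>B1. s (\<Sum>x\<in>I. l x * u1 x b) b)" by (simp add: u1 comb)
      also have "\<dots> = 0"
        using l(2)[of "Inl (Inl _)"] by (intro sum.neutral) (auto simp: J_def c_def)
      finally have 1: "L n v = 0" .
      have "L (n + 1) v = (\<Sum>x\<in>I. s (l x) (L (n + 1) x))" unfolding v_def using IC by (subst L_sum) auto
      also have "\<dots> = (\<Sum>b\<in>B2. s (\<Sum>x\<in>I. l x * u2 x b) b)" by (simp add: u2 comb)
      also have "\<dots> = 0"
        using l(2)[of "Inl (Inr _)"] by (intro sum.neutral) (auto simp: J_def c_def)
      finally have 2: "L (n + 1) v = 0" .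
      have "P n v = (\<Sum>x\<in>I. s (l x) (P n x))" unfolding v_def using IC by (subst P_sum) auto
      also have "\<dots> = (\<Sum>b\<in>B3. s (\<Sum>x\<in>I. l x * u3 x b) b)" by (simp add: u3 comb)
      also have "\<dots> = 0"
        using l(2)[of "Inr _"] by (intro sum.neutral) (auto simp: J_def c_def)
      finally have 3: "P n v = 0" .
      have "smooth v" by (rule bounded_L_step[OF n vw 1 2 3])
      then have "v = 0" using ns wt_C[OF vw] by blast
      then show False using I(2) l(1) fI by (auto simp: v_def dependent_finite)
    qed
    then show ?thesis unfolding spanned_by_def using fI I B by blast
  qed
  moreover have "spanned_by N (wt \<alpha>)" unfolding spanned_by_def N_def using B1 by (intro exI[of _ B1]) auto
  ultimately have "spanned_by N (wt (\<alpha> + of_int n))" if "n \<ge> 0" for n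
    using that by (cases "n = 0") auto
  then show ?thesis by blast
qed

text \<open>The weight spaces over a single coset of \<open>(1/2) Z\<close> already span a graded
  submodule.\<close>

lemma wt_support:
  assumes v0: "v0 \<in> wt \<alpha>" "v0 \<noteq> 0" "v0 \<in> H p" and \<beta>: "\<And>m::int. \<beta> \<noteq> \<alpha> + of_int m / 2"
  shows "wt \<beta> = {0}"
proof -
  let ?G = "\<Union>q. \<Union>m::int. wt (\<alpha> + of_int m / 2) \<inter> H q"
  have GC: "?G \<subseteq> C" by (auto intro: wt_C)
  have "span ?G = C"
  proof (rule simple_graded[of _ v0])
    show "span ?G \<subseteq> C" by (rule span_minimal[OF GC C_sub])
    show "graded (span ?G)" by (rule graded_span) auto
    have sL: "L j g \<in> span ?G" if g: "g \<in> ?G" for j g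
    proof -
      obtain q m where q: "g \<in> wt (\<alpha> + of_int m / 2)" "g \<in> H q" using g by blast
      have e: "\<alpha> + of_int m / 2 - of_int j = \<alpha> + of_int (m - 2 * j) / 2" by (simp add: field_simps)
      show ?thesis using wt_L[OF q(1), of j] L_hom[OF q(2), of j] unfolding e by (blast intro: span_base)
    qed
    have sP: "P j g \<in> span ?G" if g: "g \<in> ?G" for j g
    proof -
      obtain q m where q: "g \<in> wt (\<alpha> + of_int m / 2)" "g \<in> H q" using g by blast
      have e: "\<alpha> + of_int m / 2 - half j = \<alpha> + of_int (m - 2 * j - 1) / 2" by (simp add: half_def field_simps)
      show ?thesis using wt_P[OF q(1), of j] P_hom[OF q(2), of j] unfolding e by (blast intro: span_base)
    qed
    show "L j v \<in> span ?G" if "v \<in> span ?G" for j v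
      by (rule lin_on_span_subset[OF L_lin C_sub GC subspace_span sL that])
    show "P j v \<in> span ?G" if "v \<in> span ?G" for j v
      by (rule lin_on_span_subset[OF P_lin C_sub GC subspace_span sP that])
    show "v0 \<in> span ?G" using v0 by (intro span_base) (auto intro!: exI[of _ 0])
  qed (use v0 in auto)
  moreover have "?G \<subseteq> (\<Union>\<gamma>\<in>range (\<lambda>m::int. \<alpha> + of_int m / 2). wt \<gamma>)" by blast
  ultimately have C: "C \<subseteq> span (\<Union>\<gamma>\<in>range (\<lambda>m::int. \<alpha> + of_int m / 2). wt \<gamma>)" using span_mono by metis
  have "v = 0" if "v \<in> wt \<beta>" for v
  proof (rule wt_disjoint[OF that])
    show "v \<in> span (\<Union>\<gamma>\<in>range (\<lambda>m::int. \<alpha> + of_int m / 2). wt \<gamma>)" using C wt_C[OF that] by blast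
    show "\<beta> \<notin> range (\<lambda>m::int. \<alpha> + of_int m / 2)" using \<beta> by blast
  qed
  then show ?thesis using subspace_0[OF wt_sub] by blast
qed

lemma mirror_wt: "fvmod.wt s H (\<lambda>m v. - L (- m) v) \<alpha> = wt (- \<alpha>)"
  unfolding fvmod.wt_def[OF mirror]
  by (auto simp: wt_def minus_equation_iff[of _ "s \<alpha> _"] equation_minus_iff[of "L 0 _"] eq_commute[of "L 0 _" "s \<alpha> _"] eq_commute[of "- s \<alpha> _"])

text \<open>All weights lie in \<open>\<alpha> + (1/2) Z\<close>, which is covered by four
  half-lines: two cosets of the integers, each followed upwards in the module and, through the
  mirrored module, downwards.\<close>

lemma wt_bounded:
  assumes ns: "\<And>v. v \<in> C \<Longrightarrow> smooth v \<Longrightarrow> v = 0"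
    and ns': "\<And>v. v \<in> C \<Longrightarrow> fvmod.smooth (\<lambda>m v. - L (- m) v) (\<lambda>r. P (- r - 1)) v \<Longrightarrow> v = 0"
  shows "\<exists>N. \<forall>\<alpha>. spanned_by N (wt \<alpha>)"
proof -
  interpret M: fvmod s H "\<lambda>m v. - L (- m) v" "\<lambda>r. P (- r - 1)" "- k" \<zeta> by (rule mirror)
  obtain \<alpha> v0 p where v0: "v0 \<in> wt \<alpha>" "v0 \<noteq> 0" "v0 \<in> H p" by (rule ex_wt)
  obtain N1 where N1: "\<And>n. n \<ge> 0 \<Longrightarrow> spanned_by N1 (wt (\<alpha> + of_int n))" using wt_bound_pos[OF ns] by blast
  obtain N2 where N2: "\<And>n. n \<ge> 0 \<Longrightarrow> spanned_by N2 (wt (\<alpha> + 1/2 + of_int n))" using wt_bound_pos[OF ns] by blast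
  obtain N3 where N3: "\<And>n. n \<ge> 0 \<Longrightarrow> M.spanned_by N3 (M.wt (- \<alpha> + of_int n))" using M.wt_bound_pos[OF ns'] by blast
  obtain N4 where N4: "\<And>n. n \<ge> 0 \<Longrightarrow> M.spanned_by N4 (M.wt (- \<alpha> - 1/2 + of_int n))" using M.wt_bound_pos[OF ns'] by blast
  define N where "N = N1 + N2 + N3 + N4"
  have "spanned_by N (wt \<beta>)" for \<beta>
  proof (cases "\<exists>m::int. \<beta> = \<alpha> + of_int m / 2")
    case False
    then have "wt \<beta> = {0}" using wt_support[OF v0] by blast
    then show ?thesis unfolding spanned_by_def by (intro exI[of _ "{}"]) auto
  next
    case True
    then obtain m :: int where m: "\<beta> = \<alpha> + of_int m / 2" by blast
    consider n where "m = 2 * n" "n \<ge> 0" | n where "m = 2 * n" "n \<le> 0" | n where "m = 2 * n + 1" "n \<ge> 0" | n where "m = 2 * n + 1" "n \<le> 0"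
      by (metis evenE linear oddE)
    then show ?thesis
    proof cases
      case 1
      then show ?thesis using spanned_by_mono[OF N1[of n], of N] m by (simp add: N_def)
    next
      case 2
      then show ?thesis using spanned_by_mono[OF N3[of "- n"], of N] m by (simp add: N_def mirror_wt add.commute)
    next
      case 3
      then show ?thesis using spanned_by_mono[OF N2[of n], of N] m by (simp add: N_def add_divide_distrib algebra_simps)
    next
      case 4
      then show ?thesis using spanned_by_mono[OF N4[of "- n"], of N] m
        by (simp add: N_def mirror_wt add_divide_distrib algebra_simps)
    qed
  qed
  then show ?thesis by blast
qed

end

section \<open>Trivially acting central element\<close>

context fvmod
begin

lemma P_P0: assumes "\<zeta> = 0" "v \<in> C" shows "P r (P t v) = - P t (P r v)" "P r (P r v) = 0"
proof -
  show "P r (P t v) = - P t (P r v)" using PP[OF assms(2), of r t] assms(1) by (simp add: eq_neg_iff_add_eq_0)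
  have "s 2 (P r (P r v)) = P r (P r v) + P r (P r v)" by (metis one_add_one scale_left_distrib scale_one)
  also have "\<dots> = 0" using PP[OF assms(2), of r r] assms(1) by simp
  finally show "P r (P r v) = 0" by simp
qed

text \<open>With \<open>\<zeta> = 0\<close> the \<psi>'s anticommute. Only the existence of a scalar
  is recorded, as its value does not matter below.\<close>

lemma PL_swap_front:
  assumes "\<zeta> = 0" "v \<in> C"
  shows "\<exists>e. PL (as @ x # bs) v = s e (PL (x # as @ bs) v)"
proof (induction as)
  case Nil
  show ?case by (intro exI[of _ 1]) simp
next
  case (Cons a as)
  then obtain e where "PL (as @ x # bs) v = s e (PL (x # as @ bs) v)" by blast
  then have "PL ((a # as) @ x # bs) v = s (- e) (P x (P a (PL (as @ bs) v)))"
    using assms P_P0(1)[OF assms(1), of "PL (as @ bs) v" a x] by simp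
  then show ?case by (intro exI[of _ "- e"]) simp
qed

lemma PL_perm:
  assumes "\<zeta> = 0" "v \<in> C" "mset xs = mset ys"
  shows "\<exists>e. PL ys v = s e (PL xs v)"
  using assms(3)
proof (induction xs arbitrary: ys)
  case Nil
  then show ?case by (intro exI[of _ 1]) simp
next
  case (Cons x xs)
  then have "x \<in> set ys" by (metis list.set_intros(1) set_mset_mset)
  then obtain as bs where ys: "ys = as @ x # bs" by (meson split_list)
  then have "mset xs = mset (as @ bs)" using Cons.prems by simp
  then obtain e where e: "PL (as @ bs) v = s e (PL xs v)" using Cons.IH by blast
  obtain e' where "PL ys v = s e' (PL (x # as @ bs) v)" using PL_swap_front[OF assms(1,2)] ys by blast
  then have "PL ys v = s (e' * e) (PL (x # xs) v)" using e assms(2) by simp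
  then show ?case by blast
qed

lemma PL_not_distinct:
  assumes "\<zeta> = 0" "v \<in> C" "\<not> distinct xs"
  shows "PL xs v = 0"
  using assms(3)
proof (induction xs)
  case (Cons x xs)
  show ?case
  proof (cases "x \<in> set xs")
    case True
    then obtain as bs where xs: "xs = as @ x # bs" by (meson split_list)
    then obtain e where "PL xs v = s e (PL (x # as @ bs) v)" using PL_swap_front[OF assms(1,2)] by blast
    then show ?thesis using assms(2) P_P0(2)[OF assms(1)] by simp
  next
    case False
    then show ?thesis using Cons by simp
  qed
qed simp

text \<open>Many two-element sets of indices with the same sum give vectors in one weight space.  A linear
  dependency between them, multiplied by the remaining \<open>\<psi>\<close>'s, shows that the whole product vanishes.\<close>

lemma PL_weight_zero:
  assumes z: "\<zeta> = 0" and N: "\<And>\<alpha>. spanned_by N (wt \<alpha>)" and v: "v \<in> wt \<alpha>"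
    and xs: "distinct xs" "set xs \<subseteq> {- int R..int R}" "N * (4 * R + 1) < length xs choose 2"
  shows "PL xs v = 0"
proof -
  have vC: "v \<in> C" using v wt_C by blast
  define \<T> where "\<T> = {T. T \<subseteq> set xs \<and> card T = 2}"
  have fT: "finite \<T>" unfolding \<T>_def by simp
  have cT: "card \<T> = length xs choose 2"
    unfolding \<T>_def using n_subsets[of "set xs" 2] distinct_card[OF xs(1)] by simp
  have pair: "\<exists>p q. T = {p, q} \<and> p \<noteq> q" if "T \<in> \<T>" for T
    using that by (auto simp: \<T>_def card_2_iff)
  \<comment> \<open>The possible sums of two indices from \<open>[- R, R]\<close>; this gives the
    factor \<open>4 R + 1\<close>.\<close>
  define I where "I = {- 2 * int R..2 * int R}"
  have "\<exists>y\<in>I. N < card {T \<in> \<T>. \<Sum>T = y}"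
  proof (rule pigeonhole_sum[OF fT])
    show "(\<lambda>T. \<Sum>T) ` \<T> \<subseteq> I"
    proof clarify
      fix T assume T: "T \<in> \<T>"
      then obtain p q where pq: "T = {p, q}" "p \<noteq> q" using pair by blast
      then have "p \<in> {- int R..int R}" "q \<in> {- int R..int R}" using T xs(2) by (auto simp: \<T>_def)
      then show "\<Sum>T \<in> I" using pq by (simp add: I_def)
    qed
    have "card I = 4 * R + 1" by (simp add: I_def nat_add_distrib nat_mult_distrib)
    then show "N * card I < card \<T>" using xs(3) cT by simp
  qed (simp add: I_def)
  then obtain y where y: "N < card {T \<in> \<T>. \<Sum>T = y}" by blast
  define J where "J = {T \<in> \<T>. \<Sum>T = y}"
  define f where "f T = PL (sorted_list_of_set T) v" for T
  \<comment> \<open>The weight depends on the pair only through \<open>y\<close>; the extra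
    \<open>1\<close> comes from the two halves in the indices.\<close>
  have fw: "f T \<in> wt (\<alpha> - of_int y - 1)" if T: "T \<in> J" for T
  proof -
    obtain p q where pq: "T = {p, q}" "p \<noteq> q" "p + q = y" using T pair[of T] by (auto simp: J_def)
    have "(\<Sum>x\<leftarrow>sorted_list_of_set T. half x) = (\<Sum>x\<in>T. half x)"
      by (subst sum_list_distinct_conv_sum_set) (use pq in auto)
    also have "\<dots> = of_int (p + q) + 1" using pq(1,2) by (simp add: half_def)
    finally show ?thesis using PL_wt[OF v, of "sorted_list_of_set T"] pq by (simp add: f_def algebra_simps)
  qed
  obtain B where B: "finite B" "card B \<le> N" "wt (\<alpha> - of_int y - 1) \<subseteq> span B"
    using N[of "\<alpha> - of_int y - 1"] unfolding spanned_by_def by blast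
  have fJ: "finite J" using fT by (simp add: J_def)
  have "\<exists>c. (\<exists>T\<in>J. c T \<noteq> 0) \<and> (\<Sum>T\<in>J. s (c T) (f T)) = 0"
    by (rule dependent_family[OF fJ B(1)]) (use B y fw in \<open>auto simp: J_def\<close>)
  then obtain c T0 where c: "T0 \<in> J" "c T0 \<noteq> 0" "(\<Sum>T\<in>J. s (c T) (f T)) = 0" by blast
  define ys where "ys = sorted_list_of_set (set xs - T0)"
  have fC: "f T \<in> C" for T using vC by (simp add: f_def)
  \<comment> \<open>Another pair is not contained in \<open>T0\<close>, so one of its indices also
    occurs among the remaining ones \<open>ys\<close>, and a repeated \<psi> gives zero. Thus
    multiplying by \<open>ys\<close> isolates \<open>T0\<close>.\<close>
  have z': "PL ys (f T) = 0" if T: "T \<in> J" "T \<noteq> T0" for T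
  proof -
    have T': "finite T" "finite T0" "card T = 2" "card T0 = 2" "T \<subseteq> set xs"
      using T c by (auto simp: J_def \<T>_def intro: finite_subset)
    then have "\<not> T \<subseteq> T0" using T(2) card_subset_eq[of T0 T] by auto
    then have "\<not> distinct (ys @ sorted_list_of_set T)" using T' by (auto simp: ys_def)
    then have "PL (ys @ sorted_list_of_set T) v = 0" by (rule PL_not_distinct[OF z vC])
    then show ?thesis by (simp add: f_def)
  qed
  have "0 = PL ys (\<Sum>T\<in>J. s (c T) (f T))" using lin_on_0[OF PL_lin C_sub] c by simp
  also have "\<dots> = (\<Sum>T\<in>J. s (c T) (PL ys (f T)))"
    using fC by (subst lin_on_sum[OF PL_lin C_sub]) (auto simp: lin_onD(3)[OF PL_lin])
  also have "\<dots> = (\<Sum>T\<in>J. if T = T0 then s (c T0) (PL ys (f T0)) else 0)"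
    by (rule sum.cong) (auto simp: z')
  also have "\<dots> = s (c T0) (PL ys (f T0))" using c fJ by simp
  finally have "PL (ys @ sorted_list_of_set T0) v = 0" using c by (simp add: f_def)
  moreover have "mset (ys @ sorted_list_of_set T0) = mset xs"
  proof -
    have T0: "T0 \<subseteq> set xs" "finite T0" using c by (auto simp: J_def \<T>_def intro: finite_subset)
    then have "distinct (ys @ sorted_list_of_set T0)" "set (ys @ sorted_list_of_set T0) = set xs"
      by (auto simp: ys_def)
    then show ?thesis using xs(1) set_eq_iff_mset_eq_distinct by blast
  qed
  ultimately show ?thesis using PL_perm[OF z vC] by fastforce
qed

lemma PL_zero:
  assumes z: "\<zeta> = 0" and N: "\<And>\<alpha>. spanned_by N (wt \<alpha>)" and v: "v \<in> C"
    and xs: "set xs \<subseteq> {- int R..int R}" "N * (4 * R + 1) < length xs choose 2"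
  shows "PL xs v = 0"
proof (cases "distinct xs")
  case True
  obtain A f where A: "finite A" "\<And>\<alpha>. \<alpha> \<in> A \<Longrightarrow> f \<alpha> \<in> wt \<alpha>" "v = (\<Sum>\<alpha>\<in>A. f \<alpha>)" using C_decomp[OF v] by blast
  have "PL xs v = (\<Sum>\<alpha>\<in>A. PL xs (f \<alpha>))"
    unfolding A(3) by (rule lin_on_sum[OF PL_lin C_sub]) (use A wt_C in blast)
  also have "\<dots> = 0" by (intro sum.neutral ballI PL_weight_zero[OF z N A(2) True xs])
  finally show ?thesis .
qed (rule PL_not_distinct[OF z v])

text \<open>Restricting to homogeneous \<open>v\<close> makes the span graded; \<open>X_PL\<close>
  shows that products applied to arbitrary vectors of \<open>C\<close> still belong to it.\<close>

definition X :: "nat \<Rightarrow> int \<Rightarrow> 'a set" where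
  "X n R = span {PL xs v |xs v q. length xs = n \<and> set xs \<subseteq> {- R..R} \<and> v \<in> H q}"

lemma X_mono: "R \<le> R' \<Longrightarrow> X n R \<subseteq> X n R'"
  unfolding X_def by (intro span_mono) fastforce

lemma PL_hom: "v \<in> H q \<Longrightarrow> \<exists>q'. PL xs v \<in> H q'"
  by (induction xs) (auto dest: P_hom)

lemma X_sub: "subspace (X n R)" by (simp add: X_def)

lemma X_graded: "graded (X n R)"
  unfolding X_def by (rule graded_span) (auto dest: PL_hom)

lemma X_PL: assumes "length xs = n" "set xs \<subseteq> {- R..R}" "v \<in> C" shows "PL xs v \<in> X n R"
proof -
  obtain a b where ab: "a \<in> H False" "b \<in> H True" "v = a + b" using assms(3) by (rule C_cases)
  have "PL xs v = PL xs a + PL xs b" using ab H_C by (simp add: lin_onD(2)[OF PL_lin])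
  moreover have "PL xs a \<in> X n R" "PL xs b \<in> X n R" using assms ab by (auto simp: X_def intro!: span_base)
  ultimately show ?thesis by (simp add: subspace_add[OF X_sub])
qed

lemma X_lin_on:
  assumes T: "lin_on C T" and v: "v \<in> X n R"
    and g: "\<And>xs v. length xs = n \<Longrightarrow> set xs \<subseteq> {- R..R} \<Longrightarrow> v \<in> C \<Longrightarrow> T (PL xs v) \<in> X n' R'"
  shows "T v \<in> X n' R'"
  by (rule lin_on_span_subset[OF T C_sub _ X_sub _ v[unfolded X_def]]) (auto intro!: g dest: H_C)

lemma X_P_Suc: assumes "\<bar>r\<bar> \<le> R" "v \<in> X n R" shows "P r v \<in> X (Suc n) R"
proof (rule X_lin_on[OF P_lin assms(2)])
  fix xs v assume "length xs = n" "set xs \<subseteq> {- R..R}" "v \<in> C"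
  moreover have "r \<in> {- R..R}" using assms(1) by (simp add: abs_le_iff)
  ultimately show "P r (PL xs v) \<in> X (Suc n) R" using X_PL[of "r # xs" "Suc n" R v] by simp
qed

text \<open>The new \<psi> is moved to the far right and absorbed into the vector, so neither the
  number of factors nor the bound on the indices changes.\<close>

lemma X_P: assumes "\<zeta> = 0" "v \<in> X n R" shows "P r v \<in> X n R"
proof (rule X_lin_on[OF P_lin assms(2)])
  fix xs v assume xs: "length xs = n" "set xs \<subseteq> {- R..R}" "v \<in> C"
  obtain e where "PL (r # xs) v = s e (PL (xs @ [r]) v)"
    using PL_perm[OF assms(1) xs(3), of "xs @ [r]" "r # xs"] by auto
  then show "P r (PL xs v) \<in> X n R"
    using X_PL[OF xs(1,2), of "P r v"] xs(3) by (simp add: subspace_scale[OF X_sub])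
qed

text \<open>\<open>L m\<close> shifts one index at a time by \<open>m\<close>, as a derivation does.
  The widening is thus independent of \<open>n\<close>, which later makes the windows grow only
  linearly in the number of factors.\<close>

lemma X_L: assumes "v \<in> X n R" shows "L m v \<in> X n (R + \<bar>m\<bar>)"
proof (rule X_lin_on[OF L_lin assms])
  fix xs v assume "length xs = n" "set xs \<subseteq> {- R..R}" "v \<in> C"
  then show "L m (PL xs v) \<in> X n (R + \<bar>m\<bar>)"
  proof (induction xs arbitrary: n)
    case Nil
    then show ?case using X_PL[of "[]" n "R + \<bar>m\<bar>" "L m v"] by simp
  next
    case (Cons x xs)
    then obtain n' where n': "n = Suc n'" "length xs = n'" by auto
    have y: "PL xs v \<in> X n' (R + \<bar>m\<bar>)" using X_PL[of xs n' R v] X_mono[of R "R + \<bar>m\<bar>" n'] Cons n' by auto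
    have y': "L m (PL xs v) \<in> X n' (R + \<bar>m\<bar>)" using Cons n' by auto
    have "\<bar>x\<bar> \<le> R + \<bar>m\<bar>" "\<bar>m + x\<bar> \<le> R + \<bar>m\<bar>" using Cons.prems(2) by auto
    then have "P x (L m (PL xs v)) \<in> X n (R + \<bar>m\<bar>)" "P (m + x) (PL xs v) \<in> X n (R + \<bar>m\<bar>)"
      using X_P_Suc[OF _ y'] X_P_Suc[OF _ y] n' by auto
    moreover have "L m (PL (x # xs) v) = P x (L m (PL xs v)) + s (- half x - of_int m / 2) (P (m + x) (PL xs v))"
      using LP[of "PL xs v" m x] Cons.prems(3) by (simp add: algebra_simps)
    ultimately show ?case by (simp add: subspace_add[OF X_sub] subspace_scale[OF X_sub])
  qed
qed

lemma bounded_annih: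
  assumes z: "\<zeta> = 0" and N: "\<And>\<alpha>. spanned_by N (wt \<alpha>)" and v: "v \<in> C"
  shows "P r v = 0"
proof (rule ccontr)
  assume nz: "P r v \<noteq> 0"
  let ?G = "{P r v |r v q. v \<in> H q}"
  have GC: "?G \<subseteq> C" by (auto intro: H_C)
  have PG: "P r v \<in> span ?G" if u: "v \<in> C" for r v
  proof -
    obtain a b where ab: "a \<in> H False" "b \<in> H True" "v = a + b" by (rule C_cases[OF u])
    then have "P r v = P r a + P r b" by (simp add: H_C)
    moreover have "P r a \<in> span ?G" "P r b \<in> span ?G" using ab by (blast intro: span_base)+
    ultimately show ?thesis by (simp add: span_add)
  qed
  \<comment> \<open>The images of the \<psi>'s span a graded submodule, nonzero by assumption, so
    every vector is a sum of vectors of the form \<open>P r u\<close>. This is what allows one more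
    factor to be split off each time.\<close>
  have FC: "span ?G = C"
  proof (rule simple_graded[of _ "P r v"])
    show GC': "span ?G \<subseteq> C" by (rule span_minimal[OF GC C_sub])
    show "graded (span ?G)" by (rule graded_span) (auto dest: P_hom)
    show "P r v \<in> span ?G" by (rule PG[OF v])
    show "P r v \<in> span ?G" if "v \<in> span ?G" for r v using PG GC' that by blast
    have LG: "L m g \<in> span ?G" if g: "g \<in> ?G" for m g
    proof -
      obtain r v where g: "g = P r v" "v \<in> C" using g by (auto dest: H_C)
      have "L m g = P r (L m v) + s (- half r - of_int m / 2) (P (m + r) v)"
        using LP[OF g(2), of m r] g(1) by (simp add: algebra_simps)
      moreover have "P r (L m v) \<in> span ?G" "P (m + r) v \<in> span ?G" using g(2) PG by simp_all
      ultimately show ?thesis by (simp add: span_add span_scale)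
    qed
    show "L m v \<in> span ?G" if "v \<in> span ?G" for m v
      by (rule lin_on_span_subset[OF L_lin C_sub GC subspace_span LG that])
  qed (use nz in auto)
  obtain \<alpha> w where w: "w \<in> wt \<alpha>" "w \<noteq> 0" by (rule ex_wt)
  \<comment> \<open>If the weight space of \<alpha> consists of combinations of products with
    \<open>n\<close> factors, so does every vector generated from it, with indices in a window
    widened by some \<open>D\<close>. The point is that \<open>D\<close> depends neither on
    \<open>n\<close> nor on \<open>R\<close>.\<close>
  define Y where "Y = {v \<in> C. \<exists>D\<ge>0. \<forall>n. \<forall>R\<ge>0. wt \<alpha> \<subseteq> X n R \<longrightarrow> v \<in> X n (R + D)}"
  have YI: "v \<in> Y" if "v \<in> C" "D \<ge> 0" "\<And>n R. R \<ge> 0 \<Longrightarrow> wt \<alpha> \<subseteq> X n R \<Longrightarrow> v \<in> X n (R + D)" for v D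
    using that by (auto simp: Y_def)
  have YC: "Y = C"
  proof (rule simple_graded[of _ w])
    show "subspace Y"
    proof (rule subspaceI)
      show "0 \<in> Y" by (rule YI[of _ 0]) (auto simp: subspace_0[OF X_sub])
      show "s c y \<in> Y" if "y \<in> Y" for c y using that by (auto simp: Y_def subspace_scale[OF X_sub])
      fix y y' assume "y \<in> Y" "y' \<in> Y"
      then obtain D D' where D: "D \<ge> 0" "\<And>n R. R \<ge> 0 \<Longrightarrow> wt \<alpha> \<subseteq> X n R \<Longrightarrow> y \<in> X n (R + D)"
        and D': "D' \<ge> 0" "\<And>n R. R \<ge> 0 \<Longrightarrow> wt \<alpha> \<subseteq> X n R \<Longrightarrow> y' \<in> X n (R + D')" and yC: "y \<in> C" "y' \<in> C"
        by (auto simp: Y_def)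
      show "y + y' \<in> Y"
      proof (rule YI[of _ "D + D'"])
        fix n R assume R: "R \<ge> 0" "wt \<alpha> \<subseteq> X n R"
        show "y + y' \<in> X n (R + (D + D'))"
          using D(2)[OF R] D'(2)[OF R] X_mono[of "R + D" "R + (D + D')" n] X_mono[of "R + D'" "R + (D + D')" n] D(1) D'(1)
          by (intro subspace_add[OF X_sub]) auto
      qed (use D D' yC in auto)
    qed
    show "Y \<subseteq> C" by (auto simp: Y_def)
    show "w \<in> Y" by (rule YI[of _ 0]) (use w wt_C in auto)
    show "w \<noteq> 0" by fact
    show "graded Y" unfolding graded_def
    proof
      fix y assume y: "y \<in> Y"
      then obtain D where D: "D \<ge> 0" "\<And>n R. R \<ge> 0 \<Longrightarrow> wt \<alpha> \<subseteq> X n R \<Longrightarrow> y \<in> X n (R + D)" by (auto simp: Y_def)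
      obtain a b where ab: "a \<in> H False" "b \<in> H True" "y = a + b" using y by (auto simp: Y_def elim: C_cases)
      have "a \<in> Y" "b \<in> Y"
        using D graded_component[OF X_graded, of a b] ab by (auto intro!: YI[of _ D] H_C)
      then show "\<exists>a\<in>Y \<inter> H False. \<exists>b\<in>Y \<inter> H True. y = a + b" using ab by blast
    qed
    fix y assume y: "y \<in> Y"
    then obtain D where D: "D \<ge> 0" "\<And>n R. R \<ge> 0 \<Longrightarrow> wt \<alpha> \<subseteq> X n R \<Longrightarrow> y \<in> X n (R + D)" and yC: "y \<in> C"
      by (auto simp: Y_def)
    show "L m y \<in> Y" for m
    proof (rule YI[of _ "D + \<bar>m\<bar>"])
      fix n R assume R: "R \<ge> 0" "wt \<alpha> \<subseteq> X n R"
      show "L m y \<in> X n (R + (D + \<bar>m\<bar>))" using X_L[OF D(2)[OF R], of m] by (simp add: add.assoc)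
    qed (use D yC in auto)
    show "P r y \<in> Y" for r
      by (rule YI[of _ D]) (use D yC X_P[OF z] in auto)
  qed
  have step: "\<exists>D\<ge>0. \<forall>n. \<forall>R\<ge>0. wt \<alpha> \<subseteq> X n R \<longrightarrow> v \<in> X (Suc n) (R + D)" if v: "v \<in> C" for v
  proof -
    have "v \<in> span ?G" using FC v by simp
    then show ?thesis
    proof (induction rule: span_induct_alt)
      case base
      show ?case by (intro exI[of _ 0]) (auto simp: subspace_0[OF X_sub])
    next
      case (step c x y)
      then obtain r u where x: "x = P r u" "u \<in> Y" using YC by (auto dest: H_C)
      obtain D where D: "D \<ge> 0" "\<And>n R. R \<ge> 0 \<Longrightarrow> wt \<alpha> \<subseteq> X n R \<Longrightarrow> u \<in> X n (R + D)" using x by (auto simp: Y_def)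
      obtain D' where D': "D' \<ge> 0" "\<And>n R. R \<ge> 0 \<Longrightarrow> wt \<alpha> \<subseteq> X n R \<Longrightarrow> y \<in> X (Suc n) (R + D')"
        using step by auto
      define E where "E = D + D' + \<bar>r\<bar>"
      have "s c x + y \<in> X (Suc n) (R + E)" if R: "R \<ge> 0" "wt \<alpha> \<subseteq> X n R" for n R
      proof (intro subspace_add[OF X_sub] subspace_scale[OF X_sub])
        have "u \<in> X n (R + E)" using D(2)[OF R] X_mono[of "R + D" "R + E" n] D'(1) by (auto simp: E_def)
        then show "x \<in> X (Suc n) (R + E)" unfolding x
          by (rule X_P_Suc[rotated]) (use R D D' in \<open>auto simp: E_def\<close>)
        show "y \<in> X (Suc n) (R + E)" using D'(2)[OF R] X_mono[of "R + D'" "R + E" "Suc n"] D(1) by (auto simp: E_def)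
      qed
      moreover have "E \<ge> 0" using D D' by (simp add: E_def)
      ultimately show ?case by blast
    qed
  qed
  obtain B where B: "finite B" "wt \<alpha> = span B" by (rule wt_fin')
  have BC: "b \<in> C" if "b \<in> B" for b using B(2) span_base[OF that] wt_C by blast
  have "\<forall>b\<in>B. \<exists>D\<ge>0. \<forall>n. \<forall>R\<ge>0. wt \<alpha> \<subseteq> X n R \<longrightarrow> b \<in> X (Suc n) (R + D)" using step BC by blast
  then obtain d where d: "\<And>b. b \<in> B \<Longrightarrow> d b \<ge> 0"
    "\<And>b n R. b \<in> B \<Longrightarrow> R \<ge> 0 \<Longrightarrow> wt \<alpha> \<subseteq> X n R \<Longrightarrow> b \<in> X (Suc n) (R + d b)" by metis
  define D where "D = nat (\<Sum>b\<in>B. d b)"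
  have D: "d b \<le> int D" if "b \<in> B" for b
    using member_le_sum[OF that, of d] d(1) B(1) by (simp add: D_def)
  \<comment> \<open>The weight space is finite-dimensional, so a single widening \<open>D\<close>
    serves all vectors of a spanning set and is spent once per factor.\<close>
  have pow: "wt \<alpha> \<subseteq> X n (int (n * D))" for n
  proof (induction n)
    case 0
    then show ?case using X_PL[of "[]" 0 0] wt_C by auto
  next
    case (Suc n)
    have "B \<subseteq> X (Suc n) (int (Suc n * D))"
    proof
      fix b assume b: "b \<in> B"
      have "b \<in> X (Suc n) (int (n * D) + d b)" by (rule d(2)[OF b _ Suc]) simp
      then show "b \<in> X (Suc n) (int (Suc n * D))" using X_mono[of "int (n * D) + d b" "int (Suc n * D)"] D[OF b] by auto
    qed
    then show ?case unfolding B(2) by (rule span_minimal[OF _ X_sub])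
  qed
  \<comment> \<open>With these values \<open>m * n = 2 m^2 + 2 m\<close> is smaller than
    \<open>n choose 2 = (m + 1) (2 m + 1)\<close>.\<close>
  define m where "m = N * (4 * D + 1)"
  define n where "n = 2 * m + 2"
  have "N * (4 * (n * D) + 1) \<le> m * n" by (simp add: m_def n_def algebra_simps)
  also have "m * n < n choose 2" by (simp add: n_def choose_two algebra_simps)
  finally have n: "N * (4 * (n * D) + 1) < n choose 2" .
  have "{PL xs v |xs v q. length xs = n \<and> set xs \<subseteq> {- int (n * D)..int (n * D)} \<and> v \<in> H q} \<subseteq> {0}"
    using PL_zero[OF z N, of _ _ "n * D"] n H_C by blast
  then have "X n (int (n * D)) \<subseteq> {0}" unfolding X_def by (rule span_minimal) simp
  then show False using pow[of n] w by blast
qed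

theorem central_zero_annih:
  assumes z: "\<zeta> = 0" and v: "v \<in> C"
  shows "P r v = 0"
proof -
  interpret M: fvmod s H "\<lambda>m v. - L (- m) v" "\<lambda>r. P (- r - 1)" "- k" \<zeta> by (rule mirror)
  consider (s) x where "x \<in> C" "x \<noteq> 0" "smooth x" | (m) x where "x \<in> C" "x \<noteq> 0" "M.smooth x"
    | (b) "\<And>x. x \<in> C \<Longrightarrow> smooth x \<Longrightarrow> x = 0" "\<And>x. x \<in> C \<Longrightarrow> M.smooth x \<Longrightarrow> x = 0" by blast
  then show ?thesis
  proof cases
    case s
    then obtain u where "u \<in> C" "u \<noteq> 0" "\<And>r. P r u = 0" using smooth_annih[OF z] smooth_all[OF s] by blast
    then show ?thesis using annih_all v by blast
  next
    case m
    then obtain u where u: "u \<in> C" "u \<noteq> 0" "\<And>r. P (- r - 1) u = 0" using M.smooth_annih[OF z] M.smooth_all[OF m] by blast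
    have "P r u = 0" for r using u(3)[of "- r - 1"] by simp
    then show ?thesis using annih_all u v by blast
  next
    case b
    then show ?thesis using wt_bounded bounded_annih[OF z _ v] by blast
  qed
qed

end

section \<open>The exterior algebra module\<close>

lemma half_eq_neg_iff: "half r = - half t \<longleftrightarrow> r + t = - 1"
proof -
  have "half r + half t = of_int (r + t + 1)" by (simp add: half_def)
  then have "half r = - half t \<longleftrightarrow> of_int (r + t + 1) = (0::complex)" by (simp only: eq_neg_iff_add_eq_0)
  also have "\<dots> \<longleftrightarrow> r + t + 1 = 0" by (simp only: of_int_eq_0_iff)
  finally show ?thesis by linarith
qed

context cspace
begin

lemma lin_extend_superset:
  "finite A \<Longrightarrow> Poly_Mapping.keys x \<subseteq> A \<Longrightarrow> lin_extend s f x = (\<Sum>k\<in>A. s (Poly_Mapping.lookup x k) (f k))"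
  unfolding lin_extend_def by (rule sum.mono_neutral_left) (auto simp: in_keys_iff)

lemma lin_extend_add: "lin_extend s f (x + y) = lin_extend s f x + lin_extend s f y"
proof -
  let ?A = "Poly_Mapping.keys x \<union> Poly_Mapping.keys y"
  show ?thesis
    by (subst (1 2 3) lin_extend_superset[of ?A])
      (auto simp: lookup_add scale_left_distrib sum.distrib in_keys_iff)
qed

lemma lin_extend_pscale: "lin_extend s f (pscale a x) = s a (lin_extend s f x)"
  by (subst (1 2) lin_extend_superset[of "Poly_Mapping.keys x"]) (auto simp: in_keys_iff scale_sum_right)

lemma lin_extend_0 [simp]: "lin_extend s f 0 = 0"
  by (simp add: lin_extend_def)

lemma lin_extend_single [simp]: "lin_extend s f (Poly_Mapping.single g a) = s a (f g)"
  by (subst lin_extend_superset[of "{g}"]) auto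

lemma lin_extend_neg: "lin_extend s f (- x) = - lin_extend s f x"
  using lin_extend_add[of f x "- x"] by (simp add: add_eq_0_iff2 minus_unique)

lemma lin_extend_diff: "lin_extend s f (x - y) = lin_extend s f x - lin_extend s f y"
  using lin_extend_add[of f x "- y"] by (simp add: lin_extend_neg)

end

interpretation ps: cspace "pscale :: complex \<Rightarrow> ('k \<Rightarrow>\<^sub>0 complex) \<Rightarrow> _"
  by (simp add: cspace_def vector_space_pscale)

lemma poly_mapping_add_induct [case_names single sum]:
  assumes "\<And>k v. Q (Poly_Mapping.single k v)" "\<And>f g. Q f \<Longrightarrow> Q g \<Longrightarrow> Q (f + g)"
  shows "Q (x :: 'k \<Rightarrow>\<^sub>0 'v::comm_monoid_add)"
proof (induction x rule: update_induct)
  case const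
  show ?case using assms(1)[of undefined 0] by simp
next
  case (update f a b)
  have "Poly_Mapping.update a b f = Poly_Mapping.single a b + f"
    using update by (intro poly_mapping_eqI) (auto simp: lookup_update lookup_add lookup_single when_def in_keys_iff)
  then show ?case using assms update by metis
qed

lemma poly_mapping_lin_eqI:
  assumes "\<And>x y. f (x + y) = f x + f y" "\<And>a x. f (pscale a x) = s a (f x)"
    "\<And>x y. g (x + y) = g x + g y" "\<And>a x. g (pscale a x) = s a (g x)"
    and "\<And>k. f (unit_vec k) = g (unit_vec k)" and s: "cspace s"
  shows "f (x :: 'k \<Rightarrow>\<^sub>0 complex) = g x"
proof -
  interpret cspace s by (rule s)
  have z: "f 0 = 0" "g 0 = 0" using assms(1)[of 0 0] assms(3)[of 0 0] by auto
  show ?thesis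
  proof (induction x rule: poly_mapping_add_induct)
    case (single k v)
    have "Poly_Mapping.single k v = pscale v (unit_vec k)"
      by (rule poly_mapping_eqI) (simp add: lookup_single when_def)
    then show ?case using assms by simp
  next
    case (sum f' g')
    then show ?case using assms by simp
  qed
qed

section \<open>Fermionic signs and the anticommutation relations\<close>

definition sgn_below :: "nat \<Rightarrow> nat fset \<Rightarrow> complex" where
  "sgn_below n S = (- 1) ^ card {m. m |\<in>| S \<and> m < n}"

lemma fin_below: "finite {m. m |\<in>| S \<and> m < (n::nat)}"
  by (rule finite_subset[of _ "{..<n}"]) auto

lemma sgn_below_finsert:
  assumes "m |\<notin>| S" shows "sgn_below n (finsert m S) = (if m < n then - 1 else 1) * sgn_below n S"
proof (cases "m < n")
  case True
  then have "{i. i |\<in>| finsert m S \<and> i < n} = insert m {i. i |\<in>| S \<and> i < n}" by auto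
  then show ?thesis using True assms fin_below by (simp add: sgn_below_def)
next
  case False
  then have "{i. i |\<in>| finsert m S \<and> i < n} = {i. i |\<in>| S \<and> i < n}" by auto
  then show ?thesis using False by (simp add: sgn_below_def)
qed

lemma sgn_below_fminus:
  assumes "m |\<in>| S" shows "sgn_below n (S |-| {|m|}) = (if m < n then - 1 else 1) * sgn_below n S"
proof -
  have "S = finsert m (S |-| {|m|})" using assms by auto
  then have "sgn_below n S = (if m < n then - 1 else 1) * sgn_below n (S |-| {|m|})"
    using sgn_below_finsert[of m "S |-| {|m|}" n] by simp
  then show ?thesis by simp
qed

lemma sgn_below_sq: "sgn_below n S * sgn_below n S = 1"
  by (simp add: sgn_below_def flip: power_add)

lemma wedge_xi_unit:
  "wedge (xi n) (unit_vec S) =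
    (if n |\<in>| S then 0 else Poly_Mapping.single (finsert n S) (sgn_below n S))"
proof -
  have "{(s, t). s |\<in>| {|n|} \<and> t |\<in>| S \<and> t < s} = Pair n ` {m. m |\<in>| S \<and> m < n}" by auto
  then have "card {(s, t). s |\<in>| {|n|} \<and> t |\<in>| S \<and> t < s} = card {m. m |\<in>| S \<and> m < n}"
    by (simp add: card_image inj_on_def)
  then show ?thesis by (simp add: wedge_def xi_def sgn_below_def)
qed

lemma dxi_unit:
  "dxi n (unit_vec S) = (if n |\<in>| S then Poly_Mapping.single (S |-| {|n|}) (sgn_below n S) else 0)"
  by (simp add: dxi_def sgn_below_def)

lemma wedge_xi_lin:
  "wedge (xi n) (u + v) = wedge (xi n) u + wedge (xi n) v"
  "wedge (xi n) (pscale a u) = pscale a (wedge (xi n) u)"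
  by (simp_all add: wedge_def xi_def ps.lin_extend_add ps.lin_extend_pscale)

lemma dxi_lin: "dxi n (u + v) = dxi n u + dxi n v" "dxi n (pscale a u) = pscale a (dxi n u)"
  by (simp_all add: dxi_def ps.lin_extend_add ps.lin_extend_pscale)

lemma ext_psi_add: "ext_psi r (u + v) = ext_psi r u + ext_psi r v"
  and ext_psi_scale: "ext_psi r (pscale a u) = pscale a (ext_psi r u)"
  by (simp_all add: ext_psi_def wedge_xi_lin dxi_lin)

lemma ext_psi_lin_on: "ps.lin_on UNIV (ext_psi r)"
  by (simp add: ps.lin_on_def ext_psi_add ext_psi_scale)

lemmas ext_psi_simps = ps.lin_on_0[OF ext_psi_lin_on ps.subspace_UNIV]
  ps.lin_on_neg[OF ext_psi_lin_on UNIV_I] ps.lin_on_diff[OF ext_psi_lin_on ps.subspace_UNIV UNIV_I UNIV_I]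
  ext_psi_add ext_psi_scale

lemma ext_psi_sum: "ext_psi r (sum f A) = (\<Sum>i\<in>A. ext_psi r (f i))"
  by (rule ps.lin_on_sum[OF ext_psi_lin_on ps.subspace_UNIV]) simp

lemma single_pscale: "Poly_Mapping.single k a = pscale a (unit_vec k)"
  by (rule poly_mapping_eqI) (simp add: lookup_single when_def)

lemma fset_swap: "n \<noteq> m \<Longrightarrow> finsert n (S |-| {|m|}) = finsert n S |-| {|m|}"
  by auto

lemma ext_psi_unit:
  "ext_psi r (unit_vec S) =
    (if r \<ge> 0 then if nat r |\<in>| S then pscale (sgn_below (nat r) S) (unit_vec (S |-| {|nat r|})) else 0
     else if nat (- r - 1) |\<in>| S then 0
     else pscale (sgn_below (nat (- r - 1)) S) (unit_vec (finsert (nat (- r - 1)) S)))"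
  by (simp add: ext_psi_def dxi_unit wedge_xi_unit single_pscale[of _ "sgn_below _ _"])

lemma dxi_unit': "dxi n (unit_vec S) = (if n |\<in>| S then pscale (sgn_below n S) (unit_vec (S |-| {|n|})) else 0)"
  using ext_psi_unit[of "int n" S] by (simp add: ext_psi_def)

lemma wedge_xi_unit': "wedge (xi n) (unit_vec S) =
    (if n |\<in>| S then 0 else pscale (sgn_below n S) (unit_vec (finsert n S)))"
  using ext_psi_unit[of "- int n - 1" S] by (simp add: ext_psi_def)

text \<open>Creating or removing \<open>m\<close> flips the sign belonging to \<open>n\<close>
  exactly when \<open>m < n\<close>. For \<open>n \<noteq> m\<close> just one of the two orders
  picks up this extra sign, so the two products cancel; for \<open>n = m\<close> the sign is
  squared.\<close>

lemma ext_CAR_unit: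
  "ext_psi r (ext_psi t (unit_vec S)) + ext_psi t (ext_psi r (unit_vec S)) = (if r + t = - 1 then unit_vec S else 0)"
proof -
  have z: "dxi n 0 = 0" "wedge (xi n) 0 = 0" for n by (simp_all add: dxi_def wedge_def xi_def)
  have dd: "dxi n (dxi m (unit_vec S)) + dxi m (dxi n (unit_vec S)) = 0" for n m
  proof (cases "n \<noteq> m \<and> n |\<in>| S \<and> m |\<in>| S")
    case True
    have e: "S |-| {|m|} |-| {|n|} = S |-| {|n|} |-| {|m|}" by auto
    have 1: "dxi n (dxi m (unit_vec S)) =
        pscale (sgn_below m S * ((if m < n then - 1 else 1) * sgn_below n S)) (unit_vec (S |-| {|n|} |-| {|m|}))"
      using True by (simp add: dxi_unit' dxi_lin sgn_below_fminus e)
    have 2: "dxi m (dxi n (unit_vec S)) =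
        pscale (sgn_below n S * ((if n < m then - 1 else 1) * sgn_below m S)) (unit_vec (S |-| {|n|} |-| {|m|}))"
      using True by (simp add: dxi_unit' dxi_lin sgn_below_fminus)
    have "n < m \<or> m < n" using True by auto
    then show ?thesis unfolding 1 2 by (auto simp: mult.commute)
  next
    case False
    then consider "n = m" | "n |\<notin>| S" | "m |\<notin>| S" by blast
    then show ?thesis by cases (auto simp: dxi_unit' dxi_lin z)
  qed
  have ww: "wedge (xi n) (wedge (xi m) (unit_vec S)) + wedge (xi m) (wedge (xi n) (unit_vec S)) = 0" for n m
  proof (cases "n \<noteq> m \<and> n |\<notin>| S \<and> m |\<notin>| S")
    case True
    have e: "finsert n (finsert m S) = finsert m (finsert n S)" by auto
    have 1: "wedge (xi n) (wedge (xi m) (unit_vec S)) =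
        pscale (sgn_below m S * ((if m < n then - 1 else 1) * sgn_below n S)) (unit_vec (finsert m (finsert n S)))"
      using True by (simp add: wedge_xi_unit' wedge_xi_lin sgn_below_finsert e)
    have 2: "wedge (xi m) (wedge (xi n) (unit_vec S)) =
        pscale (sgn_below n S * ((if n < m then - 1 else 1) * sgn_below m S)) (unit_vec (finsert m (finsert n S)))"
      using True by (simp add: wedge_xi_unit' wedge_xi_lin sgn_below_finsert)
    have "n < m \<or> m < n" using True by auto
    then show ?thesis unfolding 1 2 by (auto simp: mult.commute)
  next
    case False
    then consider "n = m" | "n |\<in>| S" | "m |\<in>| S" by blast
    then show ?thesis by cases (auto simp: wedge_xi_unit' wedge_xi_lin z)
  qed
  have dw: "dxi n (wedge (xi m) (unit_vec S)) + wedge (xi m) (dxi n (unit_vec S)) = (if n = m then unit_vec S else 0)" for n m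
  proof (cases "n = m")
    case True
    show ?thesis
    proof (cases "m |\<in>| S")
      case T: True
      then have "finsert m (S |-| {|m|}) = S" by auto
      then show ?thesis using T True
        by (simp add: z wedge_xi_unit' dxi_unit' wedge_xi_lin sgn_below_fminus sgn_below_sq)
    next
      case F: False
      then have "finsert m S |-| {|m|} = S" by auto
      then show ?thesis using F True
        by (simp add: z wedge_xi_unit' dxi_unit' dxi_lin sgn_below_finsert sgn_below_sq)
    qed
  next
    case False
    show ?thesis
    proof (cases "n |\<in>| S \<and> m |\<notin>| S")
      case T: True
      have 1: "dxi n (wedge (xi m) (unit_vec S)) =
          pscale (sgn_below m S * ((if m < n then - 1 else 1) * sgn_below n S)) (unit_vec (finsert m S |-| {|n|}))"
        using False T by (simp add: wedge_xi_unit' dxi_unit' dxi_lin sgn_below_finsert)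
      have 2: "wedge (xi m) (dxi n (unit_vec S)) =
          pscale (sgn_below n S * ((if n < m then - 1 else 1) * sgn_below m S)) (unit_vec (finsert m S |-| {|n|}))"
        using False T fset_swap[of m n S] by (simp add: wedge_xi_unit' dxi_unit' wedge_xi_lin sgn_below_fminus)
      have "n < m \<or> m < n" using False by auto
      then show ?thesis unfolding 1 2 using False by (auto simp: mult.commute)
    next
      case F: False
      then consider "n |\<notin>| S" | "m |\<in>| S" by blast
      then show ?thesis using False by cases (auto simp: wedge_xi_unit' dxi_unit' dxi_lin wedge_xi_lin z)
    qed
  qed
  show ?thesis
  proof (cases "r \<ge> 0"; cases "t \<ge> 0")
    assume "r \<ge> 0" "t \<ge> 0"
    then show ?thesis using dd[of "nat r" "nat t"] by (simp add: ext_psi_def)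
  next
    assume "r \<ge> 0" "\<not> t \<ge> 0"
    moreover from this have "nat r = nat (- t - 1) \<longleftrightarrow> r + t = - 1" by auto
    ultimately show ?thesis using dw[of "nat r" "nat (- t - 1)"] by (simp add: ext_psi_def)
  next
    assume "\<not> r \<ge> 0" "t \<ge> 0"
    moreover from this have "nat t = nat (- r - 1) \<longleftrightarrow> r + t = - 1" by auto
    ultimately show ?thesis using dw[of "nat t" "nat (- r - 1)"] by (simp add: ext_psi_def add.commute)
  next
    assume "\<not> r \<ge> 0" "\<not> t \<ge> 0"
    then show ?thesis using ww[of "nat (- r - 1)" "nat (- t - 1)"] by (simp add: ext_psi_def)
  qed
qed

lemma ext_CAR:
  "ext_psi r (ext_psi t v) + ext_psi t (ext_psi r v) = (if r + t = - 1 then v else 0)"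
  by (rule poly_mapping_lin_eqI[where s = pscale])
    (auto simp: ext_psi_simps ext_CAR_unit ps.scale_right_distrib algebra_simps ps.cspace_axioms)

lemma ext_psi_swap: "ext_psi r (ext_psi t v) = (if r + t = - 1 then v else 0) - ext_psi t (ext_psi r v)"
  using ext_CAR[of r t v] by (simp add: algebra_simps)

lemma ext_psi_ann: "ext_psi (int n) (unit_vec {||}) = 0"
  by (simp add: ext_psi_unit)

lemma ext_smooth: "\<exists>M\<ge>0. \<forall>r\<ge>M. ext_psi r v = 0"
proof (induction v rule: poly_mapping_add_induct)
  case (single S a)
  have "\<forall>r\<ge>int (Suc (Max (insert 0 (fset S)))). ext_psi r (Poly_Mapping.single S a) = 0"
  proof (intro allI impI)
    fix r assume r: "r \<ge> int (Suc (Max (insert 0 (fset S))))"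
    have "nat r |\<notin>| S"
    proof
      assume "nat r |\<in>| S"
      then have "nat r \<le> Max (insert 0 (fset S))" by (intro Max_ge) auto
      then show False using r by linarith
    qed
    then show "ext_psi r (Poly_Mapping.single S a) = 0"
      using r by (subst single_pscale) (simp add: ext_psi_scale ext_psi_unit)
  qed
  then show ?case by (intro exI[of _ "int (Suc (Max (insert 0 (fset S))))"]) simp
next
  case (sum f g)
  then obtain M M' where "M \<ge> 0" "M' \<ge> 0" "\<forall>r\<ge>M. ext_psi r f = 0" "\<forall>r\<ge>M'. ext_psi r g = 0" by blast
  then show ?case by (intro exI[of _ "max M M'"]) (auto simp: ext_psi_add)
qed

text \<open>Creation operators generate the exterior algebra from the vacuum. The rule proves
  identities that are linear in \<open>u\<close> and compatible with creation operators.\<close>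

lemma ext_induct [consumes 0, case_names one add scale creation]:
  assumes one: "Q (unit_vec {||})"
    and add: "\<And>u v. Q u \<Longrightarrow> Q v \<Longrightarrow> Q (u + v)"
    and scale: "\<And>a u. Q u \<Longrightarrow> Q (pscale a u)"
    and creation: "\<And>r u. r < 0 \<Longrightarrow> Q u \<Longrightarrow> Q (ext_psi r u)"
  shows "Q u"
proof -
  have unit: "Q (unit_vec S)" for S
  proof (induction S)
    case empty
    show ?case by (rule one)
  next
    case (insert n S)
    have "unit_vec (finsert n S) = pscale (sgn_below n S) (ext_psi (- int n - 1) (unit_vec S))"
      using insert by (simp add: ext_psi_unit sgn_below_sq)
    then show ?case using scale[OF creation[OF _ insert(2), of "- int n - 1"]] by simp
  qed
  show ?thesis
  proof (induction u rule: poly_mapping_add_induct)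
    case (single k v)
    show ?case using scale[OF unit[of k], of v] by (simp only: single_pscale[of k v])
  qed (rule add)
qed

section \<open>The free-field Virasoro operators\<close>

definition nsum :: "int \<Rightarrow> int \<Rightarrow> ext \<Rightarrow> ext" where
  "nsum K k v = pscale (1 / 2) (\<Sum>r\<in>{- K..K}. pscale (half r) (normal_psi (- r - 1) (r + k) v))"

text \<open>For large \<open>\<bar>r\<bar>\<close> one of the two indices is at least
  \<open>M\<close> and the larger of the two; normal ordering puts it on the right, where it kills
  \<open>v\<close>.\<close>

lemma normal_psi_zero:
  assumes M: "M \<ge> 0" "\<forall>r\<ge>M. ext_psi r v = 0" and r: "\<bar>r\<bar> > M + \<bar>k\<bar> + 1"
  shows "normal_psi (- r - 1) (r + k) v = 0"
  using M r by (auto simp: normal_psi_def ext_psi_simps)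

lemma ext_L_nsum:
  assumes M: "M \<ge> 0" "\<forall>r\<ge>M. ext_psi r v = 0" and K: "K \<ge> M + \<bar>k\<bar> + 1"
  shows "ext_L k v = nsum K k v"
proof -
  have "Sum_any (\<lambda>r. pscale (half r) (normal_psi (- r - 1) (r + k) v)) =
    (\<Sum>r\<in>{- K..K}. pscale (half r) (normal_psi (- r - 1) (r + k) v))"
  proof (rule Sum_any.expand_superset)
    show "{a. pscale (half a) (normal_psi (- a - 1) (a + k) v) \<noteq> 0} \<subseteq> {- K..K}"
    proof clarify
      fix a assume "pscale (half a) (normal_psi (- a - 1) (a + k) v) \<noteq> 0"
      then have "\<not> \<bar>a\<bar> > M + \<bar>k\<bar> + 1" using normal_psi_zero[OF M, of k a] by auto
      then show "a \<in> {- K..K}" using K by auto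
    qed
  qed simp
  then show ?thesis by (simp add: ext_L_def nsum_def)
qed

lemma normal_psi_lin:
  "normal_psi r t (u + v) = normal_psi r t u + normal_psi r t v"
  "normal_psi r t (pscale a u) = pscale a (normal_psi r t u)"
  by (auto simp: normal_psi_def ext_psi_simps)

text \<open>Which summands of \<open>ext_L k v\<close> are nonzero depends on \<open>v\<close>. As
  any larger cut-off is equally good, finitely many vectors can share one, and identities reduce to
  finite sums.\<close>

lemma ex_nsum: "\<exists>K0. \<forall>K\<ge>K0. ext_L k v = nsum K k v"
  using ext_smooth[of v] ext_L_nsum by metis

lemma nsum_lin:
  "nsum K k (u + v) = nsum K k u + nsum K k v" "nsum K k (pscale a u) = pscale a (nsum K k u)"
  by (simp_all add: nsum_def normal_psi_lin ps.scale_right_distrib sum.distrib ps.scale_sum_right mult.commute)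

lemma ext_L_add: "ext_L k (u + v) = ext_L k u + ext_L k v"
proof -
  obtain K1 K2 K3 where "\<And>K. K \<ge> K1 \<Longrightarrow> ext_L k (u + v) = nsum K k (u + v)"
    "\<And>K. K \<ge> K2 \<Longrightarrow> ext_L k u = nsum K k u" "\<And>K. K \<ge> K3 \<Longrightarrow> ext_L k v = nsum K k v"
    using ex_nsum by metis
  from this[of "max K1 (max K2 K3)"] show ?thesis by (simp add: nsum_lin)
qed

lemma ext_L_scale: "ext_L k (pscale a u) = pscale a (ext_L k u)"
proof -
  obtain K1 K2 where "\<And>K. K \<ge> K1 \<Longrightarrow> ext_L k (pscale a u) = nsum K k (pscale a u)"
    "\<And>K. K \<ge> K2 \<Longrightarrow> ext_L k u = nsum K k u"
    using ex_nsum by metis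
  from this[of "max K1 K2"] show ?thesis by (simp add: nsum_lin)
qed

lemma ext_L_lin_on: "ps.lin_on UNIV (ext_L r)"
  by (simp add: ps.lin_on_def ext_L_add ext_L_scale)

lemmas ext_L_simps = ps.lin_on_0[OF ext_L_lin_on ps.subspace_UNIV]
  ps.lin_on_neg[OF ext_L_lin_on UNIV_I] ps.lin_on_diff[OF ext_L_lin_on ps.subspace_UNIV UNIV_I UNIV_I]
  ext_L_add ext_L_scale

lemma ext_L_sum: "ext_L r (sum f A) = (\<Sum>i\<in>A. ext_L r (f i))"
  by (rule ps.lin_on_sum[OF ext_L_lin_on ps.subspace_UNIV]) simp

text \<open>Normal ordering changes a product only by a multiple of the identity, which drops out of
  a commutator, so the result is that for the plain product.\<close>

lemma normal_psi_comm:
  "normal_psi a b (ext_psi t v) - ext_psi t (normal_psi a b v) =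
    (if b + t = - 1 then ext_psi a v else 0) - (if a + t = - 1 then ext_psi b v else 0)"
proof -
  have *: "ext_psi a (ext_psi b (ext_psi t v)) - ext_psi t (ext_psi a (ext_psi b v)) =
    (if b + t = - 1 then ext_psi a v else 0) - (if a + t = - 1 then ext_psi b v else 0)" for a b
    by (simp add: ext_psi_swap[of b t] ext_psi_swap[of a t] ext_psi_simps add.commute[of t])
  show ?thesis
  proof (cases "a \<le> b")
    case False
    then have "normal_psi a b (ext_psi t v) - ext_psi t (normal_psi a b v) =
        - (ext_psi b (ext_psi a (ext_psi t v)) - ext_psi t (ext_psi b (ext_psi a v)))"
      by (simp add: normal_psi_def ext_psi_simps)
    then show ?thesis unfolding *[of b a] by simp
  qed (simp add: normal_psi_def *)
qed

lemma ext_L_psi: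
  "ext_L m (ext_psi t v) - ext_psi t (ext_L m v) = pscale (- half t - of_int m / 2) (ext_psi (m + t) v)"
proof -
  obtain K1 where K1: "\<And>K. K \<ge> K1 \<Longrightarrow> ext_L m (ext_psi t v) = nsum K m (ext_psi t v)" using ex_nsum by metis
  obtain K2 where K2: "\<And>K. K \<ge> K2 \<Longrightarrow> ext_L m v = nsum K m v" using ex_nsum by metis
  define K where "K = \<bar>K1\<bar> + \<bar>K2\<bar> + \<bar>m\<bar> + \<bar>t\<bar> + 2"
  have K: "K \<ge> K1" "K \<ge> K2" "t \<in> {- K..K}" "- 1 - m - t \<in> {- K..K}" by (auto simp: K_def)
  have "ext_L m (ext_psi t v) - ext_psi t (ext_L m v) =
    pscale (1 / 2) (\<Sum>r\<in>{- K..K}. pscale (half r) (normal_psi (- r - 1) (r + m) (ext_psi t v) - ext_psi t (normal_psi (- r - 1) (r + m) v)))"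
    unfolding K1[OF K(1)] K2[OF K(2)] nsum_def
    by (simp add: ext_psi_simps ext_psi_sum ps.scale_right_diff_distrib sum_subtractf)
  \<comment> \<open>Only the summands whose pair contains the index opposite to \<open>t\<close>
    survive: those at \<open>r = t\<close> and \<open>r = - 1 - m - t\<close>. The cut-off
    \<open>K\<close> is large enough to include both.\<close>
  also have "(\<Sum>r\<in>{- K..K}. pscale (half r) (normal_psi (- r - 1) (r + m) (ext_psi t v) - ext_psi t (normal_psi (- r - 1) (r + m) v)))
    = (\<Sum>r\<in>{- K..K}. (if r = - 1 - m - t then pscale (half (- 1 - m - t)) (ext_psi (m + t) v) else 0)
        - (if r = t then pscale (half t) (ext_psi (m + t) v) else 0))"
  proof (rule sum.cong[OF refl])
    fix r
    have 1: "(if r + m + t = - 1 then ext_psi (- r - 1) v else 0) = (if r = - 1 - m - t then ext_psi (m + t) v else 0)"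
    proof (cases "r + m + t = - 1")
      case True
      then have a: "r = - 1 - m - t" and b: "- r - 1 = m + t" by simp_all
      show ?thesis by (subst if_P[OF True], subst if_P[OF a]) (simp only: b)
    qed auto
    have 2: "(if - r - 1 + t = - 1 then ext_psi (r + m) v else 0) = (if r = t then ext_psi (m + t) v else 0)"
      by (auto simp: add.commute)
    show "pscale (half r) (normal_psi (- r - 1) (r + m) (ext_psi t v) - ext_psi t (normal_psi (- r - 1) (r + m) v)) =
      (if r = - 1 - m - t then pscale (half (- 1 - m - t)) (ext_psi (m + t) v) else 0)
        - (if r = t then pscale (half t) (ext_psi (m + t) v) else 0)"
      unfolding normal_psi_comm 1 2 by (simp add: ps.scale_right_diff_distrib)
  qed
  also have "\<dots> = pscale (half (- 1 - m - t) - half t) (ext_psi (m + t) v)"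
    using K by (simp add: sum_subtractf ps.scale_left_diff_distrib)
  also have "pscale (1 / 2) \<dots> = pscale (- half t - of_int m / 2) (ext_psi (m + t) v)"
    by (simp add: half_def field_simps)
  finally show ?thesis .
qed

lemma ext_L_psi': "ext_L m (ext_psi t v) = ext_psi t (ext_L m v) + pscale (- half t - of_int m / 2) (ext_psi (m + t) v)"
  using ext_L_psi[of m t v] by (simp add: algebra_simps)

section \<open>Vacuum expectation values and the central charge 1/2\<close>

abbreviation vac :: ext where "vac \<equiv> unit_vec {||}"

text \<open>The vacuum expectation value; it reads off the central term.\<close>

definition eps :: "ext \<Rightarrow> complex" where "eps u = Poly_Mapping.lookup u {||}"

lemma eps_simps: "eps (u + v) = eps u + eps v" "eps (u - v) = eps u - eps v" "eps (pscale a u) = a * eps u"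
  "eps 0 = 0" "eps (sum f A) = (\<Sum>i\<in>A. eps (f i))" "eps vac = 1"
  by (simp_all add: eps_def lookup_add lookup_minus lookup_sum)

lemma lookup_dxi:
  "Poly_Mapping.lookup (dxi n u) T = (if n |\<in>| T then 0 else sgn_below n T * Poly_Mapping.lookup u (finsert n T))"
proof (induction u rule: poly_mapping_add_induct)
  case (single S v)
  have "n |\<notin>| T \<Longrightarrow> S = finsert n T \<longleftrightarrow> n |\<in>| S \<and> S |-| {|n|} = T" by auto
  moreover have "n |\<in>| S \<Longrightarrow> sgn_below n S = sgn_below n (S |-| {|n|})" by (simp add: sgn_below_fminus)
  ultimately show ?case
    by (subst (1 2) single_pscale) (auto simp: dxi_lin dxi_unit lookup_single when_def)
next
  case (sum f g)
  then show ?case by (simp add: dxi_lin lookup_add algebra_simps)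
qed

text \<open>For \<open>n\<close> in \<open>S\<close> the coefficient of \<open>u\<close> at
  \<open>S\<close> is, up to sign, the coefficient of \<open>dxi n u\<close> at \<open>S\<close>
  without \<open>n\<close>. So the vacuum is unique up to scalars.\<close>

lemma killed_vac:
  assumes "\<And>n::nat. ext_psi (int n) u = 0" shows "u = pscale (eps u) vac"
proof (rule poly_mapping_eqI)
  fix S :: "nat fset"
  show "Poly_Mapping.lookup u S = Poly_Mapping.lookup (pscale (eps u) vac) S"
  proof (cases "S = {||}")
    case True
    then show ?thesis by (simp add: eps_def)
  next
    case False
    then obtain n where "n |\<in>| S" by auto
    then obtain T where insert: "S = finsert n T" "n |\<notin>| T" by (meson mk_disjoint_finsert)
    have "dxi n u = 0" using assms[of n] by (simp add: ext_psi_def)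
    then have "sgn_below n T * Poly_Mapping.lookup u (finsert n T) = 0" using lookup_dxi[of n u T] insert by simp
    then show ?thesis using insert by (auto simp: sgn_below_def lookup_single when_def)
  qed
qed

lemma eps_creation: assumes "r < 0" shows "eps (ext_psi r u) = 0"
proof (induction u rule: poly_mapping_add_induct)
  case (single S v)
  then show ?case using assms by (subst single_pscale) (auto simp: ext_psi_simps ext_psi_unit eps_def lookup_single when_def)
qed (simp add: ext_psi_simps eps_simps)

lemma ext_psi_vac: "r \<ge> 0 \<Longrightarrow> ext_psi r vac = 0"
  using ext_psi_ann[of "nat r"] by simp

lemma ext_L_vac: assumes "n \<ge> 0" shows "ext_L n vac = 0"
proof -
  obtain K where "ext_L n vac = nsum K n vac" using ex_nsum by blast
  also have "\<dots> = 0"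
    unfolding nsum_def using assms
    by (subst sum.neutral) (auto simp: normal_psi_def ext_psi_vac ext_psi_simps)
  finally show ?thesis .
qed

text \<open>The two indices of each summand add up to \<open>m - 1 < 0\<close>, so the smaller one
  belongs to a creation operator, and normal ordering puts it on the left.\<close>

lemma eps_ext_L: assumes "m \<le> 0" shows "eps (ext_L m u) = 0"
proof -
  obtain K where "ext_L m u = nsum K m u" using ex_nsum by blast
  then have "eps (ext_L m u) = 1 / 2 * (\<Sum>r\<in>{- K..K}. half r * eps (normal_psi (- r - 1) (r + m) u))"
    by (simp add: nsum_def eps_simps)
  moreover have "eps (normal_psi (- r - 1) (r + m) u) = 0" for r
    using assms eps_creation[of "- r - 1"] eps_creation[of "r + m"] eps_simps(2)[of 0]
    by (auto simp: normal_psi_def eps_simps(4) not_le)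
  ultimately show ?thesis by simp
qed

text \<open>\<open>D\<close> is the defect of the Virasoro relation without central term. Its
  commutators with the \<psi>'s cancel because the coefficients \<open>c m t\<close> define a
  representation of the Witt algebra on the \<psi>'s.\<close>

lemma ext_L_comm_psi:
  fixes m n t v
  defines "D \<equiv> \<lambda>v. ext_L m (ext_L n v) - ext_L n (ext_L m v) - pscale (of_int (m - n)) (ext_L (m + n) v)"
  shows "D (ext_psi t v) = ext_psi t (D v)"
proof -
  define c where "c m t = - half t - of_int m / 2" for m t
  have "c n t * c m (n + t) - c m t * c n (m + t) - of_int (m - n) * c (m + n) t = 0"
    by (simp add: c_def half_def field_simps)
  then have "pscale (c n t * c m (n + t) - c m t * c n (m + t) - of_int (m - n) * c (m + n) t) (ext_psi (m + n + t) v) = 0"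
    by simp
  then show ?thesis
    unfolding D_def ext_L_psi' c_def[symmetric]
    by (simp add: ext_L_simps ext_psi_simps ext_L_psi' c_def[symmetric] ps.scale_left_diff_distrib
        ps.scale_right_distrib ps.scale_right_diff_distrib algebra_simps)
qed

lemma normal_psi_vac: assumes "a + b < - 1"
  shows "normal_psi a b vac = (if a < 0 \<and> b < 0 then ext_psi a (ext_psi b vac) else 0)"
  using assms ext_psi_swap[of a b vac]
  by (auto simp: normal_psi_def ext_psi_vac ext_psi_simps)

text \<open>For \<open>N = m\<close> and \<open>y = m / 2\<close> the value is
  \<open>(m^3 - m) / 12\<close>, twice the central term for \<open>c = 1/2\<close>.\<close>

lemma sum_half: "(\<Sum>r<N. half (int r) * (half (int r) - y)) = (4 * of_nat N ^ 3 - of_nat N) / 12 - y * of_nat N ^ 2 / 2"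
proof (induction N)
  case (Suc N)
  have *: "((4*x^3 - x)/12 - y*x^2/2) + (x+1/2)*(x+1/2-y) = (4*(x+1)^3-(x+1))/12 - y*(x+1)^2/2" for x :: complex
    by (simp add: power2_eq_square power3_eq_cube algebra_simps add_divide_distrib diff_divide_distrib)
  have h: "half (int N) = of_nat N + 1 / 2" by (simp add: half_def)
  show ?case unfolding sum.lessThan_Suc Suc.IH h of_nat_Suc using *[of "of_nat N"] by (simp only: add.commute)
qed simp

text \<open>In \<open>ext_L n vac\<close> only the summands with two creation operators survive,
  that is \<open>0 \<le> r < - n\<close>, and \<open>ext_L m\<close> can bring such a pair back to
  the vacuum only for \<open>m = - n\<close>.\<close>

lemma eps_LL:
  assumes "m > 0" "n < 0"
  shows "eps (ext_L m (ext_L n vac)) = (if m = - n then (of_int m ^ 3 - of_int m) / 24 else 0)"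
proof -
  obtain K0 where K0: "\<And>K. K \<ge> K0 \<Longrightarrow> ext_L n vac = nsum K n vac" using ex_nsum by metis
  define K where "K = max K0 (- n)"
  have K: "ext_L n vac = nsum K n vac" using K0 by (simp add: K_def)
  have e: "eps (ext_L m (normal_psi (- r - 1) (r + n) vac)) =
      (if 0 \<le> r \<and> r < - n \<and> m = - n then half r - of_int m / 2 else 0)" for r
  proof (cases "0 \<le> r \<and> r < - n")
    case True
    then have "eps (ext_psi (m + (- r - 1)) (ext_psi (r + n) vac)) = (if m = - n then 1 else 0)"
      using eps_creation[of "r + n"] by (subst ext_psi_swap) (auto simp: eps_simps)
    then have "eps (ext_L m (ext_psi (- r - 1) (ext_psi (r + n) vac))) =
        (if m = - n then - half (- r - 1) - of_int m / 2 else 0)"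
      unfolding ext_L_psi'[of m "- r - 1"] using True eps_creation[of "- r - 1"] by (simp add: eps_simps)
    moreover have "- half (- r - 1) = half r" by (simp add: half_def)
    ultimately show ?thesis using True assms by (subst normal_psi_vac) auto
  next
    case False
    then show ?thesis using assms by (subst normal_psi_vac) (auto simp: ext_L_simps eps_simps)
  qed
  have "eps (ext_L m (ext_L n vac)) =
      1 / 2 * (\<Sum>r\<in>{- K..K}. half r * (if 0 \<le> r \<and> r < - n \<and> m = - n then half r - of_int m / 2 else 0))"
    unfolding K nsum_def by (simp add: ext_L_simps ext_L_sum eps_simps e)
  also have "(\<Sum>r\<in>{- K..K}. half r * (if 0 \<le> r \<and> r < - n \<and> m = - n then half r - of_int m / 2 else 0))
      = (\<Sum>r\<in>{0..<- n}. if m = - n then half r * (half r - of_int m / 2) else 0)"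
    by (rule sum.mono_neutral_cong_right) (auto simp: K_def)
  also have "\<dots> = (if m = - n then \<Sum>r<nat m. half (int r) * (half (int r) - of_int m / 2) else 0)"
  proof (cases "m = - n")
    case True
    have "{0..<m} = int ` {..<nat m}" using image_int_atLeastLessThan[of 0 "nat m"] assms by (simp add: lessThan_atLeast0)
    then show ?thesis using True[symmetric] by (simp add: sum.reindex)
  qed simp
  finally have *: "eps (ext_L m (ext_L n vac)) =
      1 / 2 * (if m = - n then \<Sum>r<nat m. half (int r) * (half (int r) - of_int m / 2) else 0)" .
  have "of_nat (nat m) = (of_int m :: complex)" using assms by simp
  then show ?thesis unfolding * sum_half
    by (simp only: split: if_split) (simp add: field_simps power2_eq_square power3_eq_cube)
qed

text \<open>The defect of the relation commutes with the \<psi>'s, so its value on the vacuum is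
  killed by all annihilation operators and is a multiple of the vacuum; \<open>eps\<close> computes
  the multiple.\<close>

lemma ext_Vir_vac:
  "ext_L m (ext_L n vac) - ext_L n (ext_L m vac) =
    pscale (of_int (m - n)) (ext_L (m + n) vac) + (if m = - n then pscale ((of_int m ^ 3 - of_int m) / 24) vac else 0)"
proof -
  define u where "u = ext_L m (ext_L n vac) - ext_L n (ext_L m vac) - pscale (of_int (m - n)) (ext_L (m + n) vac)"
  have "ext_psi (int i) u = 0" for i
    unfolding u_def ext_L_comm_psi[symmetric] by (simp add: ext_psi_ann ext_L_simps)
  then have u: "u = pscale (eps u) vac" by (rule killed_vac)
  have "eps (ext_L (m + n) vac) = 0"
    using eps_ext_L[of "m + n" vac] ext_L_vac[of "m + n"] by (cases "m + n \<ge> 0") (auto simp: eps_simps)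
  then have e: "eps u = eps (ext_L m (ext_L n vac)) - eps (ext_L n (ext_L m vac))"
    by (simp add: u_def eps_simps)
  have z: "eps (ext_L a (ext_L b vac)) = 0" if "\<not> (a > 0 \<and> b < 0)" for a b
    using that eps_ext_L[of a "ext_L b vac"] ext_L_vac[of b] by (auto simp: ext_L_simps eps_simps not_less)
  have "eps u = (if m = - n then (of_int m ^ 3 - of_int m) / 24 else 0)"
  proof -
    consider "m > 0" "n < 0" | "n > 0" "m < 0" | "\<not> (m > 0 \<and> n < 0)" "\<not> (n > 0 \<and> m < 0)" by blast
    then show ?thesis
    proof cases
      case 1
      then show ?thesis unfolding e by (simp add: eps_LL z)
    next
      case 2
      then show ?thesis unfolding e by (auto simp add: eps_LL z field_simps)
    next
      case 3
      then show ?thesis unfolding e by (auto simp add: z)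
    qed
  qed
  then have "u = (if m = - n then pscale ((of_int m ^ 3 - of_int m) / 24) vac else 0)" using u by auto
  then show ?thesis by (simp add: u_def algebra_simps)
qed

section \<open>Parity in the exterior algebra\<close>

definition epart :: "bool \<Rightarrow> ext set" where
  "epart p = {v. \<forall>S\<in>Poly_Mapping.keys v. odd (fcard S) = p}"

lemma epart_sub: "ps.subspace (epart p)"
proof (rule ps.subspaceI)
  show "u + v \<in> epart p" if "u \<in> epart p" "v \<in> epart p" for u v
    using that Poly_Mapping.keys_add[of u v] by (auto simp: epart_def)
  show "pscale c u \<in> epart p" if "u \<in> epart p" for c u
    using that by (auto simp: epart_def in_keys_iff)
qed (simp add: epart_def)

lemma epart_unit: "unit_vec S \<in> epart (odd (fcard S))"
  by (simp add: epart_def)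

lemma ext_sum_keys: "v = (\<Sum>S\<in>Poly_Mapping.keys v. pscale (Poly_Mapping.lookup v S) (unit_vec S))"
  by (rule poly_mapping_eqI)
    (simp add: lookup_sum lookup_single when_def in_keys_iff if_distrib[of "\<lambda>c. _ * c"] cong: if_cong)

lemma epart_psi: assumes "u \<in> epart p" shows "ext_psi r u \<in> epart (\<not> p)"
proof -
  have 1: "ext_psi r (unit_vec S) \<in> epart (\<not> odd (fcard S))" for S
  proof (cases "r \<ge> 0")
    case True
    have "odd (fcard (S |-| {|nat r|})) = (\<not> odd (fcard S))" if h: "nat r |\<in>| S"
    proof -
      obtain T where "S = finsert (nat r) T" "nat r |\<notin>| T" using h by (meson mk_disjoint_finsert)
      then show ?thesis by (simp add: fcard_finsert_disjoint)
    qed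
    then show ?thesis using True epart_unit[of "S |-| {|nat r|}"]
      by (auto simp: ext_psi_unit ps.subspace_0[OF epart_sub] intro!: ps.subspace_scale[OF epart_sub])
  next
    case False
    have "odd (fcard (finsert n S)) = (\<not> odd (fcard S))" if "n |\<notin>| S" for n
      using that by (simp add: fcard_finsert_disjoint)
    then show ?thesis using False epart_unit[of "finsert (nat (- r - 1)) S"]
      by (auto simp: ext_psi_unit ps.subspace_0[OF epart_sub] intro!: ps.subspace_scale[OF epart_sub])
  qed
  have "ext_psi r u = (\<Sum>S\<in>Poly_Mapping.keys u. pscale (Poly_Mapping.lookup u S) (ext_psi r (unit_vec S)))"
    using arg_cong[OF ext_sum_keys[of u], of "ext_psi r"] by (simp only: ext_psi_sum ext_psi_scale)
  also have "\<dots> \<in> epart (\<not> p)"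
    using assms 1 by (intro ps.subspace_sum[OF epart_sub] ps.subspace_scale[OF epart_sub]) (auto simp: epart_def)
  finally show ?thesis .
qed

lemma epart_L: assumes "u \<in> epart p" shows "ext_L m u \<in> epart p"
proof -
  obtain K where "ext_L m u = nsum K m u" using ex_nsum by blast
  moreover have "normal_psi a b u \<in> epart p" for a b
    using epart_psi[OF epart_psi[OF assms]] by (auto simp: normal_psi_def intro!: ps.subspace_neg[OF epart_sub])
  ultimately show ?thesis
    by (simp add: nsum_def ps.subspace_scale[OF epart_sub] ps.subspace_sum[OF epart_sub])
qed

section \<open>Vacuum vectors\<close>

locale fvmod_charged = fvmod s H L P k \<zeta>
  for s :: "complex \<Rightarrow> 'a::ab_group_add \<Rightarrow> 'a" and H L P k \<zeta> +
  fixes l :: complex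
  assumes l0: "l \<noteq> 0" and l2: "\<zeta> = l\<^sup>2"
begin

definition p :: "int \<Rightarrow> 'a \<Rightarrow> 'a" where "p r v = s (1 / l) (P r v)"

lemma P_p: "P r v = s l (p r v)"
  using l0 by (simp add: p_def)

lemma p_lin: "lin_on C (p r)"
  unfolding p_def by (rule lin_on_comp[OF lin_on_const[OF C_sub] P_lin])

lemma p_simps [simp]:
  "v \<in> C \<Longrightarrow> p r v \<in> C"
  "v \<in> C \<Longrightarrow> w \<in> C \<Longrightarrow> p m (v + w) = p m v + p m w"
  "v \<in> C \<Longrightarrow> w \<in> C \<Longrightarrow> p m (v - w) = p m v - p m w"
  "v \<in> C \<Longrightarrow> p m (s a v) = s a (p m v)" "v \<in> C \<Longrightarrow> p m (- v) = - p m v" "p m 0 = 0"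
  by (simp_all add: lin_onD[OF p_lin] lin_on_neg[OF p_lin] lin_on_diff[OF p_lin C_sub] lin_on_0[OF p_lin C_sub])

lemma p_sum: "(\<And>i. i \<in> A \<Longrightarrow> f i \<in> C) \<Longrightarrow> p m (sum f A) = (\<Sum>i\<in>A. p m (f i))"
  by (rule lin_on_sum[OF p_lin C_sub])

lemma p_hom: "v \<in> H q \<Longrightarrow> p r v \<in> H (\<not> q)"
  by (simp add: p_def subspace_scale[OF H_sub] P_hom)

lemma p_wt: "v \<in> wt \<alpha> \<Longrightarrow> p r v \<in> wt (\<alpha> - half r)"
  by (simp add: p_def subspace_scale[OF wt_sub] wt_P)

lemma pp: assumes "v \<in> C" shows "p r (p t v) = (if r + t = - 1 then v else 0) - p t (p r v)"
proof -
  have "p r (p t v) + p t (p r v) = s (1 / l\<^sup>2) (P r (P t v) + P t (P r v))"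
    using assms by (simp add: p_def scale_right_distrib power2_eq_square)
  also have "\<dots> = (if r + t = - 1 then v else 0)" using PP[OF assms] l0 l2 by simp
  finally show ?thesis by (simp add: algebra_simps)
qed

lemma p_sq: assumes "v \<in> C" shows "p r (p r v) = 0"
proof -
  have "s 2 (p r (p r v)) = p r (p r v) + p r (p r v)" by (metis one_add_one scale_left_distrib scale_one)
  also have "\<dots> = 0" using pp[OF assms, of r r] by (auto simp: algebra_simps) presburger
  finally show ?thesis by simp
qed

lemma Lp: assumes "v \<in> C"
  shows "L m (p r v) = p r (L m v) + s (- half r - of_int m / 2) (p (m + r) v)"
proof -
  have "L m (p r v) - p r (L m v) = s (1 / l) (L m (P r v) - P r (L m v))"
    using assms by (simp add: p_def scale_right_diff_distrib)
  also have "\<dots> = s (- half r - of_int m / 2) (p (m + r) v)"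
    unfolding LP[OF assms] by (simp add: p_def mult.commute)
  finally show ?thesis by (simp add: algebra_simps)
qed

section \<open>Number operators\<close>

definition num :: "nat \<Rightarrow> 'a \<Rightarrow> 'a" where "num n v = p (- int n - 1) (p (int n) v)"

lemma num_lin: "lin_on C (num n)"
  unfolding num_def by (rule lin_on_comp[OF p_lin p_lin])

lemma num_idem: assumes "v \<in> C" shows "num n (num n v) = num n v"
  using pp[of "p (int n) v" "int n" "- int n - 1"] assms p_sq[OF assms]
  by (simp add: num_def)

lemma num_comm: assumes "v \<in> C" shows "num n (num m v) = num m (num n v)"
proof (cases "n = m")
  case False
  have 1: "num n (p r x) = p r (num n x)" if "x \<in> C" "r \<noteq> int n" "r \<noteq> - int n - 1" for r x
    using that pp[of x "int n" r] pp[of "p (int n) x" "- int n - 1" r] by (simp add: num_def)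
  show ?thesis
    unfolding num_def[of m] using 1[of v "int m"] 1[of "p (int m) v" "- int m - 1"] assms False by simp
qed simp

text \<open>The relations give \<open>p (int n) (num n v) = p (int n) v\<close>.\<close>

lemma num_0: assumes "v \<in> C" "num n v = 0" shows "p (int n) v = 0"
  using pp[of "p (int n) v" "int n" "- int n - 1"] assms p_sq[OF assms(1)] by (simp add: num_def)

lemma num_1: assumes "v \<in> C" "num n v = v" shows "p (- int n - 1) v = 0"
  using p_sq[of "p (int n) v" "- int n - 1"] assms by (simp add: num_def)

lemma num_wt: assumes "v \<in> wt \<alpha>" shows "num n v \<in> wt \<alpha>"
proof -
  have "\<alpha> - half (int n) - half (- int n - 1) = \<alpha>" by (simp add: half_def)
  then show ?thesis using p_wt[OF p_wt[OF assms, of "int n"], of "- int n - 1"] unfolding num_def by metis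
qed

lemma num_hom: "v \<in> H q \<Longrightarrow> num n v \<in> H q"
  using p_hom[OF p_hom[of v q "int n"], of "- int n - 1"] by (simp add: num_def)

text \<open>Infinitely many commuting idempotents act on a finite-dimensional space. On a nonzero
  stable subspace of least dimension each of them is \<open>0\<close> or the identity: otherwise its
  fixed vectors would form a smaller one.\<close>

lemma num_eigenvector:
  assumes v: "v \<in> wt \<alpha>" "v \<in> H q" "v \<noteq> 0"
  obtains w where "w \<in> wt \<alpha>" "w \<in> H q" "w \<noteq> 0" "\<And>n. num n w = 0 \<or> num n w = w"
proof -
  define st where "st U \<longleftrightarrow> subspace U \<and> U \<subseteq> wt \<alpha> \<inter> H q \<and> (\<exists>x\<in>U. x \<noteq> 0) \<and> (\<forall>n. \<forall>x\<in>U. num n x \<in> U)" for U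
  obtain B where B: "finite B" "wt \<alpha> = span B" by (rule wt_fin')
  have "st (wt \<alpha> \<inter> H q)"
    using v num_wt num_hom by (auto simp: st_def intro!: subspace_inter[OF wt_sub H_sub])
  moreover have "spanned_by (card B) (wt \<alpha> \<inter> H q)" using B by (auto simp: spanned_by_def)
  ultimately have ex: "\<exists>N U. st U \<and> spanned_by N U" by blast
  define N where "N = (LEAST N. \<exists>U. st U \<and> spanned_by N U)"
  obtain U where U: "st U" "spanned_by N U" unfolding N_def using LeastI_ex[OF ex] by blast
  have min: "\<not> spanned_by N' X" if "st X" "N' < N" for N' X
    using not_less_Least[of N' "\<lambda>N. \<exists>U. st U \<and> spanned_by N U"] that by (auto simp: N_def)
  have UC: "x \<in> C" if "x \<in> U" for x using that U(1) wt_C by (auto simp: st_def)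
  have subU: "subspace U" using U(1) by (simp add: st_def)
  obtain B' where B': "finite B'" "card B' \<le> N" "U \<subseteq> span B'" using U(2) by (auto simp: spanned_by_def)
  have all: "(\<forall>x\<in>U. num n x = 0) \<or> (\<forall>y\<in>U. num n y = y)" for n
  proof (rule ccontr)
    assume "\<not> ?thesis"
    then obtain x y where xy: "x \<in> U" "num n x \<noteq> 0" "y \<in> U" "num n y \<noteq> y" by blast
    define X where "X = {x \<in> U. num n x = x}"
    have sX: "subspace X"
      unfolding X_def using subU UC
      by (intro subspaceI) (auto simp: subspace_0 subspace_add subspace_scale lin_on_0[OF num_lin C_sub] lin_onD[OF num_lin])
    have "st X" unfolding st_def
    proof (intro conjI allI ballI)
      show "X \<subseteq> wt \<alpha> \<inter> H q" using U(1) by (auto simp: st_def X_def)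
      show "\<exists>x\<in>X. x \<noteq> 0"
        using xy U(1) num_idem[OF UC] by (intro bexI[of _ "num n x"]) (auto simp: st_def X_def)
      show "num m z \<in> X" if "z \<in> X" for m z
        using that U(1) num_comm[OF UC, of z n m] by (auto simp: st_def X_def)
    qed (rule sX)
    obtain J where J: "J \<subseteq> X" "independent J" "X \<subseteq> span J" using basis_exists[of X] by metis
    have "y \<notin> span J" using J(1) sX xy span_minimal[OF J(1) sX] by (auto simp: X_def)
    then have ind: "independent (insert y J)" using J(2) by (rule independent_insertI)
    have "insert y J \<subseteq> span B'" using J(1) xy B' by (auto simp: X_def)
    then have c: "finite (insert y J)" "card (insert y J) \<le> card B'"
      using independent_span_bound[OF B'(1) ind] by auto
    have "y \<notin> J" using \<open>y \<notin> span J\<close> span_base by blast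
    then have "card J < N" using c B'(2) by simp
    moreover have "spanned_by (card J) X" using J c by (auto simp: spanned_by_def)
    ultimately show False using min[OF \<open>st X\<close>] by blast
  qed
  obtain w where "w \<in> U" "w \<noteq> 0" using U(1) by (auto simp: st_def)
  then show ?thesis using that[of w] all U(1) by (auto simp: st_def)
qed

text \<open>If infinitely many \<open>\<psi>\<close>'s of both signs acted nontrivially on the eigenvector \<open>w\<close>, the vectors
  \<open>p (-n-2) (p n w)\<close> would be infinitely many independent vectors in a single weight space.\<close>

lemma vacuum_dichotomy:
  obtains w q where "w \<in> H q" "w \<noteq> 0" "finite {n::nat. p (int n) w \<noteq> 0}"
  | w where "w \<in> C" "w \<noteq> 0" "finite {n::nat. p (- int n - 1) w \<noteq> 0}"
proof -
  obtain \<alpha> v q where v: "v \<in> wt \<alpha>" "v \<noteq> 0" "v \<in> H q" by (rule ex_wt)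
  obtain w where w: "w \<in> wt \<alpha>" "w \<in> H q" "w \<noteq> 0" "\<And>n. num n w = 0 \<or> num n w = w"
    using num_eigenvector[OF v(1,3,2)] by blast
  have wC: "w \<in> C" using w wt_C by blast
  define I where "I = {n. num n w = w}"
  have nI: "n \<notin> I \<longleftrightarrow> num n w = 0" for n using w(3) w(4)[of n] by (auto simp: I_def)
  have I0: "p (int n) w = 0" if "n \<notin> I" for n using that num_0[OF wC] nI by blast
  have I1: "p (- int n - 1) w = 0" if "n \<in> I" for n using that num_1[OF wC] by (simp add: I_def)
  have "finite I \<or> finite (- I)"
  proof (rule ccontr)
    assume *: "\<not> ?thesis"
    \<comment> \<open>\<open>I\<close> is the set of occupied modes. If it and its complement are
      infinite, infinitely many occupied modes have an empty one right above.\<close>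
    define Q where "Q = {n. n \<in> I \<and> Suc n \<notin> I}"
    have "infinite Q" unfolding infinite_nat_iff_unbounded_le
    proof
      fix m
      have inf: "infinite I" "infinite (- I)" using * by auto
      obtain n where n: "n \<ge> m" "n \<in> I" using inf(1)[unfolded infinite_nat_iff_unbounded_le] by blast
      obtain n' where n': "n' > n" "n' \<notin> I" using inf(2)[unfolded infinite_nat_iff_unbounded] by blast
      define j where "j = (LEAST j. j > n \<and> j \<notin> I)"
      have j: "j > n" "j \<notin> I" using LeastI[of "\<lambda>j. j > n \<and> j \<notin> I" n'] n' by (auto simp: j_def)
      have "j - 1 \<in> I"
      proof (cases "j - 1 = n")
        case False
        then show ?thesis using not_less_Least[of "j - 1" "\<lambda>j. j > n \<and> j \<notin> I"] j(1) unfolding j_def[symmetric] by auto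
      qed (use n in simp)
      then show "\<exists>n\<ge>m. n \<in> Q" using j n by (intro exI[of _ "j - 1"]) (auto simp: Q_def)
    qed
    obtain B where B: "finite B" "wt (\<alpha> + 1) = span B" by (rule wt_fin')
    obtain A where A: "A \<subseteq> Q" "finite A" "card A = Suc (card B)"
      using infinite_arbitrarily_large[OF \<open>infinite Q\<close>] by blast
    \<comment> \<open>A particle moves from mode \<open>n\<close> to mode \<open>n + 1\<close>,
      which raises the weight by \<open>1\<close> whatever \<open>n\<close> is.\<close>
    define y where "y n = p (- int (Suc n) - 1) (p (int n) w)" for n
    have "y n \<in> wt (\<alpha> + 1)" for n
    proof -
      have "\<alpha> - half (int n) - half (- int (Suc n) - 1) = \<alpha> + 1" by (simp add: half_def)
      then show ?thesis using p_wt[OF p_wt[OF w(1), of "int n"], of "- int (Suc n) - 1"] unfolding y_def by metis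
    qed
    then have "\<exists>c. (\<exists>i\<in>A. c i \<noteq> 0) \<and> (\<Sum>i\<in>A. s (c i) (y i)) = 0"
      using dependent_family[of A B y] A B by auto
    then obtain c m where c: "m \<in> A" "c m \<noteq> 0" "(\<Sum>i\<in>A. s (c i) (y i)) = 0" by blast
    \<comment> \<open>The particle is moved back from \<open>m + 1\<close> to \<open>m\<close>: this
      recovers \<open>w\<close> from \<open>y m\<close> and kills the other \<open>y i\<close>, in
      which mode \<open>m + 1\<close> is still empty.\<close>
    define R where "R v = p (- int m - 1) (p (int (Suc m)) v)" for v
    have Rlin: "lin_on C R" unfolding R_def by (rule lin_on_comp[OF p_lin p_lin])
    have yC: "y i \<in> C" for i using wC by (simp add: y_def)
    have R: "R (y i) = (if i = m then w else 0)" if "i \<in> A" for i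
    proof -
      have i: "i \<in> I" "Suc i \<notin> I" "m \<in> I" "Suc m \<notin> I" using that c A by (auto simp: Q_def)
      then have ne: "m \<noteq> Suc i" "i \<noteq> Suc m" by auto
      have 1: "p (int (Suc m)) (p (int i) w) = 0"
        using pp[OF wC, of "int (Suc m)" "int i"] I0[OF i(4)] by simp
      then have 2: "p (int (Suc m)) (y i) = (if i = m then p (int i) w else 0)"
        using pp[of "p (int i) w" "int (Suc m)" "- int (Suc i) - 1"] wC by (auto simp: y_def)
      show ?thesis using 2 i(1) by (auto simp: R_def I_def num_def)
    qed
    have "0 = R (\<Sum>i\<in>A. s (c i) (y i))" using c lin_on_0[OF Rlin C_sub] by simp
    also have "\<dots> = (\<Sum>i\<in>A. s (c i) (R (y i)))"
      using yC by (subst lin_on_sum[OF Rlin C_sub]) (auto simp: lin_onD[OF Rlin])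
    also have "\<dots> = (\<Sum>i\<in>A. if i = m then s (c m) w else 0)" by (rule sum.cong) (auto simp: R)
    also have "\<dots> = s (c m) w" using A c by simp
    finally show False using c w by simp
  qed
  then show ?thesis
  proof
    assume "finite I"
    moreover have "{n::nat. p (int n) w \<noteq> 0} \<subseteq> I" using I0 by blast
    ultimately show ?thesis using that(1)[OF w(2,3)] finite_subset by blast
  next
    assume "finite (- I)"
    moreover have "{n::nat. p (- int n - 1) w \<noteq> 0} \<subseteq> - I" using I1 by blast
    ultimately show ?thesis using that(2)[OF wC w(3)] finite_subset by blast
  qed
qed

text \<open>Applying a \<open>p n\<close> that does not kill \<open>w\<close> yields a vector killed
  by this \<open>p n\<close> and, by anticommutation, by all that killed \<open>w\<close>. Finitely
  many such steps suffice.\<close>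

lemma ex_vacuum:
  assumes "w \<in> H q" "w \<noteq> 0" "finite {n::nat. p (int n) w \<noteq> 0}"
  shows "\<exists>u q. u \<in> H q \<and> u \<noteq> 0 \<and> (\<forall>n::nat. p (int n) u = 0)"
  using assms
proof (induction "card {n::nat. p (int n) w \<noteq> 0}" arbitrary: w q rule: less_induct)
  case less
  show ?case
  proof (cases "{n::nat. p (int n) w \<noteq> 0} = {}")
    case True
    then show ?thesis using less.prems by blast
  next
    case False
    then obtain n where n: "p (int n) w \<noteq> 0" by blast
    have wC: "w \<in> C" using less.prems H_C by blast
    have "p (int m) (p (int n) w) = 0" if "p (int m) w = 0 \<or> m = n" for m :: nat
      using that pp[OF wC, of "int m" "int n"] p_sq[OF wC] by auto
    then have "{m::nat. p (int m) (p (int n) w) \<noteq> 0} \<subset> {m::nat. p (int m) w \<noteq> 0}" using n by blast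
    then show ?thesis using less.hyps[of "p (int n) w" "\<not> q"] p_hom[OF less.prems(1)] n less.prems(3)
      by (meson finite_subset psubset_card_mono psubset_imp_subset)
  qed
qed

text \<open>The sign \<open>e\<close> selects one of the two alternatives of the dichotomy.\<close>

lemma finite_action_all:
  assumes e: "e = 1 \<or> e = (- 1 :: int)"
    and x: "x \<in> C" "x \<noteq> 0" "\<exists>M. \<forall>r\<ge>M. p (e * r) x = 0" and v: "v \<in> C"
  shows "\<exists>M. \<forall>r\<ge>M. p (e * r) v = 0"
proof -
  define N where "N = {v \<in> C. \<exists>M. \<forall>r\<ge>M. p (e * r) v = 0}"
  have "N = C"
  proof (rule simple_graded[of _ x])
    show "subspace N"
    proof (rule subspaceI)
      show "0 \<in> N" by (auto simp: N_def)
      show "s c y \<in> N" if "y \<in> N" for c y using that by (auto simp: N_def)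
      fix y z assume "y \<in> N" "z \<in> N"
      then obtain M M' where "\<forall>j\<ge>M. p (e * j) y = 0" "\<forall>j\<ge>M'. p (e * j) z = 0" "y \<in> C" "z \<in> C"
        by (auto simp: N_def)
      then show "y + z \<in> N" by (auto simp: N_def intro!: exI[of _ "max M M'"])
    qed
    show "graded N" unfolding graded_def
    proof
      fix y assume y: "y \<in> N"
      then obtain M where M: "\<forall>j\<ge>M. p (e * j) y = 0" by (auto simp: N_def)
      obtain a b where ab: "a \<in> H False" "b \<in> H True" "y = a + b" using y by (auto simp: N_def elim: C_cases)
      have "p (e * j) a = 0 \<and> p (e * j) b = 0" if "j \<ge> M" for j
      proof -
        have z: "0 \<in> H False" "0 \<in> H True" using subspace_0[OF H_sub] by auto
        have "p (e * j) b + p (e * j) a = 0 + 0" using M that ab H_C by (auto simp: add.commute)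
        then show ?thesis
          using H_unique[of "p (e * j) b" 0 "p (e * j) a" 0] z p_hom[of a False] p_hom[of b True] ab by auto
      qed
      then show "\<exists>a\<in>N \<inter> H False. \<exists>b\<in>N \<inter> H True. y = a + b"
        using ab by (intro bexI[of _ a] bexI[of _ b]) (auto simp: N_def H_C)
    qed
    fix y assume y: "y \<in> N"
    then obtain M where M: "\<And>j. j \<ge> M \<Longrightarrow> p (e * j) y = 0" and yC: "y \<in> C" by (auto simp: N_def)
    show "L m y \<in> N" for m
    proof -
      have "p (e * j) (L m y) = 0" if "j \<ge> M + \<bar>m\<bar>" for j
      proof -
        have "m + e * j = e * (j + e * m)" using e by auto
        moreover have "j + e * m \<ge> M" "j \<ge> M" using e that by auto
        ultimately show ?thesis using Lp[OF yC, of m "e * j"] M by simp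
      qed
      then show ?thesis using yC by (auto simp: N_def)
    qed
    show "P r y \<in> N" for r
    proof -
      have "p (e * j) (p r y) = 0" if "j \<ge> \<bar>M\<bar> + \<bar>r\<bar> + 2" for j
        using pp[OF yC, of "e * j" r] M[of j] that e by auto
      then show ?thesis using yC by (auto simp: N_def P_p)
    qed
  qed (use x in \<open>auto simp: N_def\<close>)
  then show ?thesis using v by (auto simp: N_def)
qed

end

section \<open>Decomposition over the vacuum vectors\<close>

text \<open>Interpreted either for the given module or for its dual, where the operators and the
  scalars \<open>k\<close>, \<zeta>, \<open>l\<close> are different.\<close>

locale fock = fvmod_charged s H L P k \<zeta> l
  for s :: "complex \<Rightarrow> 'a::ab_group_add \<Rightarrow> 'a" and H L P k \<zeta> l +
  assumes vacuum: "\<exists>u q. u \<in> H q \<and> u \<noteq> 0 \<and> (\<forall>n::nat. p (int n) u = 0)"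
begin

definition V :: "'a set" where "V = {v \<in> C. \<forall>n::nat. p (int n) v = 0}"

lemma V_C: "v \<in> V \<Longrightarrow> v \<in> C" by (simp add: V_def)

lemma V_pos: "v \<in> V \<Longrightarrow> r \<ge> 0 \<Longrightarrow> p r v = 0"
  using zero_le_imp_eq_int[of r] by (auto simp: V_def)

lemma V_I: "v \<in> C \<Longrightarrow> (\<And>n::nat. p (int n) v = 0) \<Longrightarrow> v \<in> V"
  by (simp add: V_def)

lemma V_sub: "subspace V"
  by (rule subspaceI) (auto simp: V_def)

lemma V_graded: "graded V"
  unfolding graded_def
proof
  fix y assume y: "y \<in> V"
  then obtain a b where ab: "a \<in> H False" "b \<in> H True" "y = a + b" by (auto simp: V_def elim: C_cases)
  have z: "0 \<in> H False" "0 \<in> H True" using subspace_0[OF H_sub] by auto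
  have "p r b + p r a = 0 + 0" if "r \<ge> 0" for r using V_pos[OF y that] ab by (simp add: H_C add.commute)
  then have "p r a = 0 \<and> p r b = 0" if "r \<ge> 0" for r
    using H_unique[of "p r b" 0 "p r a" 0] z p_hom[of a False] p_hom[of b True] ab that by auto
  then show "\<exists>a\<in>V \<inter> H False. \<exists>b\<in>V \<inter> H True. y = a + b"
    using ab by (intro bexI[of _ a] bexI[of _ b]) (auto simp: V_def H_C)
qed

section \<open>Action of the exterior algebra on vacuum vectors\<close>

definition crl :: "nat list \<Rightarrow> 'a \<Rightarrow> 'a" where "crl xs v = foldr (\<lambda>n. p (- int n - 1)) xs v"

text \<open>The creation operators come in increasing order of their modes, as in the basis
  monomials of the exterior algebra; hence \<open>cr_insert\<close> has the same sign as
  \<open>wedge (xi n)\<close>.\<close>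

definition cr :: "nat fset \<Rightarrow> 'a \<Rightarrow> 'a" where "cr S v = crl (sorted_list_of_fset S) v"

lemma crl_simps [simp]: "crl [] v = v" "crl (x # xs) v = p (- int x - 1) (crl xs v)"
  by (simp_all add: crl_def)

lemma crl_lin: "lin_on C (crl xs)"
proof (induction xs)
  case Nil
  then show ?case by (simp add: lin_on_def)
next
  case (Cons x xs)
  then show ?case using lin_on_comp[OF p_lin Cons] by (simp add: lin_on_def)
qed

lemma crl_C [simp]: "v \<in> C \<Longrightarrow> crl xs v \<in> C"
  using crl_lin by (rule lin_onD(1))

lemma crl_mem: assumes "v \<in> C" "n \<in> set xs" shows "p (- int n - 1) (crl xs v) = 0"
  using assms(2)
proof (induction xs)
  case (Cons x xs)
  show ?case
  proof (cases "x = n")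
    case True
    then show ?thesis using p_sq[of "crl xs v"] assms(1) by simp
  next
    case False
    then show ?thesis using Cons pp[of "crl xs v" "- int n - 1" "- int x - 1"] assms(1) by simp
  qed
qed simp

lemma crl_insort:
  assumes "v \<in> C" "sorted xs" "distinct xs" "n \<notin> set xs"
  shows "p (- int n - 1) (crl xs v) = s ((- 1) ^ card {m \<in> set xs. m < n}) (crl (insort n xs) v)"
  using assms(2-4)
proof (induction xs)
  case (Cons x xs)
  show ?case
  proof (cases "n \<le> x")
    case True
    then have e: "{m \<in> set (x # xs). m < n} = {}" using Cons by auto
    show ?thesis unfolding e using True by simp
  next
    case False
    have "{m \<in> set (x # xs). m < n} = insert x {m \<in> set xs. m < n}" using False by auto
    moreover have "x \<notin> {m \<in> set xs. m < n}" using Cons by auto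
    ultimately have e: "card {m \<in> set (x # xs). m < n} = Suc (card {m \<in> set xs. m < n})" by simp
    have "p (- int n - 1) (crl (x # xs) v) = - p (- int x - 1) (p (- int n - 1) (crl xs v))"
      using pp[of "crl xs v" "- int n - 1" "- int x - 1"] assms(1) by simp
    then show ?thesis unfolding e using Cons False assms(1) by simp
  qed
qed simp

lemma cr_lin: "lin_on C (cr S)"
  using crl_lin by (simp add: cr_def lin_on_def)

lemma cr_C [simp]: "v \<in> C \<Longrightarrow> cr S v \<in> C"
  by (simp add: cr_def)

lemma cr_empty [simp]: "cr {||} v = v"
  by (simp add: cr_def sorted_list_of_fset.rep_eq)

lemma cr_mem: "v \<in> C \<Longrightarrow> n |\<in>| S \<Longrightarrow> p (- int n - 1) (cr S v) = 0"
  unfolding cr_def by (rule crl_mem) auto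

lemma cr_insert:
  assumes "v \<in> C" "n |\<notin>| S"
  shows "p (- int n - 1) (cr S v) = s (sgn_below n S) (cr (finsert n S) v)"
proof -
  have "sorted_list_of_fset (finsert n S) = insort n (sorted_list_of_fset S)"
    using assms(2) by (simp add: sorted_list_of_fset.rep_eq)
  moreover have "{m \<in> set (sorted_list_of_fset S). m < n} = {m. m |\<in>| S \<and> m < n}" by auto
  ultimately show ?thesis
    using crl_insort[OF assms(1), of "sorted_list_of_fset S" n] assms(2)
    by (simp add: cr_def sgn_below_def sorted_list_of_fset.rep_eq)
qed

text \<open>The elements of the exterior algebra act through creation operators. On vacuum vectors
  \<open>v\<close> this is the map from the tensor product to the module.\<close>

definition mu :: "ext \<Rightarrow> 'a \<Rightarrow> 'a" where "mu u v = lin_extend s (\<lambda>S. cr S v) u"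

lemma mu_left: "mu (u + u') v = mu u v + mu u' v" "mu (u - u') v = mu u v - mu u' v"
  "mu (pscale a u) v = s a (mu u v)" "mu 0 v = 0" "mu (unit_vec S) v = cr S v"
  by (simp_all add: mu_def lin_extend_add lin_extend_diff lin_extend_pscale)

lemma mu_vac: "mu vac v = v"
  by (simp add: mu_left)

lemma mu_lin: "lin_on C (mu u)"
  unfolding lin_on_def mu_def lin_extend_def
  by (auto simp: lin_onD[OF cr_lin] scale_right_distrib sum.distrib scale_sum_right mult.commute)

lemma mu_C [simp]: "v \<in> C \<Longrightarrow> mu u v \<in> C"
  using mu_lin by (rule lin_onD(1))

lemmas mu_right = lin_onD(2,3)[OF mu_lin] lin_on_diff[OF mu_lin C_sub] lin_on_0[OF mu_lin C_sub] lin_on_sum[OF mu_lin C_sub]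

lemma mu_creation: assumes v: "v \<in> C" and r: "r < 0" shows "mu (ext_psi r u) v = p r (mu u v)"
proof (rule poly_mapping_lin_eqI[where s = s])
  fix S :: "nat fset"
  have "- int (nat (- r - 1)) - 1 = r" using r by simp
  then show "mu (ext_psi r (unit_vec S)) v = p r (mu (unit_vec S) v)"
    using cr_mem[OF v, of "nat (- r - 1)" S] cr_insert[OF v, of "nat (- r - 1)" S] r
    by (auto simp: ext_psi_unit mu_left)
qed (use v in \<open>simp_all add: ext_psi_simps mu_left cspace_axioms\<close>)

text \<open>For creation operators this holds by construction. Annihilation operators are moved to
  the right by the same relations on both sides, until they meet \<open>vac\<close> and
  \<open>v\<close> respectively, which they kill.\<close>

lemma mu_psi: assumes v: "v \<in> V" shows "mu (ext_psi r u) v = p r (mu u v)"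
proof (induction u arbitrary: r rule: ext_induct)
  case one
  show ?case
    using V_pos[OF v, of r] mu_creation[OF V_C[OF v], of r vac] by (cases "r \<ge> 0") (simp_all add: ext_psi_vac mu_left)
next
  case (creation t u)
  have "mu (ext_psi r (ext_psi t u)) v = (if r + t = - 1 then mu u v else 0) - p t (p r (mu u v))"
    using creation V_C[OF v] by (subst ext_psi_swap) (simp add: mu_left mu_creation)
  also have "\<dots> = p r (p t (mu u v))" using pp[of "mu u v" r t] V_C[OF v] by simp
  finally show ?case using creation V_C[OF v] by (simp add: mu_creation)
qed (use V_C[OF v] in \<open>simp_all add: ext_psi_simps mu_left\<close>)

text \<open>The part of \<open>L m\<close> that commutes with the \<open>\<psi>\<close>'s; it acts on the space \<open>V\<close> of vacuum vectors.\<close>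

definition LV :: "int \<Rightarrow> 'a \<Rightarrow> 'a" where "LV m v = L m v - mu (ext_L m vac) v"

lemma LV_lin: "lin_on C (LV m)"
  unfolding LV_def lin_on_def by (auto simp: mu_right scale_right_diff_distrib algebra_simps)

text \<open>\<open>L m\<close> and the free-field operator have the same commutators with the
  \<psi>'s, so the two contributions cancel.\<close>

lemma LV_V: assumes v: "v \<in> V" shows "LV m v \<in> V"
proof (rule V_I)
  show "LV m v \<in> C" using V_C[OF v] by (simp add: LV_def)
  fix n :: nat
  define c where "c = - half (int n) - of_int m / 2"
  have "p (int n) (L m v) = - s c (p (m + int n) v)"
    using Lp[OF V_C[OF v], of m "int n"] V_pos[OF v, of "int n"] by (simp add: c_def eq_neg_iff_add_eq_0)
  moreover have "ext_psi (int n) (ext_L m vac) = - pscale c (ext_psi (m + int n) vac)"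
    using ext_L_psi'[of m "int n" vac] ext_psi_vac[of "int n"] by (simp add: c_def ext_L_simps eq_neg_iff_add_eq_0)
  then have "p (int n) (mu (ext_L m vac) v) = - s c (p (m + int n) v)"
    unfolding mu_psi[OF v, symmetric] using mu_left(2)[of 0] by (simp add: mu_left mu_psi[OF v] mu_vac)
  ultimately show "p (int n) (LV m v) = 0" using V_C[OF v] by (simp add: LV_def)
qed

text \<open>On the vacuum this is the definition of \<open>LV\<close>. Equal commutators of
  \<open>L m\<close> and \<open>ext_L m\<close> with the \<psi>'s carry the identity from
  \<open>u\<close> to \<open>ext_psi r u\<close>.\<close>

lemma mu_L: assumes v: "v \<in> V" shows "L m (mu u v) = mu (ext_L m u) v + mu u (LV m v)"
proof (induction u rule: ext_induct)
  case one
  show ?case by (simp add: mu_vac LV_def)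
next
  case (creation r u)
  have vC: "v \<in> C" "LV m v \<in> C" using V_C v LV_V by auto
  show ?case
    unfolding mu_psi[OF v] mu_psi[OF LV_V[OF v]] Lp[OF mu_C[OF vC(1)]] creation ext_L_psi' mu_left
    using vC by (simp add: add.commute add.left_commute)
qed (use V_C[OF v] V_C[OF LV_V[OF v]] in \<open>simp_all add: ext_L_simps mu_left mu_right scale_right_distrib\<close>)

text \<open>When \<open>L m (L n v)\<close> is expanded, the sum of the mixed terms is symmetric in
  \<open>m\<close> and \<open>n\<close> and cancels in the commutator. What is left is the
  difference of the relations for \<open>L\<close> and \<open>ext_L\<close>, hence the central
  charge \<open>k - 1 / 2\<close>.\<close>

lemma LV_LV: assumes v: "v \<in> V"
  shows "LV m (LV n v) - LV n (LV m v) =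
    s (of_int (m - n)) (LV (m + n) v) + (if m = - n then s ((of_int m ^ 3 - of_int m) / 12 * (k - 1 / 2)) v else 0)"
proof -
  have vC: "v \<in> C" using v V_C by blast
  have Lv: "L n v = mu (ext_L n vac) v + LV n v" for n by (simp add: LV_def)
  have LL': "L m (L n v) = mu (ext_L m (ext_L n vac)) v + mu (ext_L n vac) (LV m v)
      + mu (ext_L m vac) (LV n v) + LV m (LV n v)" for m n
  proof -
    have "L m (L n v) = L m (mu (ext_L n vac) v) + L m (mu vac (LV n v))"
      using vC V_C[OF LV_V[OF v]] by (simp add: Lv[of n] mu_vac)
    then show ?thesis unfolding mu_L[OF v] mu_L[OF LV_V[OF v]] by (simp add: mu_vac)
  qed
  have "mu (ext_L m (ext_L n vac) - ext_L n (ext_L m vac)) v + (LV m (LV n v) - LV n (LV m v)) =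
      L m (L n v) - L n (L m v)"
    unfolding LL' mu_left by simp
  also have "\<dots> = s (of_int (m - n)) (mu (ext_L (m + n) vac) v) + s (of_int (m - n)) (LV (m + n) v)
      + (if m = - n then s ((of_int m ^ 3 - of_int m) / 12 * k) v else 0)"
    unfolding LL[OF vC, of m n] Lv[of "m + n"] by (simp add: scale_right_distrib)
  finally have *: "LV m (LV n v) - LV n (LV m v) = s (of_int (m - n)) (LV (m + n) v)
      + (if m = - n then s ((of_int m ^ 3 - of_int m) / 12 * k) v else 0)
      - (if m = - n then s ((of_int m ^ 3 - of_int m) / 24) v else 0)"
    unfolding ext_Vir_vac mu_left by (simp add: mu_left algebra_simps split: if_splits)
  have e: "(of_int m ^ 3 - of_int m) / 12 * (k - 1 / 2) =
      (of_int m ^ 3 - of_int m) / 12 * k - (of_int m ^ 3 - of_int m) / (24 :: complex)"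
    by (simp add: right_diff_distrib)
  show ?thesis unfolding * e scale_left_diff_distrib by simp
qed

definition gens :: "'a set" where "gens = {mu u v |u v. v \<in> V}"

lemma gens_C: "gens \<subseteq> C" by (auto simp: gens_def V_C)

lemma gens_p: "v \<in> span gens \<Longrightarrow> p r v \<in> span gens"
proof (rule lin_on_span_subset[OF p_lin C_sub gens_C subspace_span])
  fix g assume "g \<in> gens"
  then obtain u v where "g = mu u v" "v \<in> V" by (auto simp: gens_def)
  then have "p r g = mu (ext_psi r u) v" by (simp add: mu_psi)
  then show "p r g \<in> span gens" using \<open>v \<in> V\<close> by (auto simp: gens_def intro: span_base)
qed

lemma C_smooth: assumes "v \<in> C" shows "\<exists>M::nat. \<forall>n\<ge>M. p (int n) v = 0"
proof -
  obtain u q where u: "u \<in> H q" "u \<noteq> 0" "\<forall>n::nat. p (int n) u = 0" using vacuum by blast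
  have "\<forall>r\<ge>0. p (1 * r) u = 0" using u(3) zero_le_imp_eq_int by force
  then obtain M where M: "\<forall>r\<ge>M. p (1 * r) v = 0"
    using finite_action_all[of 1 u v] u(1,2) H_C assms by blast
  have "p (int n) v = 0" if "n \<ge> nat M" for n
  proof -
    have "int n \<ge> M" using that by linarith
    then show ?thesis using M by simp
  qed
  then show ?thesis by blast
qed

text \<open>The modes are removed from the top:
  \<open>w = p M (p (- M - 1) w) + p (- M - 1) (p M w)\<close>, and if all modes above
  \<open>M\<close> kill \<open>w\<close>, then all modes from \<open>M\<close> on kill both
  \<open>p M (p (- M - 1) w)\<close> and \<open>p M w\<close>.\<close>

lemma C_gens: "C = span gens"
proof
  show "span gens \<subseteq> C" by (rule span_minimal[OF gens_C C_sub])
  have *: "w \<in> span gens" if "w \<in> C" "\<forall>n\<ge>M. p (int n) w = 0" for M :: nat and w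
    using that
  proof (induction M arbitrary: w)
    case 0
    then have "w \<in> V" by (simp add: V_def)
    then have "mu vac w \<in> gens" by (auto simp: gens_def)
    then show ?case by (simp add: mu_vac span_base)
  next
    case (Suc M)
    define x where "x = p (int M) (p (- int M - 1) w)"
    define y where "y = p (int M) w"
    have C': "x \<in> C" "y \<in> C" using Suc by (simp_all add: x_def y_def)
    have "p (int n) x = 0" if "n \<ge> M" for n
    proof (cases "n = M")
      case True
      then show ?thesis using p_sq[of "p (- int M - 1) w"] Suc by (simp add: x_def)
    next
      case False
      then show ?thesis
        using that Suc pp[of "p (- int M - 1) w" "int n" "int M"] pp[of w "int n" "- int M - 1"] by (simp add: x_def)
    qed
    then have "x \<in> span gens" using Suc.IH C' by blast
    moreover have "p (int n) y = 0" if "n \<ge> M" for n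
    proof (cases "n = M")
      case True
      then show ?thesis using p_sq[of w] Suc by (simp add: y_def)
    next
      case False
      then show ?thesis using that Suc pp[of w "int n" "int M"] by (simp add: y_def)
    qed
    then have "y \<in> span gens" using Suc.IH C' by blast
    moreover have "w = x + p (- int M - 1) y" using pp[of w "int M" "- int M - 1"] Suc by (simp add: x_def y_def)
    ultimately show ?case by (auto intro: span_add gens_p)
  qed
  show "C \<subseteq> span gens" using * C_smooth by blast
qed

text \<open>Applying \<open>p n\<close> to a vanishing sum removes the terms without
  \<open>n\<close> and shortens the others by one factor, so induction on the largest cardinality
  kills all \<open>f S\<close> with nonempty \<open>S\<close>. The term of the empty set is then
  alone.\<close>

lemma cr_unique:
  assumes "finite A" "\<And>S. S \<in> A \<Longrightarrow> f S \<in> V" "(\<Sum>S\<in>A. cr S (f S)) = 0" "S \<in> A"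
  shows "f S = 0"
proof -
  have "\<forall>A f. finite A \<longrightarrow> (\<forall>S\<in>A. fcard S \<le> m) \<longrightarrow> (\<forall>S\<in>A. f S \<in> V) \<longrightarrow> (\<Sum>S\<in>A. cr S (f S)) = 0 \<longrightarrow> (\<forall>S\<in>A. f S = 0)" for m
  proof (induction m)
    case 0
    show ?case
    proof (intro allI impI ballI)
      fix A :: "nat fset set" and f S assume a: "finite A" "\<forall>S\<in>A. fcard S \<le> 0" "(\<Sum>S\<in>A. cr S (f S)) = 0" "S \<in> A"
      then have "A = {{||}}" by (auto simp: fcard_0_eq)
      then show "f S = 0" using a by simp
    qed
  next
    case (Suc m)
    show ?case
    proof (intro allI impI)
      fix A :: "nat fset set" and f
      assume a: "finite A" "\<forall>S\<in>A. fcard S \<le> Suc m" "\<forall>S\<in>A. f S \<in> V" "(\<Sum>S\<in>A. cr S (f S)) = 0"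
      have ne: "f S = 0" if S: "S \<in> A" "n |\<in>| S" for S n
      proof -
        define An where "An = {S \<in> A. n |\<in>| S}"
        define g where "g T = s (sgn_below n T) (f (finsert n T))" for T
        have inj: "inj_on (\<lambda>S. S |-| {|n|}) An"
          by (rule inj_on_inverseI[of _ "finsert n"]) (auto simp: An_def)
        have act: "p (int n) (cr S (f S)) = (if n |\<in>| S then s (sgn_below n S) (cr (S |-| {|n|}) (f S)) else 0)" if "S \<in> A" for S
          using mu_psi[of "f S" "int n" "unit_vec S"] a(3) that by (simp add: mu_left ext_psi_unit mu_left(3,4) split: if_splits)
        have "0 = p (int n) (\<Sum>S\<in>A. cr S (f S))" using a by simp
        also have "\<dots> = (\<Sum>S\<in>A. if n |\<in>| S then s (sgn_below n S) (cr (S |-| {|n|}) (f S)) else 0)"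
          using a(3) V_C by (subst p_sum) (auto intro!: sum.cong simp: act)
        also have "\<dots> = (\<Sum>S\<in>An. s (sgn_below n S) (cr (S |-| {|n|}) (f S)))"
          unfolding An_def using a(1) by (simp add: sum.inter_filter)
        also have "\<dots> = (\<Sum>T\<in>(\<lambda>S. S |-| {|n|}) ` An. cr T (g T))"
          unfolding sum.reindex[OF inj]
        proof (rule sum.cong[OF refl])
          fix S assume "S \<in> An"
          then have S: "finsert n (S |-| {|n|}) = S" "n |\<in>| S" "f S \<in> C" using a(3) V_C by (auto simp: An_def)
          then show "s (sgn_below n S) (cr (S |-| {|n|}) (f S)) = ((\<lambda>T. cr T (g T)) \<circ> (\<lambda>S. S |-| {|n|})) S"
            by (simp add: g_def sgn_below_fminus lin_onD[OF cr_lin])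
        qed
        finally have z: "(\<Sum>T\<in>(\<lambda>S. S |-| {|n|}) ` An. cr T (g T)) = 0" by simp
        have "\<forall>T\<in>(\<lambda>S. S |-| {|n|}) ` An. g T = 0"
        proof (rule Suc.IH[rule_format, of _ g, THEN ballI])
          show "finite ((\<lambda>S. S |-| {|n|}) ` An)" using a(1) by (simp add: An_def)
          fix T assume "T \<in> (\<lambda>S. S |-| {|n|}) ` An"
          then obtain S where S: "T = S |-| {|n|}" "S \<in> A" "n |\<in>| S" by (auto simp: An_def)
          then have i: "finsert n T = S" "n |\<notin>| T" by auto
          then have "fcard S = Suc (fcard T)" using fcard_finsert_disjoint by metis
          then show "fcard T \<le> m" using a(2) S by auto
          show "g T \<in> V" unfolding g_def using i S a(3) by (auto intro: subspace_scale[OF V_sub])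
        qed (use z in auto)
        moreover have "S |-| {|n|} \<in> (\<lambda>S. S |-| {|n|}) ` An" "finsert n (S |-| {|n|}) = S" using S by (auto simp: An_def)
        ultimately have "s (sgn_below n (S |-| {|n|})) (f S) = 0" by (metis g_def)
        then show ?thesis by (simp add: sgn_below_def)
      qed
      show "\<forall>S\<in>A. f S = 0"
      proof
        fix S assume S: "S \<in> A"
        show "f S = 0"
        proof (cases "S = {||}")
          case True
          have "f T = 0" if "T \<in> A - {{||}}" for T
          proof -
            have "T \<noteq> {||}" "T \<in> A" using that by auto
            then obtain n where "n |\<in>| T" by auto
            then show ?thesis using ne \<open>T \<in> A\<close> by blast
          qed
          then have "(\<Sum>T\<in>A. cr T (f T)) = (\<Sum>T\<in>{{||}}. cr T (f T))"
            using a(1) S True lin_on_0[OF cr_lin C_sub] by (intro sum.mono_neutral_right) auto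
          then show ?thesis using a(4) True by simp
        next
          case False
          then show ?thesis using ne[OF S] by auto
        qed
      qed
    qed
  qed
  moreover have "\<forall>S\<in>A. fcard S \<le> Max (fcard ` A)" using assms(1) by auto
  ultimately show ?thesis using assms by blast
qed

section \<open>Coordinates with respect to the creation monomials\<close>

definition is_coef :: "(nat fset \<Rightarrow> 'a) \<Rightarrow> 'a \<Rightarrow> bool" where
  "is_coef f w \<longleftrightarrow> (\<forall>S. f S \<in> V) \<and> finite {S. f S \<noteq> 0} \<and> w = (\<Sum>S\<in>{S. f S \<noteq> 0}. cr S (f S))"

lemma is_coef_superset:
  assumes "is_coef f w" "finite A" "{S. f S \<noteq> 0} \<subseteq> A" shows "w = (\<Sum>S\<in>A. cr S (f S))"
proof -
  have "(\<Sum>S\<in>{S. f S \<noteq> 0}. cr S (f S)) = (\<Sum>S\<in>A. cr S (f S))"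
    by (rule sum.mono_neutral_left) (use assms lin_on_0[OF cr_lin C_sub] in auto)
  then show ?thesis using assms by (simp add: is_coef_def)
qed

lemma is_coef_add: assumes "is_coef f w" "is_coef g w'" shows "is_coef (\<lambda>S. f S + g S) (w + w')"
proof -
  let ?A = "{S. f S \<noteq> 0} \<union> {S. g S \<noteq> 0}"
  have fA: "finite ?A" using assms by (auto simp: is_coef_def)
  have V: "f S \<in> V" "g S \<in> V" for S using assms by (auto simp: is_coef_def)
  have sub: "{S. f S + g S \<noteq> 0} \<subseteq> ?A" by auto
  have "w + w' = (\<Sum>S\<in>?A. cr S (f S)) + (\<Sum>S\<in>?A. cr S (g S))"
    using is_coef_superset[OF assms(1) fA] is_coef_superset[OF assms(2) fA] by simp
  also have "\<dots> = (\<Sum>S\<in>?A. cr S (f S + g S))"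
    using V V_C by (simp add: sum.distrib lin_onD[OF cr_lin])
  also have "\<dots> = (\<Sum>S\<in>{S. f S + g S \<noteq> 0}. cr S (f S + g S))"
    by (rule sum.mono_neutral_right) (use fA sub lin_on_0[OF cr_lin C_sub] in auto)
  finally show ?thesis using V finite_subset[OF sub fA] by (simp add: is_coef_def subspace_add[OF V_sub])
qed

lemma is_coef_scale: assumes "is_coef f w" shows "is_coef (\<lambda>S. s a (f S)) (s a w)"
proof -
  have V: "f S \<in> V" for S using assms by (auto simp: is_coef_def)
  have fA: "finite {S. f S \<noteq> 0}" using assms by (auto simp: is_coef_def)
  have sub: "{S. s a (f S) \<noteq> 0} \<subseteq> {S. f S \<noteq> 0}" by auto
  have "s a w = (\<Sum>S\<in>{S. f S \<noteq> 0}. cr S (s a (f S)))"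
    using is_coef_superset[OF assms fA] V V_C by (simp add: scale_sum_right lin_onD[OF cr_lin])
  also have "\<dots> = (\<Sum>S\<in>{S. s a (f S) \<noteq> 0}. cr S (s a (f S)))"
    by (rule sum.mono_neutral_right) (use fA sub lin_on_0[OF cr_lin C_sub] in auto)
  finally show ?thesis using V finite_subset[OF sub fA] by (simp add: is_coef_def subspace_scale[OF V_sub])
qed

lemma is_coef_mu: assumes v: "v \<in> V" shows "is_coef (\<lambda>S. s (Poly_Mapping.lookup u S) v) (mu u v)"
proof (cases "v = 0")
  case True
  then show ?thesis using subspace_0[OF V_sub] by (simp add: is_coef_def mu_right)
next
  case False
  then have "{S. s (Poly_Mapping.lookup u S) v \<noteq> 0} = Poly_Mapping.keys u" by (auto simp: in_keys_iff)
  then show ?thesis using v V_C[OF v]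
    by (simp add: is_coef_def mu_def lin_extend_def lin_onD[OF cr_lin] subspace_scale[OF V_sub])
qed

lemma is_coef_unique: assumes "is_coef f w" "is_coef g w" shows "f = g"
proof
  fix S
  have d: "is_coef (\<lambda>S. f S + s (- 1) (g S)) (w + s (- 1) w)"
    by (rule is_coef_add[OF assms(1) is_coef_scale[OF assms(2)]])
  let ?h = "\<lambda>S. f S + s (- 1) (g S)"
  show "f S = g S"
  proof (cases "?h S = 0")
    case False
    have "?h S = 0"
      by (rule cr_unique[of "{S. ?h S \<noteq> 0}" ?h]) (use d False in \<open>auto simp: is_coef_def\<close>)
    then show ?thesis by simp
  qed simp
qed

lemma ex_coef: assumes "w \<in> C" shows "\<exists>f. is_coef f w"
proof -
  have "w \<in> span gens" using assms C_gens by simp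
  then show ?thesis
  proof (induction rule: span_induct_alt)
    case base
    then show ?case using subspace_0[OF V_sub] by (intro exI[of _ "\<lambda>_. 0"]) (simp add: is_coef_def)
  next
    case (step c x y)
    then show ?case using is_coef_add is_coef_scale is_coef_mu unfolding gens_def by blast
  qed
qed

definition coef :: "'a \<Rightarrow> nat fset \<Rightarrow> 'a" where "coef w = (THE f. is_coef f w)"

lemma coef_eq: "is_coef f w \<Longrightarrow> coef w = f"
  unfolding coef_def using is_coef_unique by (intro the_equality) auto

lemma is_coef_coef: "w \<in> C \<Longrightarrow> is_coef (coef w) w"
  using ex_coef coef_eq by metis

lemma coef_add: "w \<in> C \<Longrightarrow> w' \<in> C \<Longrightarrow> coef (w + w') = (\<lambda>S. coef w S + coef w' S)"
  by (intro coef_eq is_coef_add is_coef_coef)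

lemma coef_scale: "w \<in> C \<Longrightarrow> coef (s a w) = (\<lambda>S. s a (coef w S))"
  by (intro coef_eq is_coef_scale is_coef_coef)

lemma coef_mu: "v \<in> V \<Longrightarrow> coef (mu u v) = (\<lambda>S. s (Poly_Mapping.lookup u S) v)"
  by (intro coef_eq is_coef_mu)

lemma coef_V: "w \<in> C \<Longrightarrow> coef w S \<in> V"
  using is_coef_coef by (auto simp: is_coef_def)

lemma coef_fin: "w \<in> C \<Longrightarrow> finite {S. coef w S \<noteq> 0}"
  using is_coef_coef by (auto simp: is_coef_def)

lemma coef_inj: assumes "w \<in> C" "\<And>S. coef w S = 0" shows "w = 0"
  using is_coef_coef[OF assms(1)] assms(2) by (simp add: is_coef_def)

end

section \<open>Isomorphism with the tensor product\<close>

context fvmod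
begin

definition gact :: "gen \<Rightarrow> 'a \<Rightarrow> 'a" where
  "gact g v = (case g of GenL m \<Rightarrow> L m v | GenPsi r \<Rightarrow> P r v | GenC \<Rightarrow> s k v | GenZ \<Rightarrow> s \<zeta> v)"

definition lact :: "fvir \<Rightarrow> 'a \<Rightarrow> 'a" where "lact x v = lin_extend s (\<lambda>g. gact g v) x"

lemma gact_lin: "lin_on C (gact g)"
  unfolding gact_def by (cases g) (simp_all add: L_lin P_lin lin_on_const C_sub)

lemma lact_left: "lact (x + y) v = lact x v + lact y v" "lact (pscale a x) v = s a (lact x v)"
  "lact (unit_vec g) v = gact g v"
  by (simp_all add: lact_def lin_extend_add lin_extend_pscale)

lemma lact_lin: "lin_on C (lact x)"
  unfolding lin_on_def lact_def lin_extend_def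
  by (auto simp: lin_onD[OF gact_lin] scale_right_distrib sum.distrib scale_sum_right mult.commute)

end

interpretation fs: cspace "fscale :: complex \<Rightarrow> ('k \<Rightarrow> complex) \<Rightarrow> _"
  by (simp add: cspace_def vector_space_fscale)

definition vir_part :: "fvir \<Rightarrow> fvir" where
  "vir_part = lin_extend pscale (\<lambda>g. case g of
       GenL k \<Rightarrow> unit_vec (GenL k)
     | GenPsi r \<Rightarrow> 0
     | GenC \<Rightarrow> unit_vec GenC
     | GenZ \<Rightarrow> 0)"

lemma inflate_simps [simp]: "scal (inflate M) = scal M" "part (inflate M) = part M"
  "act (inflate M) x = act M (vir_part x)" "carr (inflate M) = carr M"
  by (simp_all add: inflate_def carr_def vir_part_def)

lemma twist_simps [simp]: "scal (twist l M) = scal M" "part (twist l M) = part M"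
  "act (twist l M) x = act M (sigma l x)" "carr (twist l M) = carr M"
  by (simp_all add: twist_def carr_def)

lemma carr_hsum: "carr M = hsum (part M)"
  by (simp add: carr_def hsum_def)

lemma ext_module_simps: "scal ext_module = pscale" "part ext_module = epart" "carr ext_module = UNIV"
proof -
  show "scal ext_module = pscale" "part ext_module = epart"
    by (auto simp: ext_module_def epart_def)
  then have c: "carr ext_module = {a + b |a b. a \<in> epart False \<and> b \<in> epart True}" by (simp add: carr_def)
  have "u \<in> carr ext_module" for u
  proof (induction u rule: poly_mapping_add_induct)
    case (single S v)
    have "Poly_Mapping.single S v \<in> epart (odd (fcard S))"
      unfolding single_pscale[of S v] by (rule ps.subspace_scale[OF epart_sub epart_unit])
    moreover have "0 \<in> epart q" for q by (rule ps.subspace_0[OF epart_sub])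
    ultimately show ?case unfolding c by (cases "odd (fcard S)") force+
  next
    case (sum f g)
    then obtain a b a' b' where ab: "f = a + b" "g = a' + b'" "a \<in> epart False" "b \<in> epart True" "a' \<in> epart False" "b' \<in> epart True"
      unfolding c by blast
    have "f + g = (a + a') + (b + b')" using ab by simp
    moreover have "a + a' \<in> epart False" "b + b' \<in> epart True" using ab ps.subspace_add[OF epart_sub] by auto
    ultimately show ?case unfolding c by blast
  qed
  then show "carr ext_module = UNIV" by blast
qed

definition eact :: "complex \<Rightarrow> fvir \<Rightarrow> ext \<Rightarrow> ext" where
  "eact l x a = lin_extend pscale (\<lambda>g. case g of
      GenL m \<Rightarrow> ext_L m a | GenPsi r \<Rightarrow> pscale l (ext_psi r a) | GenC \<Rightarrow> pscale (1 / 2) a | GenZ \<Rightarrow> pscale (l\<^sup>2) a) x"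

lemma act_twist_ext: "act ext_module (sigma l x) a = eact l x a"
proof (rule poly_mapping_lin_eqI[where s = pscale and f = "\<lambda>x. act ext_module (sigma l x) a" and g = "\<lambda>x. eact l x a"])
  fix g
  show "act ext_module (sigma l (unit_vec g)) a = eact l (unit_vec g) a"
    by (cases g) (simp_all add: ext_module_def sigma_def eact_def)
qed (simp_all add: ext_module_def sigma_def eact_def ps.lin_extend_add ps.lin_extend_pscale ps.cspace_axioms)

lemma eact_right: "eact l x (a + b) = eact l x a + eact l x b" "eact l x (pscale c a) = pscale c (eact l x a)"
proof -
  let ?f = "\<lambda>a g. (case g of
      GenL m \<Rightarrow> ext_L m a | GenPsi r \<Rightarrow> pscale l (ext_psi r a) | GenC \<Rightarrow> pscale (1 / 2) a | GenZ \<Rightarrow> pscale (l\<^sup>2) a)"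
  have "?f (a + b) g = ?f a g + ?f b g" for g
    by (cases g) (simp_all add: ext_L_simps ext_psi_simps ps.scale_right_distrib)
  then show "eact l x (a + b) = eact l x a + eact l x b"
    by (simp add: eact_def lin_extend_def ps.scale_right_distrib sum.distrib)
  have "?f (pscale c a) g = pscale c (?f a g)" for g
    by (cases g) (simp_all add: ext_L_simps ext_psi_simps mult.commute)
  then show "eact l x (pscale c a) = pscale c (eact l x a)"
    by (simp add: eact_def lin_extend_def ps.scale_sum_right mult.commute)
qed

lemma eact_left: "eact l (x + y) a = eact l x a + eact l y a" "eact l (pscale c x) a = pscale c (eact l x a)"
  by (simp_all add: eact_def ps.lin_extend_add ps.lin_extend_pscale)

lemma fvir_proj_lin: "fvir_proj p (x + y) = fvir_proj p x + fvir_proj p y" "fvir_proj p (pscale a x) = pscale a (fvir_proj p x)"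
  by (simp_all add: fvir_proj_def ps.lin_extend_add ps.lin_extend_pscale)

lemma vir_part_lin: "vir_part (x + y) = vir_part x + vir_part y" "vir_part (pscale a x) = pscale a (vir_part x)"
  by (simp_all add: vir_part_def ps.lin_extend_add ps.lin_extend_pscale)

context fock
begin

text \<open>The exterior factor contributes \<open>1 / 2\<close> to the central charge, so
  \<open>c\<close> acts by the rest, \<open>k - 1 / 2\<close>.\<close>

definition vact :: "fvir \<Rightarrow> 'a \<Rightarrow> 'a" where
  "vact x v = lin_extend s (\<lambda>g. case g of
     GenL m \<Rightarrow> LV m v | GenPsi r \<Rightarrow> 0 | GenC \<Rightarrow> s (k - 1 / 2) v | GenZ \<Rightarrow> 0) x"

definition VM :: "'a smod" where "VM = \<lparr>scal = s, part = (\<lambda>q. V \<inter> H q), act = vact\<rparr>"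

abbreviation EM :: "ext smod" where "EM \<equiv> twist l ext_module"

abbreviation TM where "TM \<equiv> tensor EM (inflate VM)"

lemma VM_simps [simp]: "scal VM = s" "part VM q = V \<inter> H q" "act VM = vact" "carr VM = V"
proof -
  show "scal VM = s" "part VM q = V \<inter> H q" "act VM = vact" by (simp_all add: VM_def)
  show "carr VM = V"
  proof
    show "carr VM \<subseteq> V" using subspace_add[OF V_sub] by (auto simp: carr_def VM_def)
    show "V \<subseteq> carr VM" using V_graded by (fastforce simp: carr_def VM_def graded_def)
  qed
qed

lemma vact_left: "vact (x + y) v = vact x v + vact y v" "vact (pscale a x) v = s a (vact x v)" "vact 0 v = 0"
  by (simp_all add: vact_def lin_extend_add lin_extend_pscale)

lemma vact_lin: "lin_on V (vact x)"
  unfolding lin_on_def vact_def lin_extend_def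
proof (intro conjI ballI allI)
  let ?f = "\<lambda>v g. (case g of GenL m \<Rightarrow> LV m v | GenPsi r \<Rightarrow> 0 | GenC \<Rightarrow> s (k - 1 / 2) v | GenZ \<Rightarrow> 0)"
  have 1: "?f v g \<in> V" if "v \<in> V" for v g
    using that LV_V V_sub by (auto split: gen.splits intro: subspace_scale subspace_0)
  show "(\<Sum>g\<in>Poly_Mapping.keys x. s (Poly_Mapping.lookup x g) (?f v g)) \<in> V" if "v \<in> V" for v
    using 1[OF that] by (intro subspace_sum[OF V_sub] subspace_scale[OF V_sub]) auto
  have 2: "?f (v + w) g = ?f v g + ?f w g" if "v \<in> V" "w \<in> V" for v w g
    using that V_C by (auto split: gen.splits simp: lin_onD[OF LV_lin] scale_right_distrib)
  show "(\<Sum>g\<in>Poly_Mapping.keys x. s (Poly_Mapping.lookup x g) (?f (v + w) g)) =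
     (\<Sum>g\<in>Poly_Mapping.keys x. s (Poly_Mapping.lookup x g) (?f v g)) + (\<Sum>g\<in>Poly_Mapping.keys x. s (Poly_Mapping.lookup x g) (?f w g))"
    if "v \<in> V" "w \<in> V" for v w using 2[OF that] by (simp add: scale_right_distrib sum.distrib)
  have 3: "?f (s a v) g = s a (?f v g)" if "v \<in> V" for v a g
    using that V_C by (auto split: gen.splits simp: lin_onD[OF LV_lin] mult.commute)
  show "(\<Sum>g\<in>Poly_Mapping.keys x. s (Poly_Mapping.lookup x g) (?f (s a v) g)) =
     s a (\<Sum>g\<in>Poly_Mapping.keys x. s (Poly_Mapping.lookup x g) (?f v g))"
    if "v \<in> V" for v a using 3[OF that] by (simp add: scale_sum_right mult.commute)
qed

lemma vact_vir_part: "vact (vir_part x) v = vact x v"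
proof (rule poly_mapping_lin_eqI[where s = s and f = "\<lambda>x. vact (vir_part x) v" and g = "\<lambda>x. vact x v"])
  show "vact (vir_part (unit_vec g)) v = vact (unit_vec g) v" for g
    by (cases g) (simp_all add: vir_part_def vact_def)
qed (simp_all add: vact_left vir_part_lin cspace_axioms)

lemma vact_proj: "vact (fvir_proj False x) v = vact x v" "vact (fvir_proj True x) v = 0"
proof -
  show "vact (fvir_proj False x) v = vact x v"
  proof (rule poly_mapping_lin_eqI[where s = s and f = "\<lambda>x. vact (fvir_proj False x) v" and g = "\<lambda>x. vact x v"])
    show "vact (fvir_proj False (unit_vec g)) v = vact (unit_vec g) v" for g
      by (cases g) (simp_all add: vact_def fvir_proj_def)
  qed (simp_all add: vact_left fvir_proj_lin cspace_axioms)
  show "vact (fvir_proj True x) v = 0"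
  proof (rule poly_mapping_lin_eqI[where s = s and f = "\<lambda>x. vact (fvir_proj True x) v" and g = "\<lambda>x. 0"])
    show "vact (fvir_proj True (unit_vec g)) v = 0" for g
      by (cases g) (simp_all add: vact_def fvir_proj_def)
  qed (simp_all add: vact_left fvir_proj_lin cspace_axioms)
qed

abbreviation bil :: "(ext \<Rightarrow> 'a \<Rightarrow> complex) \<Rightarrow> bool" where "bil \<equiv> bilinear_on EM (inflate VM)"

abbreviation pure :: "ext \<Rightarrow> 'a \<Rightarrow> (ext \<Rightarrow> 'a \<Rightarrow> complex) \<Rightarrow> complex" where "pure \<equiv> pure_tensor EM (inflate VM)"

lemma bil_iff: "bil \<beta> \<longleftrightarrow>
    (\<forall>a a'. \<forall>b\<in>V. \<beta> (a + a') b = \<beta> a b + \<beta> a' b) \<and>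
    (\<forall>a. \<forall>b\<in>V. \<forall>b'\<in>V. \<beta> a (b + b') = \<beta> a b + \<beta> a b') \<and>
    (\<forall>a. \<forall>b\<in>V. \<forall>c. \<beta> (pscale c a) b = c * \<beta> a b \<and> \<beta> a (s c b) = c * \<beta> a b)"
  by (simp add: bilinear_on_def ext_module_simps)

lemma bilD:
  assumes "bil \<beta>" "b \<in> V"
  shows "\<beta> (a + a') b = \<beta> a b + \<beta> a' b" "b' \<in> V \<Longrightarrow> \<beta> a (b + b') = \<beta> a b + \<beta> a b'"
    "\<beta> (pscale c a) b = c * \<beta> a b" "\<beta> a (s c b) = c * \<beta> a b" "\<beta> a 0 = 0"
proof -
  show "\<beta> (a + a') b = \<beta> a b + \<beta> a' b" "b' \<in> V \<Longrightarrow> \<beta> a (b + b') = \<beta> a b + \<beta> a b'"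
    "\<beta> (pscale c a) b = c * \<beta> a b" and *: "\<beta> a (s c b) = c * \<beta> a b" for c
    using assms unfolding bil_iff by blast+
  show "\<beta> a 0 = 0" using *[of 0] by simp
qed

lemma pure_lin:
  "b \<in> V \<Longrightarrow> pure (a + a') b = pure a b + pure a' b"
  "b \<in> V \<Longrightarrow> b' \<in> V \<Longrightarrow> pure a (b + b') = pure a b + pure a b'"
  "b \<in> V \<Longrightarrow> pure (pscale c a) b = fscale c (pure a b)"
  "b \<in> V \<Longrightarrow> pure a (s c b) = fscale c (pure a b)"
  "pure a 0 = 0"
  using bilD(5)[OF _ subspace_0[OF V_sub]]
  by (auto simp: pure_tensor_def fun_eq_iff fscale_def bilD)

definition tw :: "fvir \<Rightarrow> (ext \<Rightarrow> 'a \<Rightarrow> complex) \<Rightarrow> ext \<Rightarrow> 'a \<Rightarrow> complex" where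
  "tw x \<beta> = (\<lambda>a b. \<beta> (act EM x a) b + \<beta> a (act (inflate VM) (fvir_proj False x) b)
     + \<beta> (parity_inv EM a) (act (inflate VM) (fvir_proj True x) b))"

text \<open>The term with the parity involution drops out because odd elements act as zero on the
  inflated module.\<close>

lemma tw_eq: "bil \<beta> \<Longrightarrow> b \<in> V \<Longrightarrow> tw x \<beta> a b = \<beta> (eact l x a) b + \<beta> a (vact x b)"
  by (simp add: tw_def act_twist_ext vact_vir_part vact_proj bilD)

lemma bil_tw: assumes "bil \<beta>" shows "bil (tw x \<beta>)"
  unfolding bil_iff
  using assms
  by (auto simp: tw_eq eact_right bilD subspace_add[OF V_sub] subspace_scale[OF V_sub] lin_onD[OF vact_lin] algebra_simps)

lemma act_TM: "act TM x t = (\<lambda>\<beta>. if bil \<beta> then t (tw x \<beta>) else 0)"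
  unfolding tensor_def tw_def by simp

lemma act_TM_lin: "act TM x (t + t') = act TM x t + act TM x t'" "act TM x (fscale c t) = fscale c (act TM x t)"
  by (auto simp: act_TM fscale_def)

lemma act_pure: "v \<in> V \<Longrightarrow> act TM x (pure u v) = pure (eact l x u) v + pure u (vact x v)"
  unfolding act_TM by (auto simp: pure_tensor_def bil_tw tw_eq fun_eq_iff)

text \<open>Inverse to \<open>mu\<close>, see \<open>phi_mu\<close>. It starts from the module,
  where coordinates are unique; a map out of the span of evaluations would first have to be shown
  well defined.\<close>

definition phi :: "'a \<Rightarrow> (ext \<Rightarrow> 'a \<Rightarrow> complex) \<Rightarrow> complex" where
  "phi w = (\<Sum>S\<in>{S. coef w S \<noteq> 0}. pure (unit_vec S) (coef w S))"

lemma phi_superset: "finite A \<Longrightarrow> {S. coef w S \<noteq> 0} \<subseteq> A \<Longrightarrow> phi w = (\<Sum>S\<in>A. pure (unit_vec S) (coef w S))"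
  unfolding phi_def by (rule sum.mono_neutral_left) (auto simp: pure_lin)

lemma phi_add: assumes "w \<in> C" "w' \<in> C" shows "phi (w + w') = phi w + phi w'"
proof -
  let ?A = "{S. coef w S \<noteq> 0} \<union> {S. coef w' S \<noteq> 0}"
  have A: "finite ?A" using assms by (simp add: coef_fin)
  have "phi (w + w') = (\<Sum>S\<in>?A. pure (unit_vec S) (coef (w + w') S))"
    by (rule phi_superset[OF A]) (auto simp: coef_add assms)
  also have "\<dots> = (\<Sum>S\<in>?A. pure (unit_vec S) (coef w S)) + (\<Sum>S\<in>?A. pure (unit_vec S) (coef w' S))"
    using assms coef_V by (simp add: coef_add pure_lin sum.distrib)
  also have "\<dots> = phi w + phi w'" using phi_superset[OF A] by simp
  finally show ?thesis .
qed

lemma phi_scale: assumes "w \<in> C" shows "phi (s c w) = fscale c (phi w)"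
proof -
  let ?A = "{S. coef w S \<noteq> 0}"
  have "phi (s c w) = (\<Sum>S\<in>?A. pure (unit_vec S) (coef (s c w) S))"
    by (rule phi_superset) (auto simp: coef_scale assms coef_fin)
  also have "\<dots> = fscale c (phi w)"
    using assms coef_V by (simp add: coef_scale pure_lin fs.scale_sum_right phi_def)
  finally show ?thesis .
qed

lemma pure_sum: "v \<in> V \<Longrightarrow> pure (\<Sum>i\<in>A. f i) v = (\<Sum>i\<in>A. pure (f i) v)"
proof (induction A rule: infinite_finite_induct)
  case (infinite A)
  then show ?case using pure_lin(3)[of v 0 0] by simp
next
  case empty
  then show ?case using pure_lin(3)[of v 0 0] by simp
qed (simp add: pure_lin)

lemma phi_mu: assumes "v \<in> V" shows "phi (mu u v) = pure u v"
proof -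
  have "phi (mu u v) = (\<Sum>S\<in>Poly_Mapping.keys u. pure (unit_vec S) (coef (mu u v) S))"
    by (rule phi_superset) (auto simp: coef_mu[OF assms] in_keys_iff)
  also have "\<dots> = pure (\<Sum>S\<in>Poly_Mapping.keys u. pscale (Poly_Mapping.lookup u S) (unit_vec S)) v"
    using assms by (simp add: coef_mu pure_lin pure_sum)
  also have "\<dots> = pure u v" by (simp flip: ext_sum_keys)
  finally show ?thesis .
qed

lemma lact_mu: assumes v: "v \<in> V" shows "lact x (mu u v) = mu (eact l x u) v + mu u (vact x v)"
proof (rule poly_mapping_lin_eqI[where s = s])
  have vC: "v \<in> C" "vact x v \<in> C" for x using v V_C lin_onD(1)[OF vact_lin] by auto
  show "lact (unit_vec g) (mu u v) = mu (eact l (unit_vec g) u) v + mu u (vact (unit_vec g) v)" for g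
  proof (cases g)
    case (GenL m)
    then show ?thesis by (simp add: lact_left gact_def mu_L[OF v] eact_def vact_def)
  next
    case (GenPsi r)
    then show ?thesis using vC by (simp add: lact_left gact_def P_p mu_psi[OF v] eact_def vact_def mu_left mu_right)
  next
    case GenC
    have "s k (mu u v) = s (1 / 2 + (k - 1 / 2)) (mu u v)" by simp
    then show ?thesis using vC GenC
      by (simp only: lact_left gact_def eact_def vact_def ps.lin_extend_single lin_extend_single gen.case scale_left_distrib)
         (simp add: mu_left mu_right)
  next
    case GenZ
    then show ?thesis using vC by (simp add: lact_left gact_def eact_def vact_def mu_left mu_right l2[symmetric])
  qed
qed (use v V_C lin_onD(1)[OF vact_lin] in \<open>simp_all add: lact_left vact_left eact_left mu_left mu_right cspace_axioms
      scale_right_distrib add.left_commute add.assoc\<close>)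

lemma phi_act: assumes "w \<in> C" shows "phi (lact x w) = act TM x (phi w)"
proof -
  have "w \<in> span gens" using assms C_gens by simp
  then have "w \<in> C \<and> phi (lact x w) = act TM x (phi w)"
  proof (induction rule: span_induct_alt)
    case base
    have "phi 0 = 0" "act TM x 0 = 0" using phi_scale[of 0 0] act_TM_lin(2)[of x 0 0] by simp_all
    then show ?case by (simp only: C_closed lin_on_0[OF lact_lin C_sub])
  next
    case (step c g y)
    then obtain u v where g: "g = mu u v" "v \<in> V" by (auto simp: gens_def)
    have C': "g \<in> C" "v \<in> C" "vact x v \<in> V" "vact x v \<in> C" "lact x g \<in> C" "lact x y \<in> C"
      using g V_C lin_onD(1)[OF vact_lin] lin_onD(1)[OF lact_lin] step by auto
    have "phi (lact x g) = act TM x (phi g)"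
      using C' g by (simp add: lact_mu phi_add phi_mu act_pure)
    moreover have y: "y \<in> C" "phi (lact x y) = act TM x (phi y)" using step by auto
    moreover have "lact x (s c g + y) = s c (lact x g) + lact x y" using C' y by (simp add: lin_onD[OF lact_lin])
    ultimately show ?case using C' by (simp only: phi_add phi_scale act_TM_lin C_closed)
  qed
  then show ?thesis by simp
qed

lemma crl_hom: "v \<in> H q \<Longrightarrow> crl xs v \<in> H (odd (length xs) \<noteq> q)"
proof (induction xs)
  case (Cons x xs)
  then show ?case using p_hom[of "crl xs v" "odd (length xs) \<noteq> q" "- int x - 1"] by (cases q) auto
qed simp

lemma cr_hom: "v \<in> H q \<Longrightarrow> cr S v \<in> H (odd (fcard S) \<noteq> q)"
  using crl_hom[of v q "sorted_list_of_fset S"] by (simp add: cr_def sorted_list_of_fset.rep_eq fcard.rep_eq)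

lemma mu_hom: assumes "u \<in> epart q" "v \<in> H r" shows "mu u v \<in> H (q \<noteq> r)"
proof -
  have "cr S v \<in> H (q \<noteq> r)" if "S \<in> Poly_Mapping.keys u" for S
  proof -
    have e: "odd (fcard S) = q" using assms(1) that by (simp add: epart_def)
    show ?thesis using cr_hom[OF assms(2), of S] unfolding e .
  qed
  then show ?thesis unfolding mu_def lin_extend_def
    by (intro subspace_sum[OF H_sub] subspace_scale[OF H_sub])
qed

lemma part_TM: "part TM q = fs.span {pure a b |a b q1 r. a \<in> epart q1 \<and> b \<in> V \<inter> H r \<and> (q1 \<noteq> r) = q}"
  by (simp add: tensor_def ext_module_simps)

text \<open>Products of homogeneous factors span \<open>C\<close>, and those of parity
  \<open>q\<close> lie in \<open>H q\<close>. The sum of the two parts is direct, so an even vector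
  is a combination of even products alone, and likewise for odd ones.\<close>

lemma H_gens: "H q \<subseteq> span {mu u v |u v q1 r. u \<in> epart q1 \<and> v \<in> V \<inter> H r \<and> (q1 \<noteq> r) = q}"
proof
  let ?G = "\<lambda>q. {mu u v |u v q1 r. u \<in> epart q1 \<and> v \<in> V \<inter> H r \<and> (q1 \<noteq> r) = q}"
  have GH: "span (?G q) \<subseteq> H q" for q
  proof (rule span_minimal[OF _ H_sub], rule subsetI)
    fix g assume "g \<in> ?G q"
    then obtain u v q1 r where g: "g = mu u v" "u \<in> epart q1" "v \<in> H r" "(q1 \<noteq> r) = q" by blast
    show "g \<in> H q" using mu_hom[OF g(2,3)] unfolding g(1) g(4) .
  qed
  have "gens \<subseteq> span (?G False \<union> ?G True)"
  proof
    fix g assume "g \<in> gens"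
    then obtain u v where g: "g = mu u v" "v \<in> V" by (auto simp: gens_def)
    obtain a b where ab: "a \<in> V \<inter> H False" "b \<in> V \<inter> H True" "v = a + b" using V_graded g unfolding graded_def by blast
    have "u \<in> carr ext_module" by (simp add: ext_module_simps)
    then obtain x y where xy: "x \<in> epart False" "y \<in> epart True" "u = x + y"
      by (auto simp: carr_def ext_module_simps(2))
    have abC: "a \<in> C" "b \<in> C" using ab V_C by auto
    have "g = mu x a + mu y b + (mu x b + mu y a)"
      using g xy ab abC by (simp add: mu_left mu_right)
    moreover have "mu x a \<in> ?G False" "mu y b \<in> ?G False" "mu x b \<in> ?G True" "mu y a \<in> ?G True"
      using xy ab by blast+
    ultimately show "g \<in> span (?G False \<union> ?G True)" by (simp add: span_add span_base)
  qed
  then have "C \<subseteq> span (?G False \<union> ?G True)" using C_gens span_minimal[OF _ subspace_span] by blast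
  then have C: "\<exists>x\<in>span (?G False). \<exists>y\<in>span (?G True). w = x + y" if "w \<in> C" for w
    using subsetD[OF \<open>C \<subseteq> _\<close> that] unfolding span_Un by blast
  fix w assume w: "w \<in> H q"
  then obtain x y where xy: "x \<in> span (?G False)" "y \<in> span (?G True)" "w = x + y" using C H_C by blast
  have z: "0 \<in> H False" "0 \<in> H True" using subspace_0[OF H_sub] by auto
  have "x \<in> H False" "y \<in> H True" using xy GH by blast+
  note xyH = this
  show "w \<in> span (?G q)"
  proof (cases q)
    case True
    then have q: "q = True" by simp
    have e: "x + y = 0 + w" using xy(3) by simp
    have "y = w" by (rule H_unique(2)[OF xyH(1) z(1) xyH(2) w[unfolded q] e])
    then show ?thesis using xy(2) unfolding q by metis
  next
    case False
    then have q: "q = False" by simp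
    have e: "x + y = w + 0" using xy(3) by simp
    have "x = w" by (rule H_unique(1)[OF xyH(1) w[unfolded q] xyH(2) z(2) e])
    then show ?thesis using xy(1) unfolding q by metis
  qed
qed

lemma phi_sum_part: "phi ` H q = part TM q"
proof
  let ?G = "{mu u v |u v q1 r. u \<in> epart q1 \<and> v \<in> V \<inter> H r \<and> (q1 \<noteq> r) = q}"
  have "w \<in> C \<and> phi w \<in> part TM q" if "w \<in> span ?G" for w
    using that
  proof (induction rule: span_induct_alt)
    case base
    have "phi 0 = 0" using phi_scale[of 0 0] by simp
    then show ?case by (simp only: part_TM fs.span_zero C_closed)
  next
    case (step c g y)
    then obtain u v q1 r where g: "g = mu u v" "u \<in> epart q1" "v \<in> V \<inter> H r" "(q1 \<noteq> r) = q" by blast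
    have "pure u v \<in> part TM q" unfolding part_TM using g by (intro fs.span_base) blast
    then have "phi g \<in> part TM q" "g \<in> C" using V_C g by (auto simp: phi_mu)
    moreover have "y \<in> C" "phi y \<in> part TM q" using step by auto
    ultimately show ?case
      by (simp only: phi_add phi_scale part_TM fs.span_add fs.span_scale C_closed simp_thms)
  qed
  then show "phi ` H q \<subseteq> part TM q" using H_gens by blast
  have "fs.subspace (phi ` H q)"
  proof (rule fs.subspaceI)
    show "0 \<in> phi ` H q" using phi_scale[of 0 0] subspace_0[OF H_sub] by (intro image_eqI[of _ _ 0]) auto
    fix t t' assume "t \<in> phi ` H q" "t' \<in> phi ` H q"
    then obtain w w' where "t = phi w" "t' = phi w'" "w \<in> H q" "w' \<in> H q" by blast
    then show "t + t' \<in> phi ` H q" using subspace_add[OF H_sub] by (intro image_eqI[of _ _ "w + w'"]) (auto simp: phi_add H_C)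
  next
    fix c t assume "t \<in> phi ` H q"
    then obtain w where "t = phi w" "w \<in> H q" by blast
    then show "fscale c t \<in> phi ` H q" using subspace_scale[OF H_sub] by (intro image_eqI[of _ _ "s c w"]) (auto simp: phi_scale H_C)
  qed
  moreover have "{pure a b |a b q1 r. a \<in> epart q1 \<and> b \<in> V \<inter> H r \<and> (q1 \<noteq> r) = q} \<subseteq> phi ` H q"
  proof
    fix t assume "t \<in> {pure a b |a b q1 r. a \<in> epart q1 \<and> b \<in> V \<inter> H r \<and> (q1 \<noteq> r) = q}"
    then obtain a b q1 r where t: "t = pure a b" "a \<in> epart q1" "b \<in> V" "b \<in> H r" "(q1 \<noteq> r) = q" by blast
    have "mu a b \<in> H q" using mu_hom[OF t(2,4)] unfolding t(5) .
    then show "t \<in> phi ` H q" using t(1,3) by (intro image_eqI[of _ _ "mu a b"]) (simp_all add: phi_mu)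
  qed
  ultimately show "part TM q \<subseteq> phi ` H q" unfolding part_TM by (rule fs.span_minimal[rotated])
qed

lemma ex_functional:
  assumes "x \<noteq> 0"
  shows "\<exists>f. (\<forall>v w. f (v + w) = f v + f w) \<and> (\<forall>c v. f (s c v) = c * f v) \<and> f x \<noteq> 0"
proof -
  have ind: "independent {x}" using assms by simp
  define B where "B = extend_basis {x}"
  have B: "independent B" "span B = UNIV" "x \<in> B"
    using independent_extend_basis[OF ind] span_extend_basis[OF ind] extend_basis_superset[OF ind] by (auto simp: B_def)
  have "representation B x x = 1" using representation_basis[OF B(1,3)] by simp
  then show ?thesis
    by (intro exI[of _ "\<lambda>v. representation B v x"])
      (auto simp: representation_add[OF B(1)] representation_scale[OF B(1)] B(2))
qed

text \<open>If the coordinate of \<open>w\<close> at \<open>S\<close> is nonzero, take a linear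
  functional not vanishing on it. Its product with the coefficient functional at \<open>S\<close> is
  a bilinear form on which \<open>phi w\<close> is nonzero.\<close>

lemma phi_inj: "inj_on phi C"
proof (rule inj_onI)
  have *: "w = 0" if w: "w \<in> C" "phi w = 0" for w
  proof (rule coef_inj[OF w(1)], rule ccontr)
    fix S assume nz: "coef w S \<noteq> 0"
    obtain f where f: "\<And>v w. f (v + w) = f v + f w" "\<And>c v. f (s c v) = c * f v" "f (coef w S) \<noteq> 0"
      using ex_functional[OF nz] by blast
    define \<beta> where "\<beta> u v = Poly_Mapping.lookup u S * f v" for u v
    have b: "bil \<beta>" by (simp add: bil_iff \<beta>_def f lookup_add algebra_simps)
    have "phi w \<beta> = (\<Sum>T\<in>{T. coef w T \<noteq> 0}. if T = S then f (coef w S) else 0)"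
      unfolding phi_def sum_fun_apply
      by (rule sum.cong) (auto simp: pure_tensor_def b \<beta>_def lookup_single when_def)
    also have "\<dots> = f (coef w S)" using coef_fin[OF w(1)] nz by simp
    finally show False using w f by simp
  qed
  fix w w' assume w: "w \<in> C" "w' \<in> C" "phi w = phi w'"
  have "phi (w + s (- 1) w') = phi w + fscale (- 1) (phi w')" using w by (simp only: phi_add phi_scale C_closed)
  also have "\<dots> = 0" using w by (simp add: fun_eq_iff fscale_def)
  finally have "w + s (- 1) w' = 0" by (rule *[rotated]) (use w in auto)
  then show "w = w'" by simp
qed

lemma phi_bij: "bij_betw phi C (carr TM)"
proof -
  have "phi ` C = carr TM"
  proof
    show "phi ` C \<subseteq> carr TM"
    proof clarify
      fix w assume "w \<in> C"
      then obtain a b where ab: "a \<in> H False" "b \<in> H True" "w = a + b" by (rule C_cases)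
      then have "phi w = phi a + phi b" "phi a \<in> part TM False" "phi b \<in> part TM True"
        using phi_sum_part by (auto simp: phi_add H_C)
      then show "phi w \<in> carr TM" unfolding carr_def by blast
    qed
    show "carr TM \<subseteq> phi ` C"
    proof
      fix t assume "t \<in> carr TM"
      then obtain t1 t2 where "t = t1 + t2" "t1 \<in> part TM False" "t2 \<in> part TM True" unfolding carr_def by blast
      then have "t1 \<in> phi ` H False" "t2 \<in> phi ` H True" using phi_sum_part by simp_all
      with \<open>t = t1 + t2\<close> obtain a b where ab: "a \<in> H False" "b \<in> H True" "t = phi a + phi b" by blast
      then show "t \<in> phi ` C" by (intro image_eqI[of _ _ "a + b"]) (auto simp: phi_add H_C)
    qed
  qed
  then show ?thesis using phi_inj by (simp add: bij_betw_def)
qed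

end

section \<open>The Virasoro module of vacuum vectors\<close>

lemma vir_keys: assumes "x \<in> Vir" shows "Poly_Mapping.keys x \<subseteq> insert GenC (range GenL)"
  using assms unfolding Vir_def
proof (induction rule: ps.span_induct_alt)
  case (step c x y)
  have "Poly_Mapping.keys (pscale c x) \<subseteq> Poly_Mapping.keys x" by (auto simp: in_keys_iff)
  moreover have "Poly_Mapping.keys x \<subseteq> insert GenC (range GenL)" using step(1) by auto
  ultimately show ?case using step(2) Poly_Mapping.keys_add[of "pscale c x" y] by blast
qed simp

lemma vir_odd: assumes "x \<in> Vir" "x \<in> fvir_part True" shows "x = 0"
proof -
  have "g \<notin> Poly_Mapping.keys x" for g
    using vir_keys[OF assms(1)] assms(2) by (cases g) (auto simp: fvir_part_def)
  then have "Poly_Mapping.keys x = {}" by blast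
  then show ?thesis by simp
qed

lemma bracket_left: "bracket (x + x') y = bracket x y + bracket x' y" "bracket (pscale a x) y = pscale a (bracket x y)"
  by (simp_all add: bracket_def ps.lin_extend_add ps.lin_extend_pscale)

lemma bracket_unit: "bracket (unit_vec g) y = lin_extend pscale (gen_bracket g) y"
  by (simp add: bracket_def)

lemma unit_Vir: "unit_vec (GenL m) \<in> Vir" "unit_vec GenC \<in> Vir"
  unfolding Vir_def by (intro ps.span_base; blast)+

context fock
begin

definition gv :: "gen \<Rightarrow> 'a \<Rightarrow> 'a" where
  "gv g v = (case g of GenL m \<Rightarrow> LV m v | GenPsi r \<Rightarrow> 0 | GenC \<Rightarrow> s (k - 1 / 2) v | GenZ \<Rightarrow> 0)"

lemma vact_single: "vact (Poly_Mapping.single g a) v = s a (gv g v)"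
  by (simp add: vact_def gv_def)

lemma gv_lin: "lin_on V (gv g)"
proof -
  have "vact (unit_vec g) = gv g" by (rule ext) (simp add: vact_single)
  then show ?thesis using vact_lin[of "unit_vec g"] by simp
qed

lemma vact_gen_bracket: assumes v: "v \<in> V"
  shows "vact (gen_bracket g h) v = gv g (gv h v) - gv h (gv g v)"
proof -
  have z: "LV m 0 = 0" for m using lin_on_0[OF LV_lin C_sub] .
  have c: "LV m (s a v) = s a (LV m v)" for a m using v V_C by (simp add: lin_onD[OF LV_lin])
  have n: "vact (- x) v = - vact x v" for x using vact_left(1)[of "- x" x v] vact_left(3) by (simp add: add_eq_0_iff2)
  show ?thesis
  proof (cases g)
    case (GenL m)
    show ?thesis
    proof (cases h)
      case (GenL n)
      show ?thesis using \<open>g = GenL m\<close> GenL LV_LV[OF v, of m n]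
        by (simp add: gv_def vact_left vact_single)
    qed (use GenL in \<open>simp_all add: gv_def z c vact_left vact_single\<close>)
  next
    case (GenPsi r)
    then show ?thesis by (cases h) (simp_all add: gv_def z n vact_left vact_single)
  next
    case GenC
    then show ?thesis by (cases h) (simp_all add: gv_def z c vact_left)
  next
    case GenZ
    then show ?thesis by (cases h) (simp_all add: gv_def z vact_left)
  qed
qed

lemma vact_bracket: assumes v: "v \<in> V"
  shows "vact (bracket x y) v = vact x (vact y v) - vact y (vact x v)"
proof (rule poly_mapping_lin_eqI[where s = s and f = "\<lambda>x. vact (bracket x y) v"
      and g = "\<lambda>x. vact x (vact y v) - vact y (vact x v)"])
  have V': "vact x v \<in> V" for x using v lin_onD(1)[OF vact_lin] by blast
  note lin = lin_onD(2,3)[OF vact_lin]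
  show "vact (bracket (x + x') y) v = vact (bracket x y) v + vact (bracket x' y) v"
    "vact (bracket (pscale a x) y) v = s a (vact (bracket x y) v)"
    "vact (x + x') (vact y v) - vact y (vact (x + x') v) =
      (vact x (vact y v) - vact y (vact x v)) + (vact x' (vact y v) - vact y (vact x' v))"
    "vact (pscale a x) (vact y v) - vact y (vact (pscale a x) v) = s a (vact x (vact y v) - vact y (vact x v))" for x x' a
    using V' by (simp_all add: bracket_left vact_left lin scale_right_diff_distrib)
  fix g
  show "vact (bracket (unit_vec g) y) v = vact (unit_vec g) (vact y v) - vact y (vact (unit_vec g) v)"
  proof (rule poly_mapping_lin_eqI[where s = s and f = "\<lambda>y. vact (bracket (unit_vec g) y) v"
        and g = "\<lambda>y. vact (unit_vec g) (vact y v) - vact y (vact (unit_vec g) v)"])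
    show "vact (bracket (unit_vec g) (unit_vec h)) v = vact (unit_vec g) (vact (unit_vec h) v) - vact (unit_vec h) (vact (unit_vec g) v)" for h
      using v by (simp add: bracket_unit vact_gen_bracket vact_single)
  qed (use V' in \<open>simp_all add: bracket_unit ps.lin_extend_add ps.lin_extend_pscale vact_left lin
        scale_right_diff_distrib cspace_axioms\<close>)
qed (rule cspace_axioms)

lemma LV_hom: assumes "v \<in> H q" shows "LV m v \<in> H q"
proof -
  have "vac \<in> epart False" by (simp add: epart_def fcard.rep_eq)
  then have "mu (ext_L m vac) v \<in> H (False \<noteq> q)" by (intro mu_hom epart_L assms)
  then show ?thesis unfolding LV_def using L_hom[OF assms] subspace_diff[OF H_sub] by simp
qed

lemma vact_hom: assumes "v \<in> H q" "x \<in> Vir" shows "vact x v \<in> H q"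
  unfolding vact_def lin_extend_def
  using assms(1) LV_hom subspace_0[OF H_sub]
  by (intro subspace_sum[OF H_sub] subspace_scale[OF H_sub])
    (auto split: gen.splits intro: subspace_scale[OF H_sub])

lemma VM_supermodule: "supermodule Vir VM"
  unfolding supermodule_def VM_simps
proof (intro conjI allI ballI)
  show "vector_space s" by (rule vector_space_axioms)
  show "module.subspace s (V \<inter> H q)" for q by (rule subspace_inter[OF V_sub H_sub])
  show "(V \<inter> H False) \<inter> (V \<inter> H True) = {0}" using H_int subspace_0[OF V_sub] by auto
  show "vact x (v + w) = vact x v + vact x w" if "v \<in> V" "w \<in> V" for x v w using that by (simp add: lin_onD[OF vact_lin])
  show "vact x (s a v) = s a (vact x v)" if "v \<in> V" for x v a using that by (simp add: lin_onD[OF vact_lin])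
  show "vact (x + y) v = vact x v + vact y v" "vact (pscale a x) v = s a (vact x v)" for x y v a by (simp_all add: vact_left)
  fix q r
  show "vact x v \<in> V \<inter> H (q \<noteq> r)" if x: "x \<in> Vir \<inter> fvir_part q" and v: "v \<in> V \<inter> H r" for x v
  proof (cases q)
    case True
    then have "x = 0" using x vir_odd by auto
    then show ?thesis using subspace_0[OF V_sub] subspace_0[OF H_sub] by (simp add: vact_left)
  next
    case False
    then show ?thesis using v x lin_onD(1)[OF vact_lin, of v x] vact_hom by simp
  qed
  show "vact (bracket x y) v = vact x (vact y v) - s (if q \<and> r then - 1 else 1) (vact y (vact x v))"
    if x: "x \<in> Vir \<inter> fvir_part q" and y: "y \<in> Vir \<inter> fvir_part r" and v: "v \<in> V" for x y v
  proof (cases "q \<and> r")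
    case True
    then have "x = 0" "y = 0" using x y vir_odd by auto
    then show ?thesis using bracket_left(2)[of 0 0 0] lin_on_0[OF vact_lin V_sub] by (simp add: vact_left)
  next
    case False
    then show ?thesis using vact_bracket[OF v] by auto
  qed
qed

text \<open>The exterior algebra applied to \<open>N\<close> spans a graded submodule of the whole
  module. It is zero or everything, and the coordinate at the empty set recovers \<open>N\<close>
  from it.\<close>

lemma VM_submodule_cases: assumes N: "graded_submodule Vir VM N" shows "N = {0} \<or> N = V"
proof -
  have sub: "subspace N" "N \<subseteq> V" and gr: "N = {a + b |a b. a \<in> N \<inter> (V \<inter> H False) \<and> b \<in> N \<inter> (V \<inter> H True)}"
    and st: "\<And>x v. x \<in> Vir \<Longrightarrow> v \<in> N \<Longrightarrow> vact x v \<in> N"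
    using N unfolding graded_submodule_def VM_simps by blast+
  have NC: "v \<in> C" if "v \<in> N" for v using that sub V_C by blast
  have LVN: "LV m v \<in> N" if "v \<in> N" for m v
    using st[OF unit_Vir(1) that, of m] by (simp add: vact_single gv_def)
  let ?G = "{mu (unit_vec S) v |S v q. v \<in> N \<inter> H q}"
  have GC: "?G \<subseteq> C" using NC by auto
  have muN: "mu u v \<in> span ?G" if v: "v \<in> N" for u v
  proof -
    have "v \<in> {a + b |a b. a \<in> N \<inter> (V \<inter> H False) \<and> b \<in> N \<inter> (V \<inter> H True)}" using gr v by blast
    then obtain a b where ab: "a \<in> N \<inter> H False" "b \<in> N \<inter> H True" "v = a + b" by blast
    have 1: "mu u a \<in> span ?G" if "a \<in> N \<inter> H q" for a q
    proof -
      have "mu u a = (\<Sum>S\<in>Poly_Mapping.keys u. s (Poly_Mapping.lookup u S) (mu (unit_vec S) a))"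
        by (simp add: mu_def lin_extend_def)
      also have "\<dots> \<in> span ?G" by (intro span_sum span_scale span_base) (use that in blast)
      finally show ?thesis .
    qed
    have "mu u v = mu u a + mu u b" using ab NC by (simp add: mu_right)
    then show ?thesis using 1[OF ab(1)] 1[OF ab(2)] by (simp add: span_add)
  qed
  have coefN: "w \<in> C \<and> (\<forall>S. coef w S \<in> N)" if "w \<in> span ?G" for w
    using that
  proof (induction rule: span_induct_alt)
    case base
    have "coef 0 S = 0" for S using coef_scale[of 0 0] by (simp add: fun_eq_iff)
    then show ?case using subspace_0[OF sub(1)] by simp
  next
    case (step c x y)
    then obtain S v where "x = mu (unit_vec S) v" "v \<in> N" by blast
    then have "x \<in> C" "\<forall>T. coef x T \<in> N" using NC sub by (auto simp: coef_mu subspace_scale)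
    then show ?case using step by (simp add: coef_add coef_scale subspace_add subspace_scale sub(1))
  qed
  have "span ?G = {0} \<or> span ?G = C"
  proof (rule simple)
    show "span ?G \<subseteq> C" by (rule span_minimal[OF GC C_sub])
    have "\<exists>q. g \<in> H q" if "g \<in> ?G" for g
    proof -
      obtain S v q where "g = mu (unit_vec S) v" "v \<in> H q" using \<open>g \<in> ?G\<close> by blast
      then show ?thesis using mu_hom[OF epart_unit] by blast
    qed
    then have "graded (span ?G)" by (rule graded_span)
    then show "\<exists>a\<in>span ?G \<inter> H False. \<exists>b\<in>span ?G \<inter> H True. v = a + b" if "v \<in> span ?G" for v
      using that unfolding graded_def by blast
    show "L m v \<in> span ?G" if "v \<in> span ?G" for m v
    proof (rule lin_on_span_subset[OF L_lin C_sub GC subspace_span _ that])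
      fix g assume "g \<in> ?G"
      then obtain S v where "g = mu (unit_vec S) v" "v \<in> N" by blast
      then show "L m g \<in> span ?G" using sub(2) muN LVN by (auto simp: mu_L subset_iff intro!: span_add)
    qed
    show "P r v \<in> span ?G" if "v \<in> span ?G" for r v
    proof (rule lin_on_span_subset[OF P_lin C_sub GC subspace_span _ that])
      fix g assume "g \<in> ?G"
      then obtain S v where g: "g = mu (unit_vec S) v" "v \<in> N" by blast
      then have "P r g = s l (mu (ext_psi r (unit_vec S)) v)" using sub(2) by (auto simp: P_p mu_psi)
      then show "P r g \<in> span ?G" using muN g by (simp add: span_scale)
    qed
  qed (rule subspace_span)
  then show ?thesis
  proof
    assume "span ?G = {0}"
    then have "N \<subseteq> {0}" using muN[of _ vac] by (auto simp: mu_vac)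
    then show ?thesis using subspace_0[OF sub(1)] by blast
  next
    assume C: "span ?G = C"
    have "v \<in> N" if v: "v \<in> V" for v
    proof -
      have "coef (mu vac v) {||} = v" by (simp add: coef_mu[OF v])
      then show ?thesis using coefN[of v] C V_C[OF v] by (simp add: mu_vac) metis
    qed
    then show ?thesis using sub by blast
  qed
qed

lemma VM_simple: "simple_supermodule Vir VM"
proof -
  obtain u q where "u \<in> H q" "u \<noteq> 0" "\<forall>n::nat. p (int n) u = 0" using vacuum by blast
  then have "u \<in> V" "u \<noteq> 0" using H_C by (auto simp: V_def)
  then have "V \<noteq> {0}" by blast
  then show ?thesis unfolding simple_supermodule_def
    using VM_supermodule VM_submodule_cases by simp
qed

lemma LV_0: "LV 0 v = L 0 v"
  by (simp add: LV_def ext_L_vac mu_left)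

lemma weight_space_VM: "weight_space VM \<alpha> = V \<inter> wt \<alpha>"
  using V_C by (auto simp: weight_space_def wt_def vact_single gv_def LV_0)

lemma VM_decomp:
  assumes "v \<in> V"
  obtains A f where "finite A" "\<And>\<alpha>. \<alpha> \<in> A \<Longrightarrow> f \<alpha> \<in> V \<inter> wt \<alpha>" "v = (\<Sum>\<alpha>\<in>A. f \<alpha>)"
proof -
  obtain A f where A: "finite A" "\<And>\<alpha>. \<alpha> \<in> A \<Longrightarrow> f \<alpha> \<in> wt \<alpha>" "v = (\<Sum>\<alpha>\<in>A. f \<alpha>)"
    using C_decomp[OF V_C[OF assms]] by blast
  have "f \<alpha> \<in> V" if "\<alpha> \<in> A" for \<alpha>
    by (rule wt_component[OF V_sub _ A(1,2) _ that]) (use LV_V[of _ 0] A assms in \<open>auto simp: LV_0\<close>)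
  then show ?thesis using that[OF A(1) _ A(3)] A(2) by blast
qed

lemma VM_weight: "weight_module VM"
  unfolding weight_module_def weight_space_VM VM_simps
proof
  show "V \<subseteq> span (\<Union>\<alpha>. V \<inter> wt \<alpha>)"
  proof
    fix v assume "v \<in> V"
    obtain A f where A: "\<And>\<alpha>. \<alpha> \<in> A \<Longrightarrow> f \<alpha> \<in> V \<inter> wt \<alpha>" "v = (\<Sum>\<alpha>\<in>A. f \<alpha>)" using VM_decomp[OF \<open>v \<in> V\<close>] by blast
    show "v \<in> span (\<Union>\<alpha>. V \<inter> wt \<alpha>)" unfolding A(2) by (intro span_sum span_base) (use A(1) in blast)
  qed
  show "span (\<Union>\<alpha>. V \<inter> wt \<alpha>) \<subseteq> V" by (rule span_minimal[OF _ V_sub]) auto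
qed

lemma cr_wt: "v \<in> wt \<alpha> \<Longrightarrow> p (- int n - 1) v \<in> wt (\<alpha> + half (int n))"
proof -
  have "\<alpha> - half (- int n - 1) = \<alpha> + half (int n)" by (simp add: half_def)
  then show "v \<in> wt \<alpha> \<Longrightarrow> p (- int n - 1) v \<in> wt (\<alpha> + half (int n))" using p_wt[of v \<alpha> "- int n - 1"] by metis
qed

text \<open>Vacuum vectors of arbitrarily low weight \<open>\<alpha> - n\<close> would produce infinitely many independent
  vectors \<open>\<xi>\<^sub>0 \<xi>\<^bsub>n-1\<^esub> v\<close> of weight \<open>\<alpha>\<close>.\<close>

lemma VM_bounded_below: "\<exists>n0::nat. \<forall>n\<ge>n0. V \<inter> wt (\<alpha> - of_nat n) = {0}"
proof (rule ccontr)
  assume "\<not> ?thesis"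
  then have *: "\<forall>n0::nat. \<exists>n\<ge>n0. V \<inter> wt (\<alpha> - of_nat n) \<noteq> {0}" by blast
  define Q where "Q = {n::nat. n \<ge> 2 \<and> V \<inter> wt (\<alpha> - of_nat n) \<noteq> {0}}"
  have "infinite Q" unfolding infinite_nat_iff_unbounded_le
  proof
    fix m
    obtain n where "n \<ge> max m 2" "V \<inter> wt (\<alpha> - of_nat n) \<noteq> {0}" using * by blast
    then show "\<exists>n\<ge>m. n \<in> Q" by (auto simp: Q_def)
  qed
  obtain B where B: "finite B" "wt \<alpha> = span B" by (rule wt_fin')
  obtain A where A: "A \<subseteq> Q" "finite A" "card A = Suc (card B)"
    using infinite_arbitrarily_large[OF \<open>infinite Q\<close>] by blast
  have "\<forall>n\<in>Q. \<exists>v. v \<in> V \<inter> wt (\<alpha> - of_nat n) \<and> v \<noteq> 0"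
    using subspace_0[OF V_sub] subspace_0[OF wt_sub] by (auto simp: Q_def)
  then obtain v where v: "\<And>n. n \<in> Q \<Longrightarrow> v n \<in> V" "\<And>n. n \<in> Q \<Longrightarrow> v n \<in> wt (\<alpha> - of_nat n)" "\<And>n. n \<in> Q \<Longrightarrow> v n \<noteq> 0"
    by (metis IntE)
  \<comment> \<open>Modes \<open>0\<close> and \<open>n - 1\<close> together raise the weight by
    \<open>1/2 + (n - 1/2) = n\<close>; the condition \<open>n \<ge> 2\<close> in \<open>Q\<close>
    makes them distinct.\<close>
  define T where "T n = {|0, n - 1|}" for n :: nat
  have Tinj: "inj_on T Q"
    by (rule inj_on_inverseI[of _ "\<lambda>S. Suc (Max (fset S))"]) (auto simp: T_def Q_def)
  have w: "cr (T n) (v n) \<in> wt \<alpha>" if n: "n \<in> Q" for n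
  proof -
    have vC: "v n \<in> C" using v(1)[OF n] V_C by blast
    have n2: "n \<ge> 2" using n by (simp add: Q_def)
    have "cr {|n - 1|} (v n) = p (- int (n - 1) - 1) (v n)"
      using cr_insert[OF vC, of "n - 1" "{||}"] by (simp add: sgn_below_def)
    moreover have "cr (T n) (v n) = p (- int 0 - 1) (cr {|n - 1|} (v n))"
      using cr_insert[OF vC, of 0 "{|n - 1|}"] n2 by (simp add: sgn_below_def T_def)
    ultimately have "cr (T n) (v n) \<in> wt (\<alpha> - of_nat n + half (int (n - 1)) + half (int 0))"
      using cr_wt[OF cr_wt[OF v(2)[OF n], of "n - 1"], of 0] by simp
    moreover have "\<alpha> - of_nat n + half (int (n - 1)) + half (int 0) = \<alpha>" using n2 by (simp add: half_def of_nat_diff)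
    ultimately show ?thesis by metis
  qed
  have "\<exists>c. (\<exists>i\<in>A. c i \<noteq> 0) \<and> (\<Sum>i\<in>A. s (c i) (cr (T i) (v i))) = 0"
    by (rule dependent_family[OF A(2) B(1)]) (use A B w in auto)
  then obtain c i where c: "i \<in> A" "c i \<noteq> 0" "(\<Sum>i\<in>A. s (c i) (cr (T i) (v i))) = 0" by blast
  have TA: "inj_on T A" using Tinj A(1) by (rule inj_on_subset)
  define f where "f S = s (c (the_inv_into A T S)) (v (the_inv_into A T S))" for S
  have fT: "f (T n) = s (c n) (v n)" if "n \<in> A" for n using the_inv_into_f_f[OF TA that] by (simp add: f_def)
  have "(\<Sum>S\<in>T ` A. cr S (f S)) = (\<Sum>i\<in>A. s (c i) (cr (T i) (v i)))"
    unfolding sum.reindex[OF TA] using A(1) v(1) V_C by (intro sum.cong) (auto simp: fT lin_onD[OF cr_lin] subset_iff)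
  then have "f (T i) = 0"
    using c A v(1) by (intro cr_unique[of "T ` A" f]) (auto simp: fT subset_iff intro!: subspace_scale[OF V_sub])
  then show False using fT[OF c(1)] c v(3)[of i] A(1) by auto
qed

text \<open>The weights of the whole module may differ by half-integers, but \<open>LV\<close>
  shifts them by integers. So by simplicity over \<open>Vir\<close> the weights of \<open>V\<close>
  lie in one coset of the integers, where \<open>VM_bounded_below\<close> gives a lower
  bound.\<close>

lemma VM_highest: "highest_weight VM"
proof -
  obtain u q where u: "u \<in> V" "u \<noteq> 0"
    using vacuum H_C unfolding V_def by blast
  obtain A f where A: "finite A" "\<And>\<alpha>. \<alpha> \<in> A \<Longrightarrow> f \<alpha> \<in> V \<inter> wt \<alpha>" "u = (\<Sum>\<alpha>\<in>A. f \<alpha>)" using VM_decomp[OF u(1)] by blast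
  then obtain \<alpha> where a: "\<alpha> \<in> A" "f \<alpha> \<noteq> 0" using u(2) by (metis sum.neutral)
  let ?G = "\<Union>q. \<Union>m::int. V \<inter> (wt (\<alpha> + of_int m) \<inter> H q)"
  have GV: "?G \<subseteq> V" by blast
  have gen: "gv g x \<in> span ?G" if x: "x \<in> ?G" for g x
  proof -
    obtain q m where q: "x \<in> V" "x \<in> wt (\<alpha> + of_int m)" "x \<in> H q" using x by blast
    show ?thesis
    proof (cases g)
      case (GenL j)
      have "L j x \<in> wt (\<alpha> + of_int (m - j))" using wt_L[OF q(2), of j] by (simp add: algebra_simps)
      moreover have "LV j x \<in> V" "LV j x \<in> H q" using LV_V LV_hom q by auto
      moreover have "LV j x \<in> wt (\<alpha> + of_int (m - j))"
      proof -
        have "L 0 (LV j x) = s (\<alpha> + of_int (m - j)) (LV j x)"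
          using LV_LV[OF q(1), of 0 j] q lin_onD(3)[OF LV_lin[of j], of x "\<alpha> + of_int m"]
          by (cases "j = 0") (simp_all add: LV_0 wt_def algebra_simps)
        then show ?thesis using V_C[OF \<open>LV j x \<in> V\<close>] by (simp add: wt_def)
      qed
      ultimately have "LV j x \<in> ?G" by blast
      then show ?thesis using GenL by (simp add: gv_def span_base)
    qed (use x in \<open>simp_all add: gv_def span_zero span_scale span_base\<close>)
  qed
  have "graded_submodule Vir VM (span ?G)"
    unfolding graded_submodule_def VM_simps
  proof (intro conjI ballI)
    show sV: "span ?G \<subseteq> V" by (rule span_minimal[OF GV V_sub])
    have "graded (span ?G)" by (rule graded_span) blast
    then have "\<exists>a b. v = a + b \<and> a \<in> span ?G \<inter> (V \<inter> H False) \<and> b \<in> span ?G \<inter> (V \<inter> H True)" if "v \<in> span ?G" for v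
      using that sV unfolding graded_def by blast
    then show "span ?G = {a + b |a b. a \<in> span ?G \<inter> (V \<inter> H False) \<and> b \<in> span ?G \<inter> (V \<inter> H True)}"
      by (auto intro: span_add)
    have gs: "gv g v \<in> span ?G" if "v \<in> span ?G" for g v
      by (rule lin_on_span_subset[OF gv_lin V_sub GV subspace_span gen that])
    show "vact x v \<in> span ?G" if "v \<in> span ?G" for x v
      unfolding vact_def lin_extend_def gv_def[symmetric]
      by (intro span_sum span_scale gs that)
  qed (rule subspace_span)
  then have "span ?G = {0} \<or> span ?G = V" by (rule VM_submodule_cases)
  moreover have "f \<alpha> \<in> span ?G"
  proof -
    have fa: "f \<alpha> \<in> V" "f \<alpha> \<in> wt \<alpha>" using A(2)[OF a(1)] by auto
    have "graded (V \<inter> wt \<alpha>)" unfolding graded_def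
      using graded_component[OF V_graded] graded_component[OF wt_graded] by (blast elim: C_cases dest: V_C)
    then obtain x y where "x \<in> V \<inter> wt \<alpha> \<inter> H False" "y \<in> V \<inter> wt \<alpha> \<inter> H True" and xy: "f \<alpha> = x + y"
      using fa unfolding graded_def by blast
    then have "x \<in> V \<inter> (wt (\<alpha> + of_int 0) \<inter> H False)" "y \<in> V \<inter> (wt (\<alpha> + of_int 0) \<inter> H True)" by simp_all
    then have "x \<in> ?G" "y \<in> ?G" by blast+
    then show ?thesis unfolding xy by (intro span_add span_base)
  qed
  ultimately have VG: "V = span ?G" using a by blast
  obtain n0 :: nat where n0: "\<And>n. n \<ge> n0 \<Longrightarrow> V \<inter> wt (\<alpha> - of_nat n) = {0}" using VM_bounded_below by blast
  have "{\<beta>. V \<inter> wt \<beta> \<noteq> {0}} \<subseteq> range (\<lambda>n::nat. (\<alpha> - of_nat n0) + of_nat n)"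
  proof clarify
    fix \<beta> assume b: "V \<inter> wt \<beta> \<noteq> {0}"
    then obtain v where v: "v \<in> V" "v \<in> wt \<beta>" "v \<noteq> 0" using subspace_0[OF V_sub] subspace_0[OF wt_sub] by blast
    have "\<beta> \<in> range (\<lambda>m::int. \<alpha> + of_int m)"
    proof (rule ccontr)
      assume nb: "\<beta> \<notin> range (\<lambda>m::int. \<alpha> + of_int m)"
      have "?G \<subseteq> (\<Union>\<gamma>\<in>range (\<lambda>m::int. \<alpha> + of_int m). wt \<gamma>)" by blast
      then have "span ?G \<subseteq> span (\<Union>\<gamma>\<in>range (\<lambda>m::int. \<alpha> + of_int m). wt \<gamma>)" by (rule span_mono)
      then have "v \<in> span (\<Union>\<gamma>\<in>range (\<lambda>m::int. \<alpha> + of_int m). wt \<gamma>)"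
        using equalityD1[OF VG, THEN subsetD, OF v(1)] by (rule subsetD)
      then show False using wt_disjoint[OF v(2) _ nb] v(3) by blast
    qed
    then obtain m :: int where m: "\<beta> = \<alpha> + of_int m" by blast
    have "m > - int n0"
    proof (rule ccontr)
      assume "\<not> m > - int n0"
      then have "nat (- m) \<ge> n0" "of_nat (nat (- m)) = (- of_int m :: complex)" by (simp_all add: of_nat_nat)
      then show False using n0[of "nat (- m)"] b m by simp
    qed
    then have "\<beta> = (\<alpha> - of_nat n0) + of_nat (nat (m + int n0))" using m by (simp add: of_nat_nat)
    then show "\<beta> \<in> range (\<lambda>n::nat. (\<alpha> - of_nat n0) + of_nat n)" by blast
  qed
  then show ?thesis unfolding highest_weight_def weight_space_VM using VM_weight by blast
qed

end

section \<open>The dual module\<close>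

context fvmod
begin

text \<open>Homogeneous weight vectors, not highest weight vectors.\<close>

definition hwv :: "'a set" where "hwv = {v. \<exists>\<alpha> q. v \<in> wt \<alpha> \<and> v \<in> H q}"

definition B :: "'a set" where "B = (SOME B. B \<subseteq> hwv \<and> independent B \<and> hwv \<subseteq> span B)"

lemma B_props: "B \<subseteq> hwv" "independent B" "hwv \<subseteq> span B"
proof -
  have "\<exists>B. B \<subseteq> hwv \<and> independent B \<and> hwv \<subseteq> span B"
    by (rule maximal_independent_subset[of hwv]) blast
  from someI_ex[OF this]
  show "B \<subseteq> hwv" "independent B" "hwv \<subseteq> span B" unfolding B_def by simp_all
qed

lemma B_cases: assumes "b \<in> B" obtains \<alpha> q where "b \<in> wt \<alpha>" "b \<in> H q"
  using B_props(1) assms by (auto simp: hwv_def)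

lemma B_nonzero: "b \<in> B \<Longrightarrow> b \<noteq> 0"
  using B_props(2) dependent_zero by blast

lemma B_C: "b \<in> B \<Longrightarrow> b \<in> C"
  using B_cases wt_C by metis

lemma span_B: "span B = C"
proof
  show "span B \<subseteq> C" by (rule span_minimal[OF _ C_sub]) (use B_C in blast)
  have "wt \<alpha> \<subseteq> span B" for \<alpha>
  proof
    fix v assume "v \<in> wt \<alpha>"
    then obtain a b where "a \<in> wt \<alpha> \<inter> H False" "b \<in> wt \<alpha> \<inter> H True" "v = a + b"
      using wt_graded[of \<alpha>] unfolding graded_def by blast
    moreover from this have "a \<in> span B" "b \<in> span B" using B_props(3) by (auto simp: hwv_def)
    ultimately show "v \<in> span B" by (simp add: span_add)
  qed
  then have "(\<Union>\<alpha>. wt \<alpha>) \<subseteq> span B" by blast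
  then show "C \<subseteq> span B" unfolding C_span_wt by (rule span_minimal[OF _ subspace_span])
qed

text \<open>Applied to the weight spaces and to the two parities: \<open>B\<close> is adapted to
  both, because the basis vectors outside such a \<open>U\<close> lie in a complement of it.\<close>

lemma B_split:
  assumes U: "subspace U" "v \<in> C" "v \<in> U"
    and z: "\<And>y. y \<in> span (B - U) \<Longrightarrow> y \<in> U \<Longrightarrow> y = 0"
  shows "v \<in> span (B \<inter> U)"
proof -
  have "v \<in> span ((B \<inter> U) \<union> (B - U))" using U span_B by (simp add: Int_Diff_Un)
  then obtain x y where xy: "x \<in> span (B \<inter> U)" "y \<in> span (B - U)" "v = x + y"
    unfolding span_Un by blast
  have "x \<in> U" using xy(1) span_minimal[OF _ U(1), of "B \<inter> U"] by blast
  then have "v - x \<in> U" using U by (intro subspace_diff)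
  then have "y = 0" using z xy by simp
  then show ?thesis using xy by simp
qed

lemma wt_span_B: assumes "v \<in> wt \<alpha>" shows "v \<in> span (B \<inter> wt \<alpha>)"
proof (rule B_split[OF wt_sub wt_C[OF assms] assms])
  fix y assume y: "y \<in> span (B - wt \<alpha>)" "y \<in> wt \<alpha>"
  have "B - wt \<alpha> \<subseteq> (\<Union>\<beta>\<in>- {\<alpha>}. wt \<beta>)"
  proof
    fix b assume b: "b \<in> B - wt \<alpha>"
    then obtain \<beta> q where "b \<in> wt \<beta>" using B_cases[of b] by blast
    moreover from this have "\<beta> \<noteq> \<alpha>" using b by auto
    ultimately show "b \<in> (\<Union>\<beta>\<in>- {\<alpha>}. wt \<beta>)" by auto
  qed
  from span_mono[OF this] have "y \<in> span (\<Union>\<beta>\<in>- {\<alpha>}. wt \<beta>)" using y(1) by (rule subsetD)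
  then show "y = 0" using wt_disjoint[OF y(2)] by simp
qed

lemma H_span_B: assumes "v \<in> H q" shows "v \<in> span (B \<inter> H q)"
proof (rule B_split[OF H_sub H_C[OF assms] assms])
  fix y assume y: "y \<in> span (B - H q)" "y \<in> H q"
  have "B - H q \<subseteq> H (\<not> q)"
  proof
    fix b assume b: "b \<in> B - H q"
    then obtain \<alpha> q' where q': "b \<in> H q'" using B_cases[of b] by blast
    then have "q' = (\<not> q)" using b by (cases "q = q'") auto
    then show "b \<in> H (\<not> q)" using q' by simp
  qed
  from span_minimal[OF this H_sub] have "y \<in> H (\<not> q)" using y(1) by (rule subsetD)
  then show "y = 0" using y(2) H_int by (cases q) auto
qed

lemma B_wt_fin: "finite (B \<inter> wt \<alpha>)"
proof -
  obtain B' where B': "finite B'" "wt \<alpha> = span B'" by (rule wt_fin')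
  have "independent (B \<inter> wt \<alpha>)" using B_props(2) by (rule independent_mono) blast
  then show ?thesis using independent_span_bound[OF B'(1)] B'(2) by blast
qed

definition co :: "'a \<Rightarrow> 'a \<Rightarrow> complex" where "co b v = representation B v b"

lemma co_lin: "v \<in> C \<Longrightarrow> w \<in> C \<Longrightarrow> co b (v + w) = co b v + co b w"
  "v \<in> C \<Longrightarrow> co b (s a v) = a * co b v" "co b 0 = 0"
  using representation_zero
  by (simp_all add: co_def representation_add B_props(2) span_B representation_scale)

lemma co_fin: "finite {b. co b v \<noteq> 0}"
  unfolding co_def by (rule finite_representation)

lemma co_B: "co b v \<noteq> 0 \<Longrightarrow> b \<in> B"
  unfolding co_def by (rule representation_ne_zero)

lemma co_sum: assumes "v \<in> C" "finite A" "{b. co b v \<noteq> 0} \<subseteq> A" shows "v = (\<Sum>b\<in>A. s (co b v) b)"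
proof -
  have "v = (\<Sum>b | co b v \<noteq> 0. s (co b v) b)"
    using sum_nonzero_representation_eq[OF B_props(2), of v] assms(1) by (simp add: span_B co_def)
  also have "\<dots> = (\<Sum>b\<in>A. s (co b v) b)" by (rule sum.mono_neutral_left) (use assms in auto)
  finally show ?thesis .
qed

lemma co_basis: "b \<in> B \<Longrightarrow> b' \<in> B \<Longrightarrow> co b' b = (if b = b' then 1 else 0)"
  unfolding co_def using representation_basis[OF B_props(2)] by simp

lemma co_supp: assumes "v \<in> span (B \<inter> U)" "co b v \<noteq> 0" shows "b \<in> U"
proof -
  have "representation B v = representation (B \<inter> U) v"
    by (rule representation_extend[OF B_props(2) assms(1) Int_lower1])
  then show ?thesis using assms(2) representation_ne_zero[of "B \<inter> U" v b] by (simp add: co_def)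
qed

text \<open>The homogeneous basis \<open>B\<close> is orthonormal for this form.  As weight spaces are finite-dimensional
  and orthogonal to each other, it identifies \<open>C\<close> with its restricted dual, and \<open>tr\<close> is the transpose.\<close>

definition form :: "'a \<Rightarrow> 'a \<Rightarrow> complex" where "form v w = (\<Sum>b | co b v \<noteq> 0. co b v * co b w)"

lemma form_superset: "finite A \<Longrightarrow> {b. co b v \<noteq> 0} \<subseteq> A \<Longrightarrow> form v w = (\<Sum>b\<in>A. co b v * co b w)"
  unfolding form_def by (rule sum.mono_neutral_left) auto

lemma form_sym: "form v w = form w v"
proof -
  let ?A = "{b. co b v \<noteq> 0} \<union> {b. co b w \<noteq> 0}"
  have "finite ?A" by (simp add: co_fin)
  then show ?thesis using form_superset[of ?A v w] form_superset[of ?A w v] by (simp add: mult.commute)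
qed

lemma form_right: "w \<in> C \<Longrightarrow> w' \<in> C \<Longrightarrow> form v (w + w') = form v w + form v w'"
  "w \<in> C \<Longrightarrow> form v (s a w) = a * form v w" "form v 0 = 0"
  by (simp_all add: form_def co_lin distrib_left sum.distrib sum_distrib_left mult.left_commute)

lemma form_left: "w \<in> C \<Longrightarrow> w' \<in> C \<Longrightarrow> form (w + w') v = form w v + form w' v"
  "w \<in> C \<Longrightarrow> form (s a w) v = a * form w v" "form 0 v = 0"
  by (simp_all add: form_sym[of _ v] form_right)

lemma form_neg: "w \<in> C \<Longrightarrow> form v (- w) = - form v w" "w \<in> C \<Longrightarrow> form (- w) v = - form w v"
  using form_right(2)[of w v "- 1"] form_left(2)[of w "- 1" v] by simp_all

lemma form_diff: "w \<in> C \<Longrightarrow> w' \<in> C \<Longrightarrow> form v (w - w') = form v w - form v w'"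
  "w \<in> C \<Longrightarrow> w' \<in> C \<Longrightarrow> form (w - w') v = form w v - form w' v"
  using form_right(1)[of w "- w'" v] form_left(1)[of w "- w'" v] by (simp_all add: form_neg)

lemma form_sum_right: "(\<And>i. i \<in> A \<Longrightarrow> f i \<in> C) \<Longrightarrow> form v (\<Sum>i\<in>A. f i) = (\<Sum>i\<in>A. form v (f i))"
  by (induction A rule: infinite_finite_induct) (auto simp: form_right C_sum)

lemma form_sum_left: "(\<And>i. i \<in> A \<Longrightarrow> f i \<in> C) \<Longrightarrow> form (\<Sum>i\<in>A. f i) v = (\<Sum>i\<in>A. form (f i) v)"
  by (simp add: form_sym[of _ v] form_sum_right)

lemma form_basis: assumes "b \<in> B" shows "form b v = co b v" "form v b = co b v"
proof -
  show *: "form b v = co b v"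
  proof -
    have "{b'. co b' b \<noteq> 0} \<subseteq> {b}"
    proof
      fix b' assume "b' \<in> {b'. co b' b \<noteq> 0}"
      then have nz: "co b' b \<noteq> 0" by simp
      then show "b' \<in> {b}" using co_basis[OF assms co_B[OF nz]] by (auto split: if_splits)
    qed
    then show ?thesis using co_basis[OF assms assms] by (subst form_superset[of "{b}"]) auto
  qed
  then show "form v b = co b v" by (simp add: form_sym)
qed

lemma form_eqI:
  assumes "v \<in> C" "w \<in> C" "\<And>b. b \<in> B \<Longrightarrow> form v b = form w b" shows "v = w"
proof -
  let ?A = "{b. co b v \<noteq> 0} \<union> {b. co b w \<noteq> 0}"
  have A: "finite ?A" by (simp add: co_fin)
  have "co b v = co b w" if "b \<in> ?A" for b
  proof -
    have "b \<in> B" using that co_B by blast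
    then show ?thesis using assms(3)[of b] by (simp add: form_basis)
  qed
  then have "(\<Sum>b\<in>?A. s (co b v) b) = (\<Sum>b\<in>?A. s (co b w) b)" by (intro sum.cong) auto
  then show ?thesis using co_sum[OF assms(1) A] co_sum[OF assms(2) A] by simp
qed

lemma form_wt: assumes "v \<in> wt \<alpha>" "w \<in> wt \<beta>" "\<alpha> \<noteq> \<beta>" shows "form v w = 0"
proof -
  have False if "co b v \<noteq> 0" "co b w \<noteq> 0" for b
  proof -
    have "b \<in> wt \<alpha>" "b \<in> wt \<beta>"
      using co_supp[OF wt_span_B[OF assms(1)] that(1)] co_supp[OF wt_span_B[OF assms(2)] that(2)] .
    then have "s \<alpha> b = s \<beta> b" by (simp add: wt_def)
    then have "b = 0" using assms(3) by simp
    then show False using B_nonzero[OF co_B[OF that(1)]] by simp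
  qed
  then show ?thesis unfolding form_def by (intro sum.neutral) auto
qed

lemma form_H: assumes "v \<in> H q" "w \<in> H (\<not> q)" shows "form v w = 0"
proof -
  have False if "co b v \<noteq> 0" "co b w \<noteq> 0" for b
  proof -
    have "b \<in> H q" "b \<in> H (\<not> q)"
      using co_supp[OF H_span_B[OF assms(1)] that(1)] co_supp[OF H_span_B[OF assms(2)] that(2)] .
    then have "b = 0" using H_int by (cases q) auto
    then show False using B_nonzero[OF co_B[OF that(1)]] by simp
  qed
  then show ?thesis unfolding form_def by (intro sum.neutral) auto
qed

lemma form_H_detect:
  assumes x: "x \<in> C" "\<And>v. v \<in> H (\<not> q) \<Longrightarrow> form x v = 0" shows "x \<in> H q"
proof -
  obtain a b where ab: "a \<in> H q" "b \<in> H (\<not> q)" "x = a + b"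
  proof -
    obtain a b where "a \<in> H False" "b \<in> H True" "x = a + b" using x(1) by (rule C_cases)
    then show ?thesis using that[of a b] that[of b a] by (cases q) (auto simp: add.commute)
  qed
  have "b = 0"
  proof (rule form_eqI)
    fix c assume c: "c \<in> B"
    then obtain \<alpha> q' where q': "c \<in> H q'" using B_cases[of c] by blast
    show "form b c = form 0 c"
    proof (cases "q' = q")
      case True
      then show ?thesis using form_H[of b "\<not> q" c] ab q' by (simp add: form_left)
    next
      case False
      then have "c \<in> H (\<not> q)" using q' by (cases q') auto
      then show ?thesis using x(2)[of c] form_H[OF ab(1), of c] ab H_C by (simp add: form_left)
    qed
  qed (use ab H_C in auto)
  then show ?thesis using ab by simp
qed

section \<open>Transposes of operators\<close>

definition homog :: "('a \<Rightarrow> 'a) \<Rightarrow> complex \<Rightarrow> bool" where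
  "homog T d \<longleftrightarrow> lin_on C T \<and> (\<forall>\<alpha>. \<forall>v\<in>wt \<alpha>. T v \<in> wt (\<alpha> - d))"

definition tr :: "('a \<Rightarrow> 'a) \<Rightarrow> 'a \<Rightarrow> 'a" where
  "tr T w = (\<Sum>b | b \<in> B \<and> form w (T b) \<noteq> 0. s (form w (T b)) b)"

text \<open>\<open>w\<close> involves finitely many basis vectors \<open>b'\<close>, and
  \<open>T b\<close> can involve \<open>b'\<close> only if the weight of \<open>b\<close> exceeds
  that of \<open>b'\<close> by \<open>d\<close>. Finite multiplicities leave finitely many such
  \<open>b\<close>.\<close>

lemma tr_fin: assumes "homog T d" shows "finite {b. b \<in> B \<and> form w (T b) \<noteq> 0}"
proof (rule finite_subset)
  define \<gamma> where "\<gamma> b = (SOME \<alpha>. b \<in> wt \<alpha>)" for b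
  have \<gamma>: "b \<in> wt (\<gamma> b)" if "b \<in> B" for b
    unfolding \<gamma>_def by (rule someI_ex) (use B_cases[OF that] in blast)
  show "finite (\<Union>b'\<in>{b. co b w \<noteq> 0}. B \<inter> wt (\<gamma> b' + d))" by (intro finite_UN_I co_fin B_wt_fin)
  show "{b. b \<in> B \<and> form w (T b) \<noteq> 0} \<subseteq> (\<Union>b'\<in>{b. co b w \<noteq> 0}. B \<inter> wt (\<gamma> b' + d))"
  proof clarify
    fix b assume b: "b \<in> B" "form w (T b) \<noteq> 0"
    have "\<exists>b'. co b' w * co b' (T b) \<noteq> 0"
    proof (rule ccontr)
      assume "\<not> ?thesis"
      then have "form w (T b) = 0" unfolding form_def by (intro sum.neutral) auto
      then show False using b by simp
    qed
    then obtain b' where b': "co b' w \<noteq> 0" "co b' (T b) \<noteq> 0" by auto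
    have "T b \<in> wt (\<gamma> b - d)" using assms \<gamma>[OF b(1)] by (simp add: homog_def)
    then have b'w: "b' \<in> wt (\<gamma> b - d)" using co_supp[OF wt_span_B b'(2)] by blast
    moreover have "b' \<in> B" using co_B b' by blast
    moreover have "b' \<noteq> 0" using \<open>b' \<in> B\<close> by (rule B_nonzero)
    ultimately have "\<gamma> b - d = \<gamma> b'"
      using \<gamma>[of b'] by (simp add: wt_def)
    then have "\<gamma> b = \<gamma> b' + d" by (simp add: algebra_simps)
    then have "b \<in> wt (\<gamma> b' + d)" using \<gamma>[OF b(1)] by simp
    then show "b \<in> (\<Union>b'\<in>{b. co b w \<noteq> 0}. B \<inter> wt (\<gamma> b' + d))" using b b' by blast
  qed
qed

lemma tr_C: "tr T w \<in> C"
  unfolding tr_def using B_C by (intro C_sum) auto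

lemma form_tr: assumes T: "homog T d" and v: "v \<in> C" shows "form (tr T w) v = form w (T v)"
proof -
  have b: "form (tr T w) b = form w (T b)" if "b \<in> B" for b
  proof -
    have "form (tr T w) b = (\<Sum>b' | b' \<in> B \<and> form w (T b') \<noteq> 0. form w (T b') * form b' b)"
      unfolding tr_def using B_C by (subst form_sum_left) (auto simp: form_left)
    also have "\<dots> = (\<Sum>b' | b' \<in> B \<and> form w (T b') \<noteq> 0. if b' = b then form w (T b) else 0)"
      by (rule sum.cong) (use that in \<open>auto simp: form_basis co_basis\<close>)
    also have "\<dots> = form w (T b)" using tr_fin[OF T, of w] that by simp
    finally show ?thesis .
  qed
  have Tl: "lin_on C T" using T by (simp add: homog_def)
  have v': "v = (\<Sum>b | co b v \<noteq> 0. s (co b v) b)" by (rule co_sum[OF v co_fin]) simp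
  have BB: "b \<in> B" "b \<in> C" if "co b v \<noteq> 0" for b using that co_B B_C by blast+
  have "form (tr T w) v = (\<Sum>b | co b v \<noteq> 0. co b v * form (tr T w) b)"
    using BB by (subst v', subst form_sum_right) (auto simp: form_right)
  also have "\<dots> = (\<Sum>b | co b v \<noteq> 0. co b v * form w (T b))" using b BB by simp
  also have "\<dots> = form w (\<Sum>b | co b v \<noteq> 0. s (co b v) (T b))"
    using BB lin_onD(1)[OF Tl] by (subst form_sum_right) (auto simp: form_right)
  also have "(\<Sum>b | co b v \<noteq> 0. s (co b v) (T b)) = T (\<Sum>b | co b v \<noteq> 0. s (co b v) b)"
    using BB by (subst lin_on_sum[OF Tl C_sub]) (auto simp: lin_onD[OF Tl])
  finally show ?thesis using v' by simp
qed

lemma tr_lin: assumes T: "homog T d" shows "lin_on C (tr T)"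
  unfolding lin_on_def
proof (intro conjI ballI allI)
  have TC: "T b \<in> C" if "b \<in> B" for b using T that B_C lin_onD(1) by (auto simp: homog_def)
  show "tr T v \<in> C" for v by (rule tr_C)
  show "tr T (v + w) = tr T v + tr T w" if "v \<in> C" "w \<in> C" for v w
    by (rule form_eqI) (use that TC in \<open>auto simp: tr_C form_left form_tr[OF T] B_C\<close>)
  show "tr T (s a v) = s a (tr T v)" if "v \<in> C" for v a
    by (rule form_eqI) (use that TC in \<open>auto simp: tr_C form_left form_tr[OF T] B_C\<close>)
qed

lemma tr_hom:
  assumes T: "homog T d" "\<And>q v. v \<in> H q \<Longrightarrow> T v \<in> H (e \<noteq> q)" and w: "w \<in> H q"
  shows "tr T w \<in> H (e \<noteq> q)"
proof (rule form_H_detect[OF tr_C])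
  fix v assume v: "v \<in> H (\<not> (e \<noteq> q))"
  have "T v \<in> H (\<not> q)" using T(2)[OF v] by (cases e; cases q) auto
  then show "form (tr T w) v = 0" using form_tr[OF T(1) H_C[OF v]] form_H[OF w] by simp
qed

definition par :: "'a \<Rightarrow> 'a" where
  "par v = (THE w. \<exists>a\<in>H False. \<exists>b\<in>H True. v = a + b \<and> w = a - b)"

lemma par_eq: assumes "a \<in> H False" "b \<in> H True" shows "par (a + b) = a - b"
  unfolding par_def
proof (rule the_equality)
  show "\<exists>a'\<in>H False. \<exists>b'\<in>H True. a + b = a' + b' \<and> a - b = a' - b'" using assms by blast
  fix w assume "\<exists>a'\<in>H False. \<exists>b'\<in>H True. a + b = a' + b' \<and> w = a' - b'"
  then obtain a' b' where *: "a' \<in> H False" "b' \<in> H True" "a + b = a' + b'" "w = a' - b'" by blast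
  then show "w = a - b" using H_unique[OF assms(1) *(1) assms(2) *(2,3)] by simp
qed

lemma par_lin: "lin_on C par"
  unfolding lin_on_def
proof (intro conjI ballI allI)
  fix v assume "v \<in> C"
  then obtain a b where ab: "a \<in> H False" "b \<in> H True" "v = a + b" by (rule C_cases)
  then show "par v \<in> C" using H_C by (auto simp: par_eq)
  have "s c v = s c a + s c b" "s c a \<in> H False" "s c b \<in> H True" for c
    using ab by (auto simp: scale_right_distrib subspace_scale[OF H_sub])
  then show "par (s c v) = s c (par v)" for c
    using ab by (simp add: par_eq scale_right_diff_distrib)
  fix w assume "w \<in> C"
  then obtain a' b' where ab': "a' \<in> H False" "b' \<in> H True" "w = a' + b'" by (rule C_cases)
  have "v + w = (a + a') + (b + b')" "a + a' \<in> H False" "b + b' \<in> H True"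
    using ab ab' by (auto simp: subspace_add[OF H_sub])
  then have "par (v + w) = (a + a') - (b + b')" by (simp only: par_eq)
  then show "par (v + w) = par v + par w" using ab ab' by (simp add: par_eq)
qed

lemma par_C [simp]: "v \<in> C \<Longrightarrow> par v \<in> C"
  using par_lin by (rule lin_onD(1))

lemma par_H: "v \<in> H q \<Longrightarrow> par v = (if q then - v else v)"
  using par_eq[of 0 v] par_eq[of v 0] subspace_0[OF H_sub] by (cases q) auto

lemma par_par: assumes "v \<in> C" shows "par (par v) = v"
proof -
  obtain a b where ab: "a \<in> H False" "b \<in> H True" "v = a + b" using assms by (rule C_cases)
  then have "par v = a + (- b)" by (simp add: par_eq)
  then show ?thesis using par_eq[OF ab(1) subspace_neg[OF H_sub ab(2)]] ab by simp
qed

lemma par_L: assumes "v \<in> C" shows "par (L m v) = L m (par v)"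
proof -
  obtain a b where ab: "a \<in> H False" "b \<in> H True" "v = a + b" using assms by (rule C_cases)
  then show ?thesis using par_eq[OF L_hom[OF ab(1)] L_hom[OF ab(2)]] H_C by (simp add: par_eq)
qed

lemma par_P: assumes "v \<in> C" shows "par (P r v) = - P r (par v)"
proof -
  obtain a b where ab: "a \<in> H False" "b \<in> H True" "v = a + b" using assms by (rule C_cases)
  have "P r b \<in> H False" "P r a \<in> H True" using P_hom[of a False] P_hom[of b True] ab by auto
  then show ?thesis using par_eq[of "P r b" "P r a"] ab H_C by (simp add: par_eq add.commute)
qed

lemma form_par: assumes "v \<in> C" "w \<in> C" shows "form (par v) w = form v (par w)"
proof -
  obtain a b where ab: "a \<in> H False" "b \<in> H True" "v = a + b" using assms(1) by (rule C_cases)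
  obtain a' b' where ab': "a' \<in> H False" "b' \<in> H True" "w = a' + b'" using assms(2) by (rule C_cases)
  show ?thesis
    using ab ab' form_H[OF ab(1), of b'] form_H[OF ab(2), of a'] H_C
    by (simp add: par_eq form_left form_right form_diff)
qed

lemma par_wt: assumes "v \<in> wt \<alpha>" shows "par v \<in> wt \<alpha>"
proof -
  have "L 0 (par v) = s \<alpha> (par v)"
    using par_L[of v 0] assms lin_onD(3)[OF par_lin, of v \<alpha>] by (simp add: wt_def)
  then show ?thesis using assms by (simp add: wt_def)
qed

section \<open>The dual action on the same carrier\<close>

definition Ld :: "int \<Rightarrow> 'a \<Rightarrow> 'a" where "Ld m v = - tr (L m) v"

text \<open>For odd x the dual action is \<open>(x f) v = - (-1)^|f| f (x v)\<close>. Since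
  \<open>form\<close> pairs only equal parities, the sign becomes \<open>par\<close> applied to
  \<open>x v\<close>, as in \<open>rdual\<close>.\<close>

definition Pd :: "int \<Rightarrow> 'a \<Rightarrow> 'a" where "Pd r v = - tr (\<lambda>v. par (P r v)) v"

lemma homog_L: "homog (L m) (of_int m)"
  by (simp add: homog_def L_lin wt_L)

lemma homog_P: "homog (\<lambda>v. par (P r v)) (half r)"
  using lin_on_comp[OF par_lin P_lin] by (simp add: homog_def par_wt wt_P)

lemma Ld_lin: "lin_on C (Ld m)"
  unfolding Ld_def by (rule lin_on_minus[OF tr_lin[OF homog_L] C_sub])

lemma Pd_lin: "lin_on C (Pd r)"
  unfolding Pd_def by (rule lin_on_minus[OF tr_lin[OF homog_P] C_sub])

lemma Ld_C [simp]: "Ld m v \<in> C" and Pd_C [simp]: "Pd m v \<in> C"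
  by (simp_all add: Ld_def Pd_def tr_C)

lemma form_Ld: "v \<in> C \<Longrightarrow> form (Ld m w) v = - form w (L m v)"
  by (simp add: Ld_def form_neg tr_C form_tr[OF homog_L])

lemma form_Pd: "v \<in> C \<Longrightarrow> form (Pd r w) v = - form w (par (P r v))"
  by (simp add: Pd_def form_neg tr_C form_tr[OF homog_P])

text \<open>The two signs from transposing cancel; the remaining one comes from moving
  \<open>par\<close> past \<open>P t\<close>. This is why z acts on the dual by - \<zeta>.\<close>

lemma form_Pd_Pd: assumes "v \<in> C" shows "form (Pd r (Pd t w)) v = - form w (P t (P r v))"
  using assms by (simp add: form_Pd par_P par_par form_neg)

text \<open>Weight vectors of different weights are orthogonal, so \<open>L 0\<close> is its own
  transpose, and the dual has the opposite weights.\<close>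

lemma Ld_0: assumes "v \<in> C" shows "Ld 0 v = - L 0 v"
proof -
  have 1: "form (L 0 v) w = form v (L 0 w)" if v: "v \<in> wt \<alpha>" and w: "w \<in> C" for v w \<alpha>
  proof -
    obtain A g where A: "finite A" "\<And>\<beta>. \<beta> \<in> A \<Longrightarrow> g \<beta> \<in> wt \<beta>" "w = (\<Sum>\<beta>\<in>A. g \<beta>)" using C_decomp[OF w] by blast
    have gC: "g \<beta> \<in> C" if "\<beta> \<in> A" for \<beta> using A(2)[OF that] wt_C by blast
    have "form (L 0 v) w = (\<Sum>\<beta>\<in>A. \<alpha> * form v (g \<beta>))"
      using v gC wt_C[OF v] by (simp add: A(3) wt_def form_left form_sum_right sum_distrib_left)
    also have "\<dots> = (\<Sum>\<beta>\<in>A. \<beta> * form v (g \<beta>))"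
      by (rule sum.cong) (use form_wt[OF v] A(2) in force)+
    also have "\<dots> = (\<Sum>\<beta>\<in>A. form v (L 0 (g \<beta>)))"
      by (rule sum.cong) (use A(2) in \<open>auto simp: wt_def form_right\<close>)
    also have "\<dots> = form v (L 0 w)" unfolding A(3) using gC by (simp add: L_sum form_sum_right)
    finally show ?thesis .
  qed
  obtain A f where A: "finite A" "\<And>\<beta>. \<beta> \<in> A \<Longrightarrow> f \<beta> \<in> wt \<beta>" "v = (\<Sum>\<beta>\<in>A. f \<beta>)" using C_decomp[OF assms] by blast
  have fC: "f \<beta> \<in> C" if "\<beta> \<in> A" for \<beta> using A(2)[OF that] wt_C by blast
  show ?thesis
  proof (rule form_eqI)
    fix b assume b: "b \<in> B"
    have "form v (L 0 b) = (\<Sum>\<beta>\<in>A. form (f \<beta>) (L 0 b))" unfolding A(3) using fC by (simp add: form_sum_left)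
    also have "\<dots> = (\<Sum>\<beta>\<in>A. form (L 0 (f \<beta>)) b)" using 1[OF A(2) B_C[OF b]] by simp
    also have "\<dots> = form (L 0 v) b" unfolding A(3) using fC by (simp add: L_sum form_sum_left)
    finally show "form (Ld 0 v) b = form (- L 0 v) b" using assms B_C[OF b] by (simp add: form_Ld form_neg)
  qed (use assms in auto)
qed

lemma dual_wt: "{v \<in> C. Ld 0 v = s \<alpha> v} = wt (- \<alpha>)"
  by (auto simp: wt_def Ld_0 minus_equation_iff[of _ "s \<alpha> _"] equation_minus_iff[of "L 0 _"] eq_commute[of "L 0 _" "s \<alpha> _"] eq_commute[of "- s \<alpha> _"])

text \<open>The form is bilinear and not Hermitian, so a subspace may meet its own complement. The
  vector is therefore found by counting: a basis of \<open>N\<close> gives fewer equations than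
  \<open>wt \<alpha>\<close> has coordinates.\<close>

lemma perp_vector:
  assumes N: "subspace N" "N \<subseteq> wt \<alpha>" "N \<noteq> wt \<alpha>"
  obtains v where "v \<in> wt \<alpha>" "v \<noteq> 0" "\<And>w. w \<in> N \<Longrightarrow> form w v = 0"
proof -
  obtain J where J: "J \<subseteq> N" "independent J" "N \<subseteq> span J" using basis_exists[of N] by metis
  obtain y where y: "y \<in> wt \<alpha>" "y \<notin> N" using N by blast
  have "span J \<subseteq> N" by (rule span_minimal[OF J(1) N(1)])
  then have yJ: "y \<notin> span J" using y by blast
  have ind: "independent (insert y J)" by (rule independent_insertI[OF yJ J(2)])
  have "insert y J \<subseteq> span (B \<inter> wt \<alpha>)" using J(1) N(2) y wt_span_B by blast
  then have c: "finite (insert y J)" "card (insert y J) \<le> card (B \<inter> wt \<alpha>)"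
    using independent_span_bound[OF B_wt_fin ind] by auto
  moreover have "y \<notin> J" using yJ span_base by blast
  ultimately have fJ: "finite J" and "card J < card (B \<inter> wt \<alpha>)" by auto
  then obtain c where c: "\<exists>b\<in>B \<inter> wt \<alpha>. c b \<noteq> 0" "\<forall>j\<in>J. (\<Sum>b\<in>B \<inter> wt \<alpha>. c b * co b j) = 0"
    using complex_system_nontrivial[OF B_wt_fin fJ, of \<alpha> "\<lambda>j b. co b j"] by blast
  define v where "v = (\<Sum>b\<in>B \<inter> wt \<alpha>. s (c b) b)"
  have vw: "v \<in> wt \<alpha>" unfolding v_def by (intro subspace_sum[OF wt_sub] subspace_scale[OF wt_sub]) blast
  have f: "form w v = (\<Sum>b\<in>B \<inter> wt \<alpha>. c b * co b w)" for w
    unfolding v_def using B_C by (subst form_sum_right) (auto simp: form_right form_basis)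
  show ?thesis
  proof (rule that[OF vw])
    obtain b where b: "b \<in> B \<inter> wt \<alpha>" "c b \<noteq> 0" using c(1) by blast
    have "form b v = (\<Sum>b'\<in>B \<inter> wt \<alpha>. if b' = b then c b else 0)"
      unfolding f by (rule sum.cong) (use b co_basis in auto)
    also have "\<dots> = c b" using b B_wt_fin by simp
    finally show "v \<noteq> 0" using b form_right(3)[of b] by auto
    fix w assume "w \<in> N"
    then have "w \<in> span J" using J by blast
    then have "w \<in> C \<and> form w v = 0"
    proof (induction rule: span_induct_alt)
      case (step a x y)
      then have "x \<in> C" "form x v = 0" using J(1) N(2) wt_C c(2) f by auto
      then show ?case using step by (simp add: form_left)
    qed (simp add: form_left)
    then show "form w v = 0" ..
  qed
qed

text \<open>The relations follow by transposing. For simplicity, the orthogonal complement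
  \<open>M\<close> of a dual submodule \<open>N\<close> is a submodule of the original, where
  stability of \<open>N\<close> under \<open>par\<close> translates \<open>Pd\<close> into
  \<open>P\<close>. If \<open>M = C\<close>, then \<open>N\<close> is zero by nondegeneracy; if
  \<open>M = {0}\<close>, then \<open>perp_vector\<close> puts every weight space into
  \<open>N\<close>.\<close>

lemma dual: "fvmod s H Ld Pd (- k) (- \<zeta>)"
proof (unfold_locales)
  show "subspace (H q)" "H False \<inter> H True = {0}" "lin_on C (Ld m)" "lin_on C (Pd m)" "C \<noteq> {0}" for q m
    by (rule H_sub H_int Ld_lin Pd_lin nonzero)+
  show "Ld m v \<in> H q" if v: "v \<in> H q" for m q v
  proof -
    have "tr (L m) v \<in> H (False \<noteq> q)" by (rule tr_hom[OF homog_L _ v]) (simp add: L_hom)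
    then show ?thesis by (simp add: Ld_def subspace_neg[OF H_sub])
  qed
  show "Pd r v \<in> H (\<not> q)" if v: "v \<in> H q" for r q v
  proof -
    have "tr (\<lambda>v. par (P r v)) v \<in> H (True \<noteq> q)"
    proof (rule tr_hom[OF homog_P _ v])
      fix q v assume "v \<in> H q"
      then show "par (P r v) \<in> H (True \<noteq> q)" using par_H[OF P_hom[of v q r]] P_hom[of v q r] subspace_neg[OF H_sub] by auto
    qed
    then show ?thesis by (simp add: Pd_def subspace_neg[OF H_sub])
  qed
  show "Ld m (Ld n v) - Ld n (Ld m v) =
       s (of_int (m - n)) (Ld (m + n) v) + (if m = - n then s ((of_int m ^ 3 - of_int m) / 12 * - k) v else 0)"
    if v: "v \<in> C" for m n v
  proof (rule form_eqI)
    fix b assume "b \<in> B"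
    then have b: "b \<in> C" by (rule B_C)
    have "form (Ld m (Ld n v) - Ld n (Ld m v)) b = form v (L n (L m b) - L m (L n b))"
      using b by (simp add: form_diff form_Ld)
    also have "L n (L m b) - L m (L n b) = s (of_int (n - m)) (L (n + m) b)
          + (if n = - m then s ((of_int n ^ 3 - of_int n) / 12 * k) b else 0)"
      by (rule LL[OF b])
    finally show "form (Ld m (Ld n v) - Ld n (Ld m v)) b = form (s (of_int (m - n)) (Ld (m + n) v)
        + (if m = - n then s ((of_int m ^ 3 - of_int m) / 12 * - k) v else 0)) b"
      using b v by (auto simp: form_left form_right form_Ld form_diff form_neg add.commute algebra_simps)
  qed (use v in auto)
  show "Ld m (Pd r v) - Pd r (Ld m v) = s (- half r - of_int m / 2) (Pd (m + r) v)" if v: "v \<in> C" for m r v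
  proof (rule form_eqI)
    fix b assume "b \<in> B"
    then have b: "b \<in> C" by (rule B_C)
    have "form (Ld m (Pd r v) - Pd r (Ld m v)) b = form v (par (P r (L m b))) - form v (L m (par (P r b)))"
      using b by (simp add: form_diff form_Ld form_Pd)
    also have "\<dots> = - form v (par (L m (P r b) - P r (L m b)))"
      using b by (simp add: par_L lin_on_diff[OF par_lin C_sub] form_diff)
    also have "\<dots> = form (s (- half r - of_int m / 2) (Pd (m + r) v)) b"
      unfolding LP[OF b] using b by (simp add: lin_onD[OF par_lin] form_right form_left form_Pd)
    finally show "form (Ld m (Pd r v) - Pd r (Ld m v)) b = form (s (- half r - of_int m / 2) (Pd (m + r) v)) b" .
  qed (use v in auto)
  show "Pd r (Pd t v) + Pd t (Pd r v) = (if r + t = - 1 then s (- \<zeta>) v else 0)" if v: "v \<in> C" for r t v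
  proof (rule form_eqI)
    fix b assume "b \<in> B"
    then have b: "b \<in> C" by (rule B_C)
    have "form (Pd r (Pd t v) + Pd t (Pd r v)) b = - form v (P r (P t b) + P t (P r b))"
      using b by (simp add: form_left form_right form_Pd_Pd)
    also have "\<dots> = form (if r + t = - 1 then s (- \<zeta>) v else 0) b"
      unfolding PP[OF b] using b v by (simp add: form_left form_right form_neg)
    finally show "form (Pd r (Pd t v) + Pd t (Pd r v)) b = form (if r + t = - 1 then s (- \<zeta>) v else 0) b" .
  qed (use v in auto)
  show "C \<subseteq> span (\<Union>\<alpha>. {v \<in> C. Ld 0 v = s \<alpha> v})"
  proof -
    have "wt \<alpha> \<subseteq> (\<Union>\<beta>. wt (- \<beta>))" for \<alpha> using UN_upper[of "- \<alpha>" UNIV "\<lambda>\<beta>. wt (- \<beta>)"] by simp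
    then have "(\<Union>\<alpha>. wt \<alpha>) \<subseteq> (\<Union>\<beta>. wt (- \<beta>))" by blast
    from span_mono[OF this] show ?thesis unfolding dual_wt using C_span_wt by simp
  qed
  show "\<exists>B. finite B \<and> {v \<in> C. Ld 0 v = s \<alpha> v} = span B" for \<alpha>
    unfolding dual_wt using wt_fin'[of "- \<alpha>"] by metis
  fix N assume N: "subspace N" "N \<subseteq> C" "\<And>v. v \<in> N \<Longrightarrow> \<exists>a\<in>N \<inter> H False. \<exists>b\<in>N \<inter> H True. v = a + b"
    "\<And>m v. v \<in> N \<Longrightarrow> Ld m v \<in> N" "\<And>r v. v \<in> N \<Longrightarrow> Pd r v \<in> N"
  define M where "M = {v \<in> C. \<forall>w\<in>N. form w v = 0}"
  have parN: "par w \<in> N" if w: "w \<in> N" for w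
  proof -
    obtain a b where "a \<in> N \<inter> H False" "b \<in> N \<inter> H True" "w = a + b" using N(3)[OF w] by blast
    then show ?thesis using subspace_diff[OF N(1)] by (simp add: par_eq)
  qed
  have "M = {0} \<or> M = C"
  proof (rule simple)
    show "subspace M" by (rule subspaceI) (auto simp: M_def form_right)
    show "M \<subseteq> C" by (auto simp: M_def)
    show "\<exists>a\<in>M \<inter> H False. \<exists>b\<in>M \<inter> H True. v = a + b" if v: "v \<in> M" for v
    proof -
      have "v \<in> C" using v by (simp add: M_def)
      then obtain a b where ab: "a \<in> H False" "b \<in> H True" "v = a + b" by (rule C_cases)
      have "form w a = 0 \<and> form w b = 0" if "w \<in> N" for w
      proof -
        obtain x y where xy: "x \<in> N" "x \<in> H False" "y \<in> N" "y \<in> H True" "w = x + y" using N(3)[OF \<open>w \<in> N\<close>] by blast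
        have "form x v = 0" "form y v = 0" using \<open>v \<in> M\<close> xy by (auto simp: M_def)
        then show ?thesis using xy ab H_C form_H[of x False b] form_H[of y True a] \<open>v = a + b\<close> by (simp add: form_left form_right)
      qed
      then show ?thesis using ab H_C by (intro bexI[of _ a] bexI[of _ b]) (auto simp: M_def)
    qed
    show "L m v \<in> M" if "v \<in> M" for m v
    proof -
      have vC: "v \<in> C" using that by (simp add: M_def)
      have "form w (L m v) = 0" if "w \<in> N" for w
      proof -
        have "form (Ld m w) v = 0" using N(4)[OF \<open>w \<in> N\<close>] \<open>v \<in> M\<close> by (simp add: M_def)
        then show ?thesis using form_Ld[OF vC, of m w] by simp
      qed
      then show ?thesis using vC by (simp add: M_def)
    qed
    show "P r v \<in> M" if v: "v \<in> M" for r v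
    proof -
      have vC: "v \<in> C" using v by (simp add: M_def)
      have "form w (P r v) = 0" if w: "w \<in> N" for w
      proof -
        have wC: "w \<in> C" using w N by blast
        have "form w (P r v) = form (par w) (par (P r v))"
          using form_par[OF wC, of "par (P r v)"] vC by (simp add: par_par)
        also have "\<dots> = - form (Pd r (par w)) v" using vC by (simp add: form_Pd)
        also have "\<dots> = 0" using v N(5)[OF parN[OF w]] by (simp add: M_def)
        finally show ?thesis .
      qed
      then show ?thesis using vC by (simp add: M_def)
    qed
  qed
  then show "N = {0} \<or> N = C"
  proof
    assume "M = C"
    have "w = 0" if "w \<in> N" for w
      by (rule form_eqI) (use that N B_C \<open>M = C\<close> in \<open>auto simp: M_def form_left\<close>)
    then show ?thesis using subspace_0[OF N(1)] by blast
  next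
    assume M0: "M = {0}"
    have L0: "L 0 v \<in> N" if "v \<in> N" for v
      using N(4)[OF that, of 0] Ld_0[of v] that N(2) subspace_neg[OF N(1), of "Ld 0 v"] by auto
    have "wt \<alpha> \<subseteq> N" for \<alpha>
    proof (rule ccontr)
      assume "\<not> wt \<alpha> \<subseteq> N"
      then have "N \<inter> wt \<alpha> \<noteq> wt \<alpha>" by blast
      then obtain v where v: "v \<in> wt \<alpha>" "v \<noteq> 0" "\<And>w. w \<in> N \<inter> wt \<alpha> \<Longrightarrow> form w v = 0"
        using perp_vector[of "N \<inter> wt \<alpha>" \<alpha>] subspace_inter[OF N(1) wt_sub] by blast
      have "form w v = 0" if w: "w \<in> N" for w
      proof -
        obtain A f where A: "finite A" "\<And>\<beta>. \<beta> \<in> A \<Longrightarrow> f \<beta> \<in> wt \<beta>" "w = (\<Sum>\<beta>\<in>A. f \<beta>)"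
          using C_decomp[of w] w N(2) by blast
        have "form (f \<beta>) v = 0" if b: "\<beta> \<in> A" for \<beta>
        proof (cases "\<beta> = \<alpha>")
          case True
          have "f \<beta> \<in> N" by (rule wt_component[OF N(1) L0 A(1,2) _ b]) (use w A(3) in auto)
          then show ?thesis using v(3) A(2)[OF b] True by blast
        next
          case False
          then show ?thesis using form_wt[OF A(2)[OF b] v(1)] by simp
        qed
        then show ?thesis unfolding A(3) using A(2) wt_C by (subst form_sum_left) auto
      qed
      then have "v \<in> M" using wt_C[OF v(1)] by (simp add: M_def)
      then show False using M0 v(2) by blast
    qed
    then have "C \<subseteq> N" unfolding C_span_wt by (intro span_minimal[OF _ N(1)]) blast
    then show ?thesis using N(2) by blast
  qed
qed

end

section \<open>The module as the restricted dual of its dual\<close>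

context fvmod
begin

text \<open>\<open>T\<close> is any model of the dual, and the map is the identification with the
  double dual. For superspaces it sends \<open>v\<close> to
  \<open>f \<mapsto> (-1)^(|f| |v|) f v\<close>; as \<open>form\<close> pairs only equal parities,
  the sign amounts to replacing \<open>v\<close> by \<open>par v\<close>.\<close>

lemma rdual_iso:
  fixes T :: "'b::ab_group_add smod" and \<phi> :: "'a \<Rightarrow> 'b"
  assumes bij: "bij_betw \<phi> C (carr T)"
    and add: "\<And>v w. v \<in> C \<Longrightarrow> w \<in> C \<Longrightarrow> \<phi> (v + w) = \<phi> v + \<phi> w"
    and scale: "\<And>v c. v \<in> C \<Longrightarrow> \<phi> (s c v) = scal T c (\<phi> v)"
    and part: "\<And>q. \<phi> ` H q = part T q"
    and act: "\<And>x v. v \<in> C \<Longrightarrow> \<phi> (fvmod.lact s Ld Pd (- k) (- \<zeta>) x v) = act T x (\<phi> v)"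
  obtains \<Phi> where "bij_betw \<Phi> C (carr (rdual T))"
    "\<And>v w. v \<in> C \<Longrightarrow> w \<in> C \<Longrightarrow> \<Phi> (v + w) = \<Phi> v + \<Phi> w"
    "\<And>v c. v \<in> C \<Longrightarrow> \<Phi> (s c v) = scal (rdual T) c (\<Phi> v)"
    "\<And>q. \<Phi> ` H q \<subseteq> part (rdual T) q"
    "\<And>x v. v \<in> C \<Longrightarrow> \<Phi> (lact x v) = act (rdual T) x (\<Phi> v)"
proof -
  interpret D: fvmod s H Ld Pd "- k" "- \<zeta>" by (rule dual)
  define ps where "ps = the_inv_into C \<phi>"
  have inj: "inj_on \<phi> C" and img: "\<phi> ` C = carr T" using bij by (auto simp: bij_betw_def)
  have ps_phi: "ps (\<phi> w) = w" if "w \<in> C" for w unfolding ps_def by (rule the_inv_into_f_f[OF inj that])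
  have phi_carr: "\<phi> w \<in> carr T" if "w \<in> C" for w using that img by blast
  have carrE: "\<exists>w\<in>C. t = \<phi> w" if "t \<in> carr T" for t using that img by blast
  define \<Phi> where "\<Phi> v = (\<lambda>t. if t \<in> carr T then form (ps t) (par v) else 0)" for v
  have Phi: "\<Phi> v (\<phi> w) = form w (par v)" if "w \<in> C" for v w
    using that by (simp add: \<Phi>_def phi_carr ps_phi)
  have Phi0: "\<Phi> v t = 0" if "t \<notin> carr T" for v t using that by (simp add: \<Phi>_def)
  have ext: "f = g" if "\<And>w. w \<in> C \<Longrightarrow> f (\<phi> w) = g (\<phi> w)" "\<And>t. t \<notin> carr T \<Longrightarrow> f t = g t" for f g :: "'b \<Rightarrow> complex"
    using that carrE by (metis ext)
  have ws: "weight_space T \<alpha> = \<phi> ` wt (- \<alpha>)" for \<alpha>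
  proof
    show "weight_space T \<alpha> \<subseteq> \<phi> ` wt (- \<alpha>)"
    proof
      fix t assume t: "t \<in> weight_space T \<alpha>"
      then obtain w where w: "w \<in> C" "t = \<phi> w" using carrE[of t] by (auto simp: weight_space_def)
      have "\<phi> (Ld 0 w) = act T (unit_vec (GenL 0)) (\<phi> w)"
        using act[OF w(1), of "unit_vec (GenL 0)"] by (simp add: D.lact_left D.gact_def)
      also have "\<dots> = \<phi> (s \<alpha> w)" using t w scale by (simp add: weight_space_def)
      finally have "Ld 0 w = s \<alpha> w" using inj w(1) by (simp add: inj_on_eq_iff)
      then show "t \<in> \<phi> ` wt (- \<alpha>)" using w dual_wt by blast
    qed
    show "\<phi> ` wt (- \<alpha>) \<subseteq> weight_space T \<alpha>"
    proof clarify
      fix w assume "w \<in> wt (- \<alpha>)"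
      then have w: "w \<in> C" "Ld 0 w = s \<alpha> w" using dual_wt[of \<alpha>] by auto
      have "act T (unit_vec (GenL 0)) (\<phi> w) = \<phi> (Ld 0 w)"
        using act[OF w(1), of "unit_vec (GenL 0)"] by (simp add: D.lact_left D.gact_def)
      then show "\<phi> w \<in> weight_space T \<alpha>" using w phi_carr scale by (simp add: weight_space_def)
    qed
  qed
  have rpart: "part (rdual T) q = {f.
       (\<forall>v\<in>carr T. \<forall>w\<in>carr T. f (v + w) = f v + f w) \<and>
       (\<forall>v\<in>carr T. \<forall>k. f (scal T k v) = k * f v) \<and>
       (\<forall>v. v \<notin> carr T \<longrightarrow> f v = 0) \<and>
       finite {\<alpha>. \<exists>v\<in>weight_space T \<alpha>. f v \<noteq> 0} \<and>
       (\<forall>v\<in>part T (\<not> q). f v = 0)}" for q by (simp add: rdual_def)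
  have sub: "\<Phi> v \<in> part (rdual T) q" if v: "v \<in> H q" for v q
    unfolding rpart
  proof (intro CollectI conjI ballI allI impI)
    have vC: "v \<in> C" using v by (rule H_C)
    show "\<Phi> v (t + t') = \<Phi> v t + \<Phi> v t'" if t: "t \<in> carr T" "t' \<in> carr T" for t t'
    proof -
      obtain w where w1: "w \<in> C" "t = \<phi> w" using carrE[OF t(1)] by blast
      obtain w' where w2: "w' \<in> C" "t' = \<phi> w'" using carrE[OF t(2)] by blast
      note w = w1(1) w2(1) w1(2) w2(2)
      then show ?thesis using Phi[of "w + w'" v] by (simp add: Phi add form_left)
    qed
    show "\<Phi> v (scal T c t) = c * \<Phi> v t" if t: "t \<in> carr T" for t c
    proof -
      obtain w where w: "w \<in> C" "t = \<phi> w" using carrE[OF t] by blast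
      then show ?thesis using Phi[of "s c w" v] by (simp add: Phi scale form_left)
    qed
    show "\<Phi> v t = 0" if "t \<notin> carr T" for t using that by (rule Phi0)
    obtain A g where A: "finite A" "\<And>\<beta>. \<beta> \<in> A \<Longrightarrow> g \<beta> \<in> wt \<beta>" "par v = (\<Sum>\<beta>\<in>A. g \<beta>)"
      using C_decomp[of "par v"] vC by auto
    show "finite {\<alpha>. \<exists>t\<in>weight_space T \<alpha>. \<Phi> v t \<noteq> 0}"
    proof (rule finite_subset)
      show "finite (uminus ` A)" using A by simp
      show "{\<alpha>. \<exists>t\<in>weight_space T \<alpha>. \<Phi> v t \<noteq> 0} \<subseteq> uminus ` A"
      proof clarify
        fix \<alpha> t assume "t \<in> weight_space T \<alpha>" "\<Phi> v t \<noteq> 0"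
        then obtain w where w: "w \<in> wt (- \<alpha>)" "\<Phi> v (\<phi> w) \<noteq> 0" unfolding ws by blast
        then have "form w (par v) \<noteq> 0" using Phi wt_C by simp
        then have "(\<Sum>\<beta>\<in>A. form w (g \<beta>)) \<noteq> 0" unfolding A(3) using A(2) wt_C by (subst (asm) form_sum_right) auto
        then obtain \<beta> where b: "\<beta> \<in> A" "form w (g \<beta>) \<noteq> 0" by (metis (no_types, lifting) sum.neutral)
        then have "\<beta> = - \<alpha>" using form_wt[OF w(1) A(2)[OF b(1)]] by metis
        then show "\<alpha> \<in> uminus ` A" using b by force
      qed
    qed
    show "\<Phi> v t = 0" if t: "t \<in> part T (\<not> q)" for t
    proof -
      have "t \<in> \<phi> ` H (\<not> q)" using t part by simp
      then obtain w where w: "w \<in> H (\<not> q)" "t = \<phi> w" by blast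
      have "form w (par v) = 0"
        using form_H[OF v w(1)] par_H[OF v] vC by (simp add: form_sym[of w] form_neg)
      then show ?thesis using w H_C Phi by simp
    qed
  qed
  have sup: "\<exists>v\<in>H q. f = \<Phi> v" if f: "f \<in> part (rdual T) q" for f q
  proof -
    have f1: "f (\<phi> v + \<phi> w) = f (\<phi> v) + f (\<phi> w)" if "v \<in> C" "w \<in> C" for v w using f that phi_carr by (simp add: rpart)
    have f2: "f (scal T c (\<phi> v)) = c * f (\<phi> v)" if "v \<in> C" for v c using f that phi_carr by (simp add: rpart)
    have f3: "f t = 0" if "t \<notin> carr T" for t using f that by (simp add: rpart)
    have f4: "finite {\<alpha>. \<exists>v\<in>weight_space T \<alpha>. f v \<noteq> 0}" using f by (simp add: rpart)
    have f5: "f (\<phi> v) = 0" if "v \<in> H (\<not> q)" for v using f part[of "\<not> q"] that by (auto simp: rpart)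
    \<comment> \<open>\<open>f\<close> sees finitely many weight spaces, each containing finitely
      many elements of \<open>B\<close>; so it is represented by the finite sum
      \<open>v0\<close>.\<close>
    define F where "F = {b. b \<in> B \<and> f (\<phi> b) \<noteq> 0}"
    have fF: "finite F"
    proof (rule finite_subset)
      show "finite (\<Union>\<alpha>\<in>{\<alpha>. \<exists>v\<in>weight_space T \<alpha>. f v \<noteq> 0}. B \<inter> wt (- \<alpha>))" by (intro finite_UN_I f4 B_wt_fin)
      show "F \<subseteq> (\<Union>\<alpha>\<in>{\<alpha>. \<exists>v\<in>weight_space T \<alpha>. f v \<noteq> 0}. B \<inter> wt (- \<alpha>))"
      proof
        fix b assume b: "b \<in> F"
        then have bB: "b \<in> B" "f (\<phi> b) \<noteq> 0" by (auto simp: F_def)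
        obtain \<beta> q' where bw: "b \<in> wt \<beta>" using B_cases[OF bB(1)] by blast
        then have "\<phi> b \<in> weight_space T (- \<beta>)" unfolding ws by simp
        then have "- \<beta> \<in> {\<alpha>. \<exists>v\<in>weight_space T \<alpha>. f v \<noteq> 0}" using bB by blast
        then show "b \<in> (\<Union>\<alpha>\<in>{\<alpha>. \<exists>v\<in>weight_space T \<alpha>. f v \<noteq> 0}. B \<inter> wt (- \<alpha>))" using bB bw by (intro UN_I[of "- \<beta>"]) auto
      qed
    qed
    define v0 where "v0 = (\<Sum>b\<in>F. s (f (\<phi> b)) b)"
    have FB: "b \<in> B" if "b \<in> F" for b using that by (simp add: F_def)
    have v0C: "v0 \<in> C" unfolding v0_def using FB B_C by (intro C_sum) auto
    have b: "form b v0 = f (\<phi> b)" if "b \<in> B" for b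
    proof -
      have "form b v0 = (\<Sum>b'\<in>F. if b' = b then f (\<phi> b) else 0)"
        unfolding v0_def
      proof (subst form_sum_right, goal_cases)
        case (2)
        have "form b (s (f (\<phi> b')) b') = (if b' = b then f (\<phi> b) else 0)" if "b' \<in> F" for b'
          using B_C[OF FB[OF that]] by (subst form_right(2)) (simp_all add: form_basis[OF \<open>b \<in> B\<close>] co_basis \<open>b \<in> B\<close> FB[OF that])
        then show ?case by (rule sum.cong[OF refl])
      qed (use FB B_C in auto)
      also have "\<dots> = f (\<phi> b)" using fF that by (auto simp: F_def)
      finally show ?thesis .
    qed
    have fw: "form w v0 = f (\<phi> w)" if "w \<in> C" for w
    proof -
      have "w \<in> span B" using that span_B by simp
      then have "w \<in> C \<and> form w v0 = f (\<phi> w)"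
      proof (induction rule: span_induct_alt)
        case base
        have "\<phi> 0 = scal T 0 (\<phi> 0)" by (metis C_closed(1) scale scale_zero_left)
        then have "f (\<phi> 0) = 0" using f2[of 0 0] by (metis C_closed(1) mult_zero_left)
        then show ?case by (simp add: form_left)
      next
        case (step c x y)
        then have "x \<in> C" "y \<in> C" "form x v0 = f (\<phi> x)" using B_C b by auto
        moreover have "f (\<phi> (s c x + y)) = c * f (\<phi> x) + f (\<phi> y)"
          using calculation step.IH f1[of "s c x" y] f2[of x c] by (simp add: add scale)
        ultimately show ?case using step by (simp add: form_left)
      qed
      then show ?thesis ..
    qed
    have "v0 \<in> H q"
    proof (rule form_H_detect[OF v0C])
      fix w assume "w \<in> H (\<not> q)"
      then show "form v0 w = 0" using fw[of w] f5 H_C by (simp add: form_sym)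
    qed
    then have pH: "par v0 \<in> H q" using par_H subspace_neg[OF H_sub] by auto
    have "f = \<Phi> (par v0)"
      by (rule ext) (use v0C in \<open>simp_all add: Phi par_par fw f3 Phi0\<close>)
    then show ?thesis using pH by blast
  qed
  have Padd: "\<Phi> (v + w) = \<Phi> v + \<Phi> w" if "v \<in> C" "w \<in> C" for v w
    by (rule ext) (use that in \<open>simp_all add: Phi Phi0 lin_onD[OF par_lin] form_right\<close>)
  have Pscale: "\<Phi> (s c v) = scal (rdual T) c (\<Phi> v)" if "v \<in> C" for v c
    by (rule ext) (use that in \<open>simp_all add: Phi Phi0 lin_onD[OF par_lin] form_right rdual_def fscale_def\<close>)
  have Pinj: "inj_on \<Phi> C"
  proof (rule inj_onI)
    fix v w assume vw: "v \<in> C" "w \<in> C" "\<Phi> v = \<Phi> w"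
    have "par v = par w"
    proof (rule form_eqI)
      fix b assume "b \<in> B"
      then have bC: "b \<in> C" by (rule B_C)
      have "\<Phi> v (\<phi> b) = \<Phi> w (\<phi> b)" using vw by simp
      then show "form (par v) b = form (par w) b" using bC by (simp add: Phi form_sym)
    qed (use vw in auto)
    then show "v = w" using par_par vw by metis
  qed
  have Pimg: "\<Phi> ` C = carr (rdual T)"
  proof
    show "\<Phi> ` C \<subseteq> carr (rdual T)"
    proof clarify
      fix v assume "v \<in> C"
      then obtain a b where ab: "a \<in> H False" "b \<in> H True" "v = a + b" by (rule C_cases)
      then have "\<Phi> v = \<Phi> a + \<Phi> b" using Padd H_C by simp
      then show "\<Phi> v \<in> carr (rdual T)" unfolding carr_def using sub ab by blast
    qed
    show "carr (rdual T) \<subseteq> \<Phi> ` C"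
    proof
      fix f assume "f \<in> carr (rdual T)"
      then obtain g h where gh: "f = g + h" "g \<in> part (rdual T) False" "h \<in> part (rdual T) True" unfolding carr_def by blast
      obtain a where a: "a \<in> H False" "g = \<Phi> a" using sup[OF gh(2)] by blast
      obtain b where b: "b \<in> H True" "h = \<Phi> b" using sup[OF gh(3)] by blast
      have "f = \<Phi> (a + b)" using Padd a b gh H_C by simp
      then show "f \<in> \<Phi> ` C" using a b H_C by blast
    qed
  qed
  have parT: "parity_inv T (\<phi> w) = \<phi> (par w)" if "w \<in> C" for w
  proof -
    obtain a b where ab: "a \<in> H False" "b \<in> H True" "w = a + b" using \<open>w \<in> C\<close> by (rule C_cases)
    have nb: "- b \<in> H True" "b \<in> C" "a \<in> C" using ab subspace_neg[OF H_sub] H_C by auto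
    have neg: "\<phi> (- x) = - \<phi> x" if "x \<in> C" for x
    proof -
      have "\<phi> 0 = 0" using add[of 0 0] by simp
      then show ?thesis using add[of x "- x"] that by (simp add: eq_neg_iff_add_eq_0 add.commute)
    qed
    have "\<phi> (par w) = \<phi> a - \<phi> b"
    proof -
      have "par w = a + - b" using ab by (simp add: par_eq)
      then show ?thesis using add[of a "- b"] nb neg by simp
    qed
    moreover have "parity_inv T (\<phi> w) = \<phi> a - \<phi> b"
      unfolding parity_inv_def
    proof (rule the_equality)
      show "\<exists>x\<in>part T False. \<exists>y\<in>part T True. \<phi> w = x + y \<and> \<phi> a - \<phi> b = x - y"
      proof (intro bexI conjI)
        show "\<phi> w = \<phi> a + \<phi> b" using ab nb add by simp
        show "\<phi> a \<in> part T False" "\<phi> b \<in> part T True" using ab part by blast+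
      qed (rule refl)
      fix z assume "\<exists>x\<in>part T False. \<exists>y\<in>part T True. \<phi> w = x + y \<and> z = x - y"
      then obtain x y where xy: "x \<in> part T False" "y \<in> part T True" "\<phi> w = x + y" "z = x - y" by blast
      have "x \<in> \<phi> ` H False" "y \<in> \<phi> ` H True" using xy part by simp_all
      then obtain a' b' where ab': "a' \<in> H False" "b' \<in> H True" "x = \<phi> a'" "y = \<phi> b'" by blast
      have "\<phi> w = \<phi> (a' + b')" using xy ab' add H_C by simp
      then have "a + b = a' + b'" using inj \<open>w \<in> C\<close> ab ab' H_C by (metis C_closed(2) inj_on_eq_iff)
      then show "z = \<phi> a - \<phi> b" using H_unique[OF ab(1) ab'(1) ab(2) ab'(2)] xy ab' by simp
    qed
    ultimately show ?thesis by simp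
  qed
  have key: "- form (D.lact (fvir_proj False x) w) (par v) - form (D.lact (fvir_proj True x) w) v = form w (par (lact x v))"
    if vw: "v \<in> C" "w \<in> C" for x v w
  proof (rule poly_mapping_lin_eqI[where s = times
        and f = "\<lambda>x. - form (D.lact (fvir_proj False x) w) (par v) - form (D.lact (fvir_proj True x) w) v"
        and g = "\<lambda>x. form w (par (lact x v))"])
    have DC: "D.lact x w \<in> C" "lact x v \<in> C" for x using lin_onD(1)[OF D.lact_lin] lin_onD(1)[OF lact_lin] vw by auto
    show "- form (D.lact (fvir_proj False (x + y)) w) (par v) - form (D.lact (fvir_proj True (x + y)) w) v =
       (- form (D.lact (fvir_proj False x) w) (par v) - form (D.lact (fvir_proj True x) w) v) +
       (- form (D.lact (fvir_proj False y) w) (par v) - form (D.lact (fvir_proj True y) w) v)" for x y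
      using DC by (simp add: fvir_proj_lin D.lact_left form_left)
    show "- form (D.lact (fvir_proj False (pscale a x)) w) (par v) - form (D.lact (fvir_proj True (pscale a x)) w) v =
       a * (- form (D.lact (fvir_proj False x) w) (par v) - form (D.lact (fvir_proj True x) w) v)" for a x
      using DC by (simp add: fvir_proj_lin D.lact_left form_left algebra_simps)
    show "form w (par (lact (x + y) v)) = form w (par (lact x v)) + form w (par (lact y v))" for x y
      using DC by (simp add: lact_left lin_onD[OF par_lin] form_right)
    show "form w (par (lact (pscale a x) v)) = a * form w (par (lact x v))" for a x
      using DC by (simp add: lact_left lin_onD[OF par_lin] form_right)
    show "- form (D.lact (fvir_proj False (unit_vec g)) w) (par v) - form (D.lact (fvir_proj True (unit_vec g)) w) v =
       form w (par (lact (unit_vec g) v))" for g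
    proof -
      have z: "D.lact 0 w = 0" using D.lact_left(2)[of 0 0 w] by simp
      show ?thesis using vw
        by (cases g) (simp_all add: fvir_proj_def z D.lact_left D.gact_def lact_left gact_def form_left form_right
            form_Ld form_Pd par_L lin_onD[OF par_lin] del: scale_minus_left)
    qed
    show "cspace (times :: complex \<Rightarrow> complex \<Rightarrow> complex)"
      by unfold_locales (auto simp: algebra_simps)
  qed
  have Pact: "\<Phi> (lact x v) = act (rdual T) x (\<Phi> v)" if v: "v \<in> C" for x v
  proof (rule ext)
    fix w assume w: "w \<in> C"
    have DC: "D.lact x w \<in> C" for x using lin_onD(1)[OF D.lact_lin] w by auto
    have "act (rdual T) x (\<Phi> v) (\<phi> w) =
       - \<Phi> v (act T (fvir_proj False x) (\<phi> w)) - \<Phi> v (parity_inv T (act T (fvir_proj True x) (\<phi> w)))"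
      using phi_carr[OF w] by (simp add: rdual_def)
    also have "\<dots> = - form (D.lact (fvir_proj False x) w) (par v) - form (par (D.lact (fvir_proj True x) w)) (par v)"
      using DC by (simp add: act[OF w, symmetric] parT Phi)
    also have "form (par (D.lact (fvir_proj True x) w)) (par v) = form (D.lact (fvir_proj True x) w) v"
      using DC v by (simp add: form_par par_par)
    finally show "\<Phi> (lact x v) (\<phi> w) = act (rdual T) x (\<Phi> v) (\<phi> w)"
      using key[OF v w, of x] Phi[OF w, of "lact x v"] by simp
  next
    fix t assume "t \<notin> carr T"
    then show "\<Phi> (lact x v) t = act (rdual T) x (\<Phi> v) t" by (simp add: Phi0 rdual_def)
  qed
  show ?thesis
  proof (rule that[of \<Phi>])
    show "bij_betw \<Phi> C (carr (rdual T))" using Pinj Pimg by (simp add: bij_betw_def)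
    show "\<Phi> ` H q \<subseteq> part (rdual T) q" for q using sub by blast
  qed (use Padd Pscale Pact in auto)
qed

end

context fvmod_charged
begin

text \<open>A vector \<open>f\<close> of weight \<alpha> is orthogonal to all other weight spaces,
  and on the finite-dimensional space of weight \<alpha> one bound \<open>M\<close> serves for all
  creation operators. So almost all annihilation operators of the dual kill
  \<open>f\<close>.\<close>

lemma dual_fock:
  assumes w: "w \<in> C" "w \<noteq> 0" "finite {n::nat. p (- int n - 1) w \<noteq> 0}"
    and l': "l' \<noteq> 0" "- \<zeta> = l'\<^sup>2"
  shows "fock s H Ld Pd (- k) (- \<zeta>) l'"
proof -
  interpret D: fvmod s H Ld Pd "- k" "- \<zeta>" by (rule dual)
  interpret D: fvmod_charged s H Ld Pd "- k" "- \<zeta>" l' by unfold_locales (use l' in auto)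
  obtain N where N: "\<And>n. p (- int n - 1) w \<noteq> 0 \<Longrightarrow> n < N"
    using w(3) finite_nat_set_iff_bounded by auto
  have "p (- 1 * r) w = 0" if "r \<ge> int N + 1" for r
  proof -
    have "- int (nat (r - 1)) - 1 = - 1 * r" "\<not> nat (r - 1) < N" using that by auto
    then show ?thesis using N[of "nat (r - 1)"] by metis
  qed
  then have wM: "\<exists>M. \<forall>r\<ge>M. p (- 1 * r) w = 0" by blast
  have all: "\<exists>M. \<forall>r\<ge>M. p (- 1 * r) v = 0" if "v \<in> C" for v
    by (rule finite_action_all[OF _ w(1,2) wM that]) simp
  obtain \<alpha> f q where f: "f \<in> wt \<alpha>" "f \<noteq> 0" "f \<in> H q" by (rule ex_wt)
  obtain B' where B': "finite B'" "wt \<alpha> = span B'" by (rule wt_fin')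
  have B'C: "b \<in> C" if "b \<in> B'" for b using that B'(2) span_base wt_C by blast
  have "\<forall>b\<in>B'. \<exists>M. \<forall>r\<ge>M. p (- 1 * r) b = 0" using all B'C by blast
  then obtain m where m: "\<And>b r. b \<in> B' \<Longrightarrow> r \<ge> m b \<Longrightarrow> p (- 1 * r) b = 0" by metis
  define M where "M = Max (insert 0 (m ` B'))"
  have mM: "m b \<le> M" if "b \<in> B'" for b unfolding M_def using B'(1) that by (intro Max_ge) auto
  have kill: "p (- 1 * r) v = 0" if r: "r \<ge> M" and v: "v \<in> wt \<alpha>" for r v
  proof -
    have "p (- 1 * r) v \<in> {0}"
    proof (rule lin_on_span_subset[OF p_lin C_sub])
      show "v \<in> span B'" using v B' by simp
      show "p (- 1 * r) b \<in> {0}" if "b \<in> B'" for b using m[OF that, of r] mM[OF that] r by auto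
    qed (use B'C in \<open>auto simp: subspace_def\<close>)
    then show ?thesis by simp
  qed
  have fC: "f \<in> C" using f wt_C by blast
  have Pdf: "Pd (int n) f = 0" if n: "int n + 1 \<ge> M" for n
  proof -
    \<comment> \<open>The product is tested instead of \<open>Pd (int n) f\<close>: it preserves
      weights, so the bound \<open>M\<close> for a single weight space suffices. Afterwards
      \<open>num_0\<close> returns to the single factor.\<close>
    define h where "h = Pd (- int n - 1) (Pd (int n) f)"
    have "h = 0"
    proof (rule form_eqI)
      fix b assume b: "b \<in> B"
      then have bC: "b \<in> C" by (rule B_C)
      obtain \<beta> q' where bw: "b \<in> wt \<beta>" using B_cases[OF b] by blast
      have "form h b = - form f (P (int n) (P (- int n - 1) b))"
        unfolding h_def by (rule form_Pd_Pd[OF bC])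
      also have "\<dots> = 0"
      proof (cases "\<beta> = \<alpha>")
        case True
        then have "p (- 1 * (int n + 1)) b = 0" using kill[OF n] bw by simp
        then have "P (- int n - 1) b = 0" by (simp add: P_p)
        then show ?thesis by (simp add: form_right)
      next
        case False
        have "\<beta> - half (- int n - 1) - half (int n) = \<beta>" by (simp add: half_def)
        then have "P (int n) (P (- int n - 1) b) \<in> wt \<beta>" using wt_P[OF wt_P[OF bw, of "- int n - 1"], of "int n"] by metis
        then show ?thesis using form_wt[OF f(1)] False by auto
      qed
      finally show "form h b = form 0 b" by (simp add: form_left)
    qed (simp_all add: h_def)
    then have "D.p (- int n - 1) (D.p (int n) f) = 0" using fC by (simp add: D.p_def h_def)
    then have "D.p (int n) f = 0" using D.num_0[of f n] fC by (simp add: D.num_def)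
    then show ?thesis using D.P_p by simp
  qed
  have "finite {n::nat. D.p (int n) f \<noteq> 0}"
  proof (rule finite_subset)
    show "{n::nat. D.p (int n) f \<noteq> 0} \<subseteq> {..nat M}"
    proof
      fix n assume "n \<in> {n::nat. D.p (int n) f \<noteq> 0}"
      then have "\<not> int n + 1 \<ge> M" using Pdf by (auto simp: D.p_def)
      then show "n \<in> {..nat M}" by auto
    qed
  qed simp
  then show ?thesis using D.ex_vacuum[OF f(3,2)] by unfold_locales
qed

end

text \<open>A nonzero polynomial \<open>q\<close> of least degree with \<open>q(T) x = 0\<close> has
  a complex root \<open>z\<close>; dividing it by \<open>X - z\<close> gives a polynomial that maps
  \<open>x\<close> to an eigenvector.\<close>

lemma (in cspace) ex_eigenvector:
  assumes T: "lin_on U T" and U: "subspace U" "finite B" "U \<subseteq> span B" and x: "x \<in> U" "x \<noteq> 0"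
  shows "\<exists>c. \<exists>u\<in>U. u \<noteq> 0 \<and> T u = s c u"
proof -
  define f where "f i = (T ^^ i) x" for i
  have fU: "f i \<in> U" for i by (induction i) (use x lin_onD(1)[OF T] in \<open>auto simp: f_def\<close>)
  have fS: "f (Suc i) = T (f i)" for i by (simp add: f_def)
  define ev where "ev q = (\<Sum>i\<le>degree q. s (coeff q i) (f i))" for q
  have ev: "ev q = (\<Sum>i\<le>n. s (coeff q i) (f i))" if "degree q \<le> n" for q n
    unfolding ev_def by (rule sum.mono_neutral_left) (use that in \<open>auto simp: coeff_eq_0\<close>)
  have evU: "ev q \<in> U" for q unfolding ev_def by (intro subspace_sum[OF U(1)] subspace_scale[OF U(1)] fU)
  have mult: "ev ([:- z, 1:] * r) = T (ev r) - s z (ev r)" for z r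
  proof -
    have d: "degree ([:- z, 1:] * r) \<le> Suc (degree r)"
      using degree_mult_le[of "[:- z, 1:]" r] by simp
    have e: "[:- z, 1:] * r = smult (- z) r + pCons 0 r" by simp
    have "ev ([:- z, 1:] * r) = (\<Sum>i\<le>Suc (degree r). s (- z * coeff r i) (f i)) + (\<Sum>i\<le>Suc (degree r). s (coeff (pCons 0 r) i) (f i))"
      unfolding ev[OF d] unfolding e by (simp only: coeff_add coeff_smult scale_left_distrib sum.distrib)
    also have "(\<Sum>i\<le>Suc (degree r). s (- z * coeff r i) (f i)) = s (- z) (ev r)"
      by (simp add: ev_def scale_sum_right coeff_eq_0)
    also have "(\<Sum>i\<le>Suc (degree r). s (coeff (pCons 0 r) i) (f i)) = (\<Sum>i\<le>degree r. s (coeff r i) (f (Suc i)))"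
      by (subst sum.atMost_Suc_shift) simp
    also have "\<dots> = T (ev r)"
      unfolding ev_def fS using fU by (subst lin_on_sum[OF T U(1)]) (auto simp: lin_onD[OF T] subspace_scale[OF U(1)])
    finally show ?thesis by simp
  qed
  have "\<exists>c. (\<exists>i\<in>{..card B}. c i \<noteq> 0) \<and> (\<Sum>i\<in>{..card B}. s (c i) (f i)) = 0"
    by (rule dependent_family[OF _ U(2)]) (use fU U in auto)
  then obtain c i where c: "i \<le> card B" "c i \<noteq> 0" "(\<Sum>i\<le>card B. s (c i) (f i)) = 0" by auto
  define q0 where "q0 = (\<Sum>j\<le>card B. monom (c j) j)"
  have q0c: "coeff q0 j = (if j \<le> card B then c j else 0)" for j
    by (simp add: q0_def coeff_sum)
  have "degree q0 \<le> card B" by (rule degree_le) (simp add: q0c)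
  then have "ev q0 = 0" using ev[of q0 "card B"] c(3) by (simp add: q0c)
  moreover have "q0 \<noteq> 0" using q0c[of i] c by auto
  ultimately have ex: "\<exists>n q. q \<noteq> 0 \<and> ev q = 0 \<and> degree q = n" by blast
  define n where "n = (LEAST n. \<exists>q. q \<noteq> 0 \<and> ev q = 0 \<and> degree q = n)"
  obtain q where q: "q \<noteq> 0" "ev q = 0" "degree q = n" using LeastI_ex[OF ex] unfolding n_def by blast
  have min: "ev r \<noteq> 0" if "r \<noteq> 0" "degree r < n" for r
    using not_less_Least[of "degree r" "\<lambda>n. \<exists>q. q \<noteq> 0 \<and> ev q = 0 \<and> degree q = n"] that by (auto simp: n_def)
  have "degree q \<noteq> 0"
  proof
    assume "degree q = 0"
    then have "ev q = s (coeff q 0) x" by (simp add: ev_def f_def)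
    then show False using q x \<open>degree q = 0\<close> leading_coeff_0_iff[of q] by simp
  qed
  then have "\<not> constant (poly q)" by (simp add: constant_degree)
  then obtain z where "poly q z = 0" using fundamental_theorem_of_algebra by blast
  then obtain r where r: "q = [:- z, 1:] * r" by (metis dvdE poly_eq_0_iff_dvd)
  have "r \<noteq> 0" using q r by auto
  then have "degree q = Suc (degree r)" using r by (simp add: degree_mult_eq del: mult_pCons_left)
  then have "ev r \<noteq> 0" using min[OF \<open>r \<noteq> 0\<close>] q by simp
  moreover have "T (ev r) = s z (ev r)" using mult[of z r] q r by simp
  ultimately show ?thesis using evU by blast
qed

section \<open>The classification\<close>

locale hc_module =
  fixes W :: "'a::ab_group_add smod"
  assumes simple_W: "simple_supermodule FVir W" and hc_W: "harish_chandra W"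
begin

sublocale cspace "scal W"
  using simple_W by (simp add: cspace_def simple_supermodule_def supermodule_def)

abbreviation ua :: "gen \<Rightarrow> 'a \<Rightarrow> 'a" where "ua g \<equiv> act W (unit_vec g)"

lemma supermodule_W: "supermodule FVir W"
  using simple_W by (simp add: simple_supermodule_def)

lemma part_sub: "subspace (part W q)" and part_int: "part W False \<inter> part W True = {0}"
  using supermodule_W by (simp_all add: supermodule_def)

lemma act_right: "v \<in> carr W \<Longrightarrow> w \<in> carr W \<Longrightarrow> act W x (v + w) = act W x v + act W x w"
    "v \<in> carr W \<Longrightarrow> act W x (scal W a v) = scal W a (act W x v)"
  and act_left: "v \<in> carr W \<Longrightarrow> act W (x + y) v = act W x v + act W y v"
    "v \<in> carr W \<Longrightarrow> act W (pscale a x) v = scal W a (act W x v)"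
  and act_part: "x \<in> fvir_part p \<Longrightarrow> v \<in> part W q \<Longrightarrow> act W x v \<in> part W (p \<noteq> q)"
  and act_bracket: "x \<in> fvir_part p \<Longrightarrow> y \<in> fvir_part q \<Longrightarrow> v \<in> carr W \<Longrightarrow> act W (bracket x y) v =
          act W x (act W y v) - scal W (if p \<and> q then - 1 else 1) (act W y (act W x v))"
  using supermodule_W unfolding supermodule_def by simp_all

lemma carr_sub: "subspace (carr W)"
  unfolding carr_def by (intro subspace_sums part_sub)

lemma part_carr: "v \<in> part W q \<Longrightarrow> v \<in> carr W"
  unfolding carr_def using subspace_0[OF part_sub] by (cases q) (force intro: exI[of _ 0])+

lemma part_unique:
  assumes "a \<in> part W False" "a' \<in> part W False" "b \<in> part W True" "b' \<in> part W True" "a + b = a' + b'"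
  shows "a = a'" "b = b'"
proof -
  have "a - a' = b' - b" using assms(5) by (simp add: algebra_simps)
  moreover have "a - a' \<in> part W False" "b' - b \<in> part W True" using assms subspace_diff[OF part_sub] by auto
  ultimately have "a - a' = 0" "b' - b = 0" using part_int by (metis IntI singletonD)+
  then show "a = a'" "b = b'" by auto
qed

lemma unit_part: "unit_vec g \<in> fvir_part (gen_parity g)"
  by (simp add: fvir_part_def)

lemma ua_part: "v \<in> part W q \<Longrightarrow> ua g v \<in> part W (gen_parity g \<noteq> q)"
  by (rule act_part[OF unit_part])

lemma ua_lin: "lin_on (carr W) (ua g)"
proof -
  have "ua g v \<in> carr W" if v: "v \<in> carr W" for v
  proof -
    obtain a b where ab: "a \<in> part W False" "b \<in> part W True" "v = a + b" using v by (auto simp: carr_def)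
    then show ?thesis
      using act_right(1)[OF part_carr part_carr, of a False b True] subspace_add[OF carr_sub]
        part_carr[OF ua_part[of a False g]] part_carr[OF ua_part[of b True g]] by simp
  qed
  then show ?thesis by (simp add: lin_on_def act_right)
qed

lemma ua_carr: "v \<in> carr W \<Longrightarrow> ua g v \<in> carr W"
  by (rule lin_onD(1)[OF ua_lin])

lemma act_0: "v \<in> carr W \<Longrightarrow> act W 0 v = 0"
  using act_left(2)[of v 0 0] by simp

lemma act_single: "v \<in> carr W \<Longrightarrow> act W (Poly_Mapping.single g c) v = scal W c (ua g v)"
  by (subst single_pscale) (rule act_left(2))

lemma act_ua: assumes "v \<in> carr W" shows "act W x v = lin_extend (scal W) (\<lambda>g. ua g v) x"
  by (rule poly_mapping_lin_eqI[where s = "scal W" and f = "\<lambda>x. act W x v" and g = "lin_extend (scal W) (\<lambda>g. ua g v)"])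
    (simp_all add: assms act_left lin_extend_add lin_extend_pscale cspace_axioms)

lemma ua_bracket:
  assumes "v \<in> carr W"
  shows "act W (gen_bracket g h) v =
    ua g (ua h v) - scal W (if gen_parity g \<and> gen_parity h then - 1 else 1) (ua h (ua g v))"
  using act_bracket[OF unit_part unit_part assms, of g h] by (simp add: bracket_unit ps.lin_extend_single)

lemma submodule_all:
  assumes N: "subspace N" "N \<subseteq> carr W" "\<And>v. v \<in> N \<Longrightarrow> \<exists>a\<in>N \<inter> part W False. \<exists>b\<in>N \<inter> part W True. v = a + b"
    and cl: "\<And>g v. v \<in> N \<Longrightarrow> ua g v \<in> N"
  shows "N = {0} \<or> N = carr W"
proof -
  have Neq: "N = {a + b |a b. a \<in> N \<inter> part W False \<and> b \<in> N \<inter> part W True}"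
  proof
    show "N \<subseteq> {a + b |a b. a \<in> N \<inter> part W False \<and> b \<in> N \<inter> part W True}" using N(3) by blast
    show "{a + b |a b. a \<in> N \<inter> part W False \<and> b \<in> N \<inter> part W True} \<subseteq> N"
      using subspace_add[OF N(1)] by auto
  qed
  have act: "act W x v \<in> N" if "v \<in> N" for x v
  proof -
    have "v \<in> carr W" using that N(2) by blast
    have "scal W c (ua g v) \<in> N" for c g by (rule subspace_scale[OF N(1) cl[OF that]])
    then show ?thesis
      by (subst act_ua[OF \<open>v \<in> carr W\<close>]) (simp add: lin_extend_def subspace_sum[OF N(1)])
  qed
  have "graded_submodule FVir W N" unfolding graded_submodule_def
    by (intro conjI ballI) (rule N(1) N(2) Neq act, assumption?)+
  then show ?thesis using simple_W unfolding simple_supermodule_def by (elim conjE allE[of _ N] impE)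
qed

lemma weight_space_sub: "subspace (weight_space W \<alpha>)"
  using carr_sub unfolding weight_space_def
  by (intro subspaceI) (auto simp: subspace_0 subspace_add subspace_scale lin_on_0[OF ua_lin]
      act_right scale_right_distrib mult.commute)

lemma ex_weight_vector: "\<exists>\<alpha> v. v \<in> weight_space W \<alpha> \<and> v \<noteq> 0"
proof (rule ccontr)
  assume "\<not> ?thesis"
  then have "(\<Union>\<alpha>. weight_space W \<alpha>) \<subseteq> {0}" by auto
  then have "span (\<Union>\<alpha>. weight_space W \<alpha>) \<subseteq> {0}"
    by (rule span_minimal) simp
  then have "carr W \<subseteq> {0}" using hc_W by (simp add: harish_chandra_def weight_module_def)
  then show False using simple_W subspace_0[OF carr_sub] by (auto simp: simple_supermodule_def)
qed

text \<open>A central element commutes with \<open>L 0\<close> and so preserves a finite-dimensional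
  weight space, where it has an eigenvector. As it is even, its eigenspace is graded.\<close>

lemma central_scalar:
  assumes g: "g = GenC \<or> g = GenZ"
  shows "\<exists>c. \<forall>v\<in>carr W. ua g v = scal W c v"
proof -
  have even: "\<not> gen_parity g" using g by auto
  have comm: "ua g (ua h v) = ua h (ua g v)" if "v \<in> carr W" for h v
  proof -
    have "gen_bracket g h = 0" using g by auto
    then show ?thesis using ua_bracket[OF that, of g h] act_0[OF that] even by simp
  qed
  obtain \<alpha> x where x: "x \<in> weight_space W \<alpha>" "x \<noteq> 0" using ex_weight_vector by blast
  obtain B where B: "finite B" "weight_space W \<alpha> = span B" using hc_W by (auto simp: harish_chandra_def)
  have "lin_on (weight_space W \<alpha>) (ua g)"
    using comm[of _ "GenL 0", symmetric] by (auto simp: lin_on_def weight_space_def act_right ua_carr)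
  then obtain c u where u: "u \<in> weight_space W \<alpha>" "u \<noteq> 0" "ua g u = scal W c u"
    using ex_eigenvector[OF _ weight_space_sub B(1) _ x] B(2) by blast
  define N where "N = {v \<in> carr W. ua g v = scal W c v}"
  have "N = {0} \<or> N = carr W"
  proof (rule submodule_all)
    show "subspace N" unfolding N_def using carr_sub
      by (intro subspaceI) (auto simp: subspace_0 subspace_add subspace_scale lin_on_0[OF ua_lin]
          act_right scale_right_distrib mult.commute)
    show "N \<subseteq> carr W" by (auto simp: N_def)
    show "ua h v \<in> N" if "v \<in> N" for h v
      using that by (simp add: N_def ua_carr comm act_right)
    fix v assume v: "v \<in> N"
    then obtain a b where ab: "a \<in> part W False" "b \<in> part W True" "v = a + b" by (auto simp: carr_def N_def)
    have abC: "a \<in> carr W" "b \<in> carr W" using ab part_carr by auto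
    have sum: "ua g a + ua g b = scal W c a + scal W c b"
      using v by (simp add: N_def ab(3) act_right(1)[OF abC] scale_right_distrib)
    have "ua g a \<in> part W False" "ua g b \<in> part W True"
      using ua_part[OF ab(1), of g] ua_part[OF ab(2), of g] even by simp_all
    then have "ua g a = scal W c a" "ua g b = scal W c b"
      using part_unique[of "ua g a" "scal W c a" "ua g b" "scal W c b"] sum subspace_scale[OF part_sub] ab by auto
    then show "\<exists>a\<in>N \<inter> part W False. \<exists>b\<in>N \<inter> part W True. v = a + b"
      using ab abC by (intro bexI[of _ a] bexI[of _ b]) (auto simp: N_def)
  qed
  moreover have "u \<in> N" using u by (simp add: N_def weight_space_def)
  ultimately have "N = carr W" using u(2) by auto
  then show ?thesis unfolding N_def by blast
qed

lemma ex_fvmod: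
  obtains k \<zeta> where "fvmod (scal W) (part W) (\<lambda>m. ua (GenL m)) (\<lambda>r. ua (GenPsi r)) k \<zeta>"
    "\<And>x v. v \<in> carr W \<Longrightarrow>
       act W x v = fvmod.lact (scal W) (\<lambda>m. ua (GenL m)) (\<lambda>r. ua (GenPsi r)) k \<zeta> x v"
proof -
  obtain k where k: "\<And>v. v \<in> carr W \<Longrightarrow> ua GenC v = scal W k v" using central_scalar by blast
  obtain \<zeta> where \<zeta>: "\<And>v. v \<in> carr W \<Longrightarrow> ua GenZ v = scal W \<zeta> v" using central_scalar by blast
  interpret fvmod "scal W" "part W" "\<lambda>m. ua (GenL m)" "\<lambda>r. ua (GenPsi r)" k \<zeta>
  proof unfold_locales
    show "lin_on (hsum (part W)) (ua (GenL m))" "lin_on (hsum (part W)) (ua (GenPsi m))" for m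
      using ua_lin by (simp_all add: carr_hsum)
    show "ua (GenL m) v \<in> part W q" if "v \<in> part W q" for m q v
      using ua_part[OF that, of "GenL m"] by simp
    show "ua (GenPsi r) v \<in> part W (\<not> q)" if "v \<in> part W q" for r q v
      using ua_part[OF that, of "GenPsi r"] by simp
    show "ua (GenL m) (ua (GenL n) v) - ua (GenL n) (ua (GenL m) v) =
        scal W (of_int (m - n)) (ua (GenL (m + n)) v) +
        (if m = - n then scal W ((of_int m ^ 3 - of_int m) / 12 * k) v else 0)"
      if "v \<in> hsum (part W)" for m n v
    proof -
      have v: "v \<in> carr W" using that by (simp add: carr_hsum)
      have "act W (gen_bracket (GenL m) (GenL n)) v = scal W (of_int (m - n)) (ua (GenL (m + n)) v) +
          (if m = - n then scal W ((of_int m ^ 3 - of_int m) / 12) (scal W k v) else 0)"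
        by (simp only: gen_bracket.simps act_left(1)[OF v] if_distrib[where f = "\<lambda>x. act W x v"] act_0[OF v]
            act_single[OF v, of "GenL (m + n)" "of_int (m - n)"]
            act_single[OF v, of GenC "(of_int m ^ 3 - of_int m) / 12"] k[OF v])
      then show ?thesis unfolding ua_bracket[OF v]
        by (simp only: gen_parity.simps simp_thms if_False scale_one scale_scale)
    qed
    show "ua (GenL m) (ua (GenPsi r) v) - ua (GenPsi r) (ua (GenL m) v) =
        scal W (- half r - of_int m / 2) (ua (GenPsi (m + r)) v)"
      if "v \<in> hsum (part W)" for m r v
    proof -
      have v: "v \<in> carr W" using that by (simp add: carr_hsum)
      show ?thesis using ua_bracket[OF v, of "GenL m" "GenPsi r"]
        by (simp add: act_single[OF v, of "GenPsi (m + r)" "- half r - of_int m / 2"])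
    qed
    show "ua (GenPsi r) (ua (GenPsi t) v) + ua (GenPsi t) (ua (GenPsi r) v) =
        (if r + t = - 1 then scal W \<zeta> v else 0)"
      if "v \<in> hsum (part W)" for r t v
    proof -
      have v: "v \<in> carr W" using that by (simp add: carr_hsum)
      show ?thesis using ua_bracket[OF v, of "GenPsi r" "GenPsi t"]
        by (cases "r + t = - 1") (simp_all add: half_eq_neg_iff act_0[OF v] \<zeta>[OF v])
    qed
    show "hsum (part W) \<subseteq> span (\<Union>\<alpha>. {v \<in> hsum (part W). ua (GenL 0) v = scal W \<alpha> v})"
      using hc_W by (simp add: harish_chandra_def weight_module_def weight_space_def carr_hsum)
    show "\<exists>B. finite B \<and> {v \<in> hsum (part W). ua (GenL 0) v = scal W \<alpha> v} = span B" for \<alpha>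
      using hc_W by (simp add: harish_chandra_def weight_space_def carr_hsum)
    show "hsum (part W) \<noteq> {0}" using simple_W by (simp add: simple_supermodule_def carr_hsum)
    fix N assume N: "subspace N" "N \<subseteq> hsum (part W)"
      "\<And>v. v \<in> N \<Longrightarrow> \<exists>a\<in>N \<inter> part W False. \<exists>b\<in>N \<inter> part W True. v = a + b"
      "\<And>m v. v \<in> N \<Longrightarrow> ua (GenL m) v \<in> N" "\<And>r v. v \<in> N \<Longrightarrow> ua (GenPsi r) v \<in> N"
    have NC: "N \<subseteq> carr W" using N(2) by (simp add: carr_hsum)
    have "ua g v \<in> N" if v: "v \<in> N" for g v
    proof -
      have vC: "v \<in> carr W" using v NC by blast
      show ?thesis
        using N(4,5)[OF v] k[OF vC] \<zeta>[OF vC] subspace_scale[OF N(1) v] by (cases g) simp_all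
    qed
    then show "N = {0} \<or> N = hsum (part W)" using submodule_all[OF N(1) NC N(3)] by (simp add: carr_hsum)
  qed (rule part_sub, rule part_int)
  have "act W x v = lact x v" if v: "v \<in> carr W" for x v
  proof -
    have "ua g v = gact g v" for g by (cases g) (simp_all add: gact_def k[OF v] \<zeta>[OF v])
    then show ?thesis by (subst act_ua[OF v]) (simp add: lact_def)
  qed
  then show ?thesis using that fvmod_axioms by blast
qed

lemma inflated_case:
  assumes "\<And>r v. v \<in> carr W \<Longrightarrow> ua (GenPsi r) v = 0" "\<And>v. v \<in> carr W \<Longrightarrow> ua GenZ v = 0"
  shows "simple_supermodule Vir W" "smod_iso FVir W (inflate W)"
proof -
  have vp: "act W (vir_part x) v = act W x v" if v: "v \<in> carr W" for x v
  proof (rule poly_mapping_lin_eqI[where s = "scal W" and f = "\<lambda>x. act W (vir_part x) v" and g = "\<lambda>x. act W x v"])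
    show "act W (vir_part (unit_vec g)) v = act W (unit_vec g) v" for g
      by (cases g) (simp_all add: vir_part_def assms v act_0)
  qed (simp_all add: act_left v vir_part_lin cspace_axioms)
  show "smod_iso FVir W (inflate W)" unfolding smod_iso_def
    by (rule exI[of _ id]) (simp add: vp)
  have "N = {0} \<or> N = carr W" if N: "graded_submodule Vir W N" for N
  proof (rule submodule_all)
    show "subspace N" "N \<subseteq> carr W" using N by (simp_all add: graded_submodule_def)
    show "\<exists>a\<in>N \<inter> part W False. \<exists>b\<in>N \<inter> part W True. v = a + b" if "v \<in> N" for v
      using N that unfolding graded_submodule_def by blast
    show "ua g v \<in> N" if v: "v \<in> N" for g v
    proof -
      have vC: "v \<in> carr W" using v \<open>N \<subseteq> carr W\<close> by blast
      have "act W x v \<in> N" if "x \<in> Vir" for x using N v that by (simp add: graded_submodule_def)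
      then show ?thesis using assms vC unit_Vir subspace_0[OF \<open>subspace N\<close>] by (cases g) simp_all
    qed
  qed
  moreover have "supermodule Vir W" using supermodule_W unfolding supermodule_def by simp
  ultimately show "simple_supermodule Vir W" using simple_W by (simp add: simple_supermodule_def)
qed

end

theorem theorem5p5:
  fixes W :: "'a::ab_group_add smod"
  assumes "simple_supermodule FVir W" and "harish_chandra W"
  shows
    "(\<exists>V :: 'a smod. simple_supermodule Vir V \<and> harish_chandra V \<and>
        smod_iso FVir W (inflate V)) \<or>
     (\<exists>(l :: complex) (V :: 'a smod). l \<noteq> 0 \<and> simple_supermodule Vir V \<and> highest_weight V \<and>
        smod_iso FVir W (tensor (twist l ext_module) (inflate V))) \<or>
     (\<exists>(l :: complex) (V :: 'a smod). l \<noteq> 0 \<and> simple_supermodule Vir V \<and> highest_weight V \<and>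
        smod_iso FVir W (rdual (tensor (twist l ext_module) (inflate V))))"
proof -
  interpret W: hc_module W using assms by unfold_locales
  let ?L = "\<lambda>m. act W (unit_vec (GenL m))"
  let ?P = "\<lambda>r. act W (unit_vec (GenPsi r))"
  obtain k \<zeta> where fv: "fvmod (scal W) (part W) ?L ?P k \<zeta>"
    and lact: "\<And>x v. v \<in> carr W \<Longrightarrow> act W x v = fvmod.lact (scal W) ?L ?P k \<zeta> x v"
    by (rule W.ex_fvmod) (rule that; blast)
  interpret F: fvmod "scal W" "part W" ?L ?P k \<zeta> by (rule fv)
  have C: "F.C = carr W" by (simp add: carr_hsum)
  show ?thesis
  proof (cases "\<zeta> = 0")
    case True
    have "?P r v = 0" if "v \<in> carr W" for r v using F.central_zero_annih[OF True] that C by simp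
    moreover have "act W (unit_vec GenZ) v = 0" if "v \<in> carr W" for v
      using lact[OF that, of "unit_vec GenZ"] F.lact_left(3)[of GenZ v] F.gact_def[of GenZ v] by (simp add: True)
    ultimately show ?thesis using W.inflated_case assms(2) by blast
  next
    case False
    define l where "l = csqrt \<zeta>"
    \<comment> \<open>z acts on the dual by - \<zeta>, so the exterior factor there needs a square
      root of - \<zeta>.\<close>
    define l' where "l' = csqrt (- \<zeta>)"
    have l: "l \<noteq> 0" "\<zeta> = l\<^sup>2" and l': "l' \<noteq> 0" "- \<zeta> = l'\<^sup>2" using False by (simp_all add: l_def l'_def)
    interpret F: fvmod_charged "scal W" "part W" ?L ?P k \<zeta> l by unfold_locales (rule l)+
    show ?thesis
    proof (rule F.vacuum_dichotomy)
      fix w q assume w: "w \<in> part W q" "w \<noteq> 0" "finite {n::nat. F.p (int n) w \<noteq> 0}"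
      interpret F: fock "scal W" "part W" ?L ?P k \<zeta> l
        using F.ex_vacuum[OF w] by unfold_locales
      have "smod_iso FVir W F.TM" unfolding smod_iso_def
      proof (intro exI[of _ F.phi] conjI ballI allI)
        show "bij_betw F.phi (carr W) (carr F.TM)" using F.phi_bij by (simp only: C)
        show "F.phi (v + w) = F.phi v + F.phi w" if "v \<in> carr W" "w \<in> carr W" for v w
          using that F.phi_add by (simp only: C)
        show "F.phi (scal W a v) = scal F.TM a (F.phi v)" if "v \<in> carr W" for v a
          using that F.phi_scale[of v a] by (simp add: C tensor_def)
        show "F.phi ` part W q \<subseteq> part F.TM q" for q by (simp add: F.phi_sum_part)
        show "F.phi (act W x v) = act F.TM x (F.phi v)" if "v \<in> carr W" for x v
          unfolding lact[OF that] by (rule F.phi_act) (simp add: C that)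
      qed
      then show ?thesis
        by (intro disjI2[OF disjI1] exI[of _ l] exI[of _ F.VM] conjI l(1) F.VM_simple F.VM_highest)
    next
      fix w assume w: "w \<in> F.C" "w \<noteq> 0" "finite {n::nat. F.p (- int n - 1) w \<noteq> 0}"
      \<comment> \<open>\<open>D.TM\<close> is a tensor product of the second kind isomorphic to the
        dual; \<open>rdual_iso\<close> turns this into a statement on the module itself.\<close>
      interpret D: fock "scal W" "part W" F.Ld F.Pd "- k" "- \<zeta>" l' by (rule F.dual_fock[OF w l'])
      show ?thesis
      proof (rule F.rdual_iso[OF D.phi_bij D.phi_add _ D.phi_sum_part D.phi_act])
        show "D.phi (scal W c v) = scal D.TM c (D.phi v)" if "v \<in> F.C" for v c
          using D.phi_scale[OF that] by (simp add: tensor_def)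
      next
        fix \<Phi>
        assume \<Phi>: "bij_betw \<Phi> F.C (carr (rdual D.TM))"
          "\<And>v w. v \<in> F.C \<Longrightarrow> w \<in> F.C \<Longrightarrow> \<Phi> (v + w) = \<Phi> v + \<Phi> w"
          "\<And>v c. v \<in> F.C \<Longrightarrow> \<Phi> (scal W c v) = scal (rdual D.TM) c (\<Phi> v)"
          "\<And>q. \<Phi> ` part W q \<subseteq> part (rdual D.TM) q"
          "\<And>x v. v \<in> F.C \<Longrightarrow> \<Phi> (F.lact x v) = act (rdual D.TM) x (\<Phi> v)"
        have "smod_iso FVir W (rdual D.TM)" unfolding smod_iso_def
        proof (intro exI[of _ \<Phi>] conjI ballI allI)
          show "\<Phi> (act W x v) = act (rdual D.TM) x (\<Phi> v)" if "v \<in> carr W" for x v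
          proof -
            have v: "v \<in> F.C" unfolding C by (rule that)
            have "act W x v = F.lact x v" by (rule lact[OF that])
            then have "\<Phi> (act W x v) = \<Phi> (F.lact x v)" by (rule arg_cong)
            also note \<Phi>(5)[OF v]
            finally show ?thesis .
          qed
        qed (use \<Phi>(1-4) in \<open>simp_all only: C\<close>)
        then show ?thesis
          by (intro disjI2 exI[of _ l'] exI[of _ D.VM] conjI l'(1) D.VM_simple D.VM_highest)
      qed
    qed
  qed
qed

end
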